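(* Let $X\subset\mathbb R^2$ be a smooth plane dendroid. If $E(X)$ is hereditarily disconnected and $1$-dimensional, then $X$ contains a Cantor set of arcs.
   Context: A continuum is a compact connected metric space. It is hereditarily unicoherent if every two of its subcontinua have connected intersection. A dendroid is a hereditarily unicoherent, arcwise connected continuum (hence uniquely arcwise connected); for $x,y$ in a dendroid $X$, $\alpha(x,y)$ denotes the unique arc in $X$ with endpoints $x$ and $y$ (with $\alpha(x,x)=\{x\}$). A plane dendroid is a dendroid $X\subset\mathbb R^2$. A dendroid $X$ is smooth if there exists $p\in X$ such that whenever $x_n\to x$ in $X$, $\alpha(x_n,p)\to\alpha(x,p)$ in the Hausdorff distance. A point $e\in X$ is an endpoint if $e$ is an endpoint of every arc in $X$ that contains it; $E(X)$ is the set of all endpoints of $X$, with the subspace topology. A space is hereditarily disconnected if it contains no non-degenerate (more than one point) connected subset. Dimension is the topological dimension of separable metrizable spaces. A Cantor set of arcs is a continuous collection of pairwise-disjoint arcs whose decomposition space is a Cantor set (i.e. a family $\{A_c:c\in C\}$ of pairwise disjoint arcs indexed by a Cantor set $C$ such that $c\mapsto A_c$ is continuous with respect to the Hausdorff distance). *)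

theory Defs
  imports "HOL-Analysis.Analysis"
begin

subsection \<open>Arcs, continua and dendroids\<close>

text \<open>Arcs as point sets. The library predicate \<^const>\<open>arc\<close> is about injective
  parametrizations by the unit interval, so the two endpoints are always distinct.\<close>

definition arc_from_to :: "'a::topological_space set \<Rightarrow> 'a \<Rightarrow> 'a \<Rightarrow> bool" where
  "arc_from_to A x y \<longleftrightarrow>
     (\<exists>g. arc g \<and> path_image g = A \<and> pathstart g = x \<and> pathfinish g = y)"

definition is_arc :: "'a::topological_space set \<Rightarrow> bool" where
  "is_arc A \<longleftrightarrow> (\<exists>x y. arc_from_to A x y)"

definition continuum :: "'a::metric_space set \<Rightarrow> bool" where
  "continuum X \<longleftrightarrow> compact X \<and> connected X"

definition hereditarily_unicoherent :: "'a::metric_space set \<Rightarrow> bool" where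
  "hereditarily_unicoherent X \<longleftrightarrow>
     (\<forall>K L. continuum K \<and> K \<subseteq> X \<and> continuum L \<and> L \<subseteq> X \<longrightarrow> connected (K \<inter> L))"

definition arcwise_connected :: "'a::topological_space set \<Rightarrow> bool" where
  "arcwise_connected X \<longleftrightarrow>
     (\<forall>x\<in>X. \<forall>y\<in>X. x \<noteq> y \<longrightarrow> (\<exists>A. A \<subseteq> X \<and> arc_from_to A x y))"

definition dendroid :: "'a::metric_space set \<Rightarrow> bool" where
  "dendroid X \<longleftrightarrow> continuum X \<and> hereditarily_unicoherent X \<and> arcwise_connected X"

text \<open>The description below is proper only if \<open>X\<close> is uniquely arcwise connected,
  which every dendroid is.\<close>

definition the_arc :: "'a::metric_space set \<Rightarrow> 'a \<Rightarrow> 'a \<Rightarrow> 'a set" where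
  "the_arc X x y = (if x = y then {x} else (THE A. A \<subseteq> X \<and> arc_from_to A x y))"

text \<open>Meaningful for nonempty bounded sets only; it is applied to nonempty compact sets.\<close>

definition hausdorff_dist :: "'a::metric_space set \<Rightarrow> 'a set \<Rightarrow> real" where
  "hausdorff_dist A B = max (SUP a\<in>A. infdist a B) (SUP b\<in>B. infdist b A)"

definition smooth_dendroid :: "'a::metric_space set \<Rightarrow> bool" where
  "smooth_dendroid X \<longleftrightarrow> dendroid X \<and>
     (\<exists>p\<in>X. \<forall>s x. (\<forall>n. s n \<in> X) \<and> x \<in> X \<and> s \<longlonglongrightarrow> x \<longrightarrow>
        (\<lambda>n. hausdorff_dist (the_arc X (s n) p) (the_arc X x p)) \<longlonglongrightarrow> 0)"

definition endpoints :: "'a::topological_space set \<Rightarrow> 'a set" where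
  "endpoints X =
     {e \<in> X. \<forall>A x y. A \<subseteq> X \<and> arc_from_to A x y \<and> e \<in> A \<longrightarrow> e = x \<or> e = y}"


subsection \<open>Disconnectedness and dimension\<close>

definition hereditarily_disconnected :: "'a::topological_space set \<Rightarrow> bool" where
  "hereditarily_disconnected S \<longleftrightarrow>
     (\<forall>C. C \<subseteq> S \<and> connected C \<longrightarrow> (\<forall>x\<in>C. \<forall>y\<in>C. x = y))"

text \<open>Small inductive dimension, which agrees with the large inductive and the covering
  dimension on separable metrizable spaces. For \<open>n = -1\<close> the premise cannot be met at any
  point, so exactly the empty space has dimension at most \<open>-1\<close>.\<close>

inductive dimension_le :: "'a topology \<Rightarrow> int \<Rightarrow> bool" where
  "\<lbrakk>-1 \<le> n;
    \<And>V a. \<lbrakk>openin X V; a \<in> V\<rbrakk> \<Longrightarrow>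
      \<exists>W. a \<in> W \<and> W \<subseteq> V \<and> openin X W \<and>
          dimension_le (subtopology X (X frontier_of W)) (n - 1)\<rbrakk>
   \<Longrightarrow> dimension_le X n"

definition has_dimension :: "'a topology \<Rightarrow> int \<Rightarrow> bool" where
  "has_dimension X n \<longleftrightarrow> dimension_le X n \<and> \<not> dimension_le X (n - 1)"


subsection \<open>Cantor sets of arcs\<close>

text \<open>The type \<^typ>\<open>nat \<Rightarrow> bool\<close> carries the product topology of the discrete
  two-point space.\<close>

definition cantor_set :: "'a::topological_space set \<Rightarrow> bool" where
  "cantor_set C \<longleftrightarrow> C homeomorphic (UNIV :: (nat \<Rightarrow> bool) set)"

text \<open>Every Cantor set is homeomorphic to a set of reals, so taking the index set there
  is no restriction.\<close>

definition cantor_set_of_arcs :: "'a::metric_space set set \<Rightarrow> bool" where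
  "cantor_set_of_arcs \<A> \<longleftrightarrow>
     (\<exists>(C :: real set) A. cantor_set C \<and> \<A> = A ` C \<and>
        (\<forall>c\<in>C. is_arc (A c)) \<and>
        disjoint_family_on A C \<and>
        (\<forall>c\<in>C. ((\<lambda>d. hausdorff_dist (A d) (A c)) \<longlongrightarrow> 0) (at c within C)))"

end

theory Submission
  imports Defs
begin

text \<open>Let \<open>p\<close> be a point at which \<open>X\<close> is smooth, let \<open>x \<le> y\<close> mean that \<open>x\<close> lies on the arc from \<open>p\<close>
  to \<open>y\<close>, and choose a continuous, strictly increasing height \<open>f\<close> on \<open>X\<close>. For heights \<open>s < t\<close> let \<open>N s t\<close>
  be the compact set of points of height \<open>s\<close> that lie below a point of height \<open>t\<close>. If some \<open>N s t\<close> is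
  uncountable, a Cantor scheme in the level \<open>f = t\<close> selects a Cantor set of points with distinct
  predecessors at height \<open>s\<close>; the arcs between the two levels form a Cantor set of arcs.

  Otherwise every \<open>N s t\<close> is countable, and the endpoints other than \<open>p\<close> are shown to be zero-dimensional.
  Every such endpoint has a small closed neighbourhood in \<open>X\<close> that is the union of the sets of points above \<open>m\<close>,
  with \<open>m\<close> in a subset of some \<open>N s t\<close>. Two facts of plane topology finish the proof. First, for given \<open>m\<close> at most
  two endpoints above \<open>m\<close> are limits of points not above \<open>m\<close> (otherwise a theta curve separates
  the connected set of points not above \<open>m\<close>), so only countably many endpoints lie on the boundary of the neighbourhood. Second,
  incomparable points have neighbourhoods that are separated by a clopen subset of the endpoints: a
  Jordan curve is formed by an arc of \<open>X\<close> and an arc outside \<open>X\<close>, and on each of its sides some continuum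
  without endpoints crosses from one of these arcs to the other; such a continuum exists because the endpoint set
  is hereditarily disconnected. Hence the boundary endpoints can be removed one by one.\<close>

text \<open>Hereditary disconnectedness is weaker than zero-dimensionality: it splits a set of
  endpoints without telling which points are separated. Planarity makes up for this. Once a
  continuum \<open>H\<close> free of endpoints crosses a side of the Jordan curve, being joined by
  continua off \<open>H\<close> within that side is a locally constant relation on the endpoints
  there, so unions of its classes are clopen. The two sides are treated separately and glued along
  the curve, which carries no endpoints outside the two given neighbourhoods. Smoothness enters
  through the order and the height. The graph of the order is closed, so the points above a compact
  set form a compact set; and \<open>X\<close> contracts to \<open>p\<close> along its arcs, so its
  complement is connected and supplies the arcs outside \<open>X\<close>. The gap between
  \<open>s\<close> and \<open>t\<close> makes the arcs of the Cantor family nondegenerate, while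
  every point of height at least \<open>t\<close> still has its predecessor in \<open>N s t\<close>.
  The point \<open>p\<close> is set aside because it may be an endpoint that is minimal rather than
  maximal in the order; adding one point preserves zero-dimensionality.\<close>

lemma arc_from_to_sym: "arc_from_to A x y \<Longrightarrow> arc_from_to A y x"
  unfolding arc_from_to_def
  by (metis arc_reversepath path_image_reversepath pathfinish_reversepath pathstart_reversepath)

lemma arc_from_to_ends: "arc_from_to A x y \<Longrightarrow> x \<in> A \<and> y \<in> A \<and> x \<noteq> y"
  unfolding arc_from_to_def
  using arc_distinct_ends pathfinish_in_path_image pathstart_in_path_image by blast

lemma arc_from_to_compact: "arc_from_to A x y \<Longrightarrow> compact A"
  for A :: "'a::real_normed_vector set"
  unfolding arc_from_to_def using compact_arc_image by blast

lemma arc_from_to_connected: "arc_from_to A x y \<Longrightarrow> connected A"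
  for A :: "'a::real_normed_vector set"
  unfolding arc_from_to_def using connected_arc_image by blast

lemma arc_from_to_closed: "arc_from_to A x y \<Longrightarrow> closed A"
  for A :: "'a::real_normed_vector set"
  using arc_from_to_compact compact_imp_closed by blast

lemma arc_from_to_join:
  fixes A :: "'a::real_normed_vector set"
  assumes "arc_from_to A a b" "arc_from_to B b c" "A \<inter> B = {b}"
  shows "arc_from_to (A \<union> B) a c"
proof -
  obtain g h where g: "arc g" "path_image g = A" "pathstart g = a" "pathfinish g = b"
    and h: "arc h" "path_image h = B" "pathstart h = b" "pathfinish h = c"
    using assms unfolding arc_from_to_def by blast
  then show ?thesis
    unfolding arc_from_to_def using assms(3)
    by (intro exI[of _ "g +++ h"]) (auto intro!: arc_join simp: path_image_join)
qed

lemma subpath_image_eq: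
  assumes "u \<le> v"
  shows "path_image (subpath u v g) = g ` {u..v}"
  using assms by (simp add: path_image_subpath)

lemma arc_from_to_subpath:
  fixes g :: "real \<Rightarrow> 'a::real_normed_vector"
  assumes "arc g" "u \<in> {0..1}" "v \<in> {0..1}" "u < v"
  shows "arc_from_to (g ` {u..v}) (g u) (g v)"
  unfolding arc_from_to_def using assms
  by (intro exI[of _ "subpath u v g"]) (auto simp: arc_subpath_arc subpath_image_eq)

lemma arc_from_to_split:
  fixes A :: "'a::real_normed_vector set"
  assumes "arc_from_to A a b" "c \<in> A" "c \<noteq> a" "c \<noteq> b"
  obtains A1 A2 where "arc_from_to A1 a c" "arc_from_to A2 c b" "A = A1 \<union> A2" "A1 \<inter> A2 = {c}"
proof -
  obtain g where g: "arc g" "path_image g = A" "pathstart g = a" "pathfinish g = b"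
    using assms unfolding arc_from_to_def by blast
  obtain t where t: "t \<in> {0..1}" "g t = c"
    using assms(2) g(2) unfolding path_image_def by blast
  have t01: "0 < t" "t < 1"
    using t assms g unfolding pathstart_def pathfinish_def
    by (metis atLeastAtMost_iff less_eq_real_def)+
  have inj: "inj_on g {0..1}"
    using g(1) arc_def by blast
  show ?thesis
  proof
    show "arc_from_to (g ` {0..t}) a c"
      using arc_from_to_subpath[OF g(1), of 0 t] t01 t g(3) by (simp add: pathstart_def)
    show "arc_from_to (g ` {t..1}) c b"
      using arc_from_to_subpath[OF g(1), of t 1] t01 t g(4) by (simp add: pathfinish_def)
    have "{0..1} = {0..t} \<union> {t..1}" using t01 by auto
    then show "A = g ` {0..t} \<union> g ` {t..1}"
      using g(2) unfolding path_image_def by (metis image_Un)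
    have "g ` {0..t} \<inter> g ` {t..1} = g ` ({0..t} \<inter> {t..1})"
      using inj by (rule inj_on_image_Int[symmetric]) (use t01 in auto)
    also have "{0..t} \<inter> {t..1} = {t}" using t01 by auto
    finally show "g ` {0..t} \<inter> g ` {t..1} = {c}" using t by auto
  qed
qed

text \<open>A missing interior point \<open>c\<close> would cut the arc into two closed subarcs that
  meet only in \<open>c\<close>, and these would disconnect \<open>K\<close>. Uniqueness of arcs in
  dendroids rests on this.\<close>

lemma connected_subset_arc_eq:
  fixes A :: "'a::real_normed_vector set"
  assumes "arc_from_to A a b" "connected K" "K \<subseteq> A" "a \<in> K" "b \<in> K"
  shows "K = A"
proof (rule ccontr)
  assume "K \<noteq> A"
  then obtain c where c: "c \<in> A" "c \<notin> K" using assms(3) by blast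
  then have "c \<noteq> a" "c \<noteq> b" using assms by auto
  then obtain A1 A2 where A: "arc_from_to A1 a c" "arc_from_to A2 c b" "A = A1 \<union> A2" "A1 \<inter> A2 = {c}"
    using arc_from_to_split[OF assms(1) c(1)] by metis
  have "closed A1" "closed A2" using A arc_from_to_closed by blast+
  moreover have "K \<subseteq> A1 \<union> A2" "A1 \<inter> A2 \<inter> K = {}" using A assms(3) c by auto
  moreover have "A1 \<inter> K \<noteq> {}" "A2 \<inter> K \<noteq> {}"
    using arc_from_to_ends[OF A(1)] arc_from_to_ends[OF A(2)] assms by auto
  ultimately show False
    using connected_closedD[OF assms(2)] by metis
qed

text \<open>The closed set of parameters that are sent into \<open>K\<close> has a least element; it
  is positive because \<open>a\<close> is outside \<open>K\<close>, so the initial piece is a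
  genuine arc.\<close>

lemma arc_first_hit:
  fixes A :: "'a::real_normed_vector set"
  assumes "arc_from_to A a b" "closed K" "A \<inter> K \<noteq> {}" "a \<notin> K"
  obtains c A1 where "c \<in> K" "c \<in> A" "arc_from_to A1 a c" "A1 \<subseteq> A" "A1 \<inter> K = {c}"
proof -
  obtain g where g: "arc g" "path_image g = A" "pathstart g = a" "pathfinish g = b"
    using assms unfolding arc_from_to_def by blast
  define Z where "Z = {t \<in> {0..1}. g t \<in> K}"
  have contg: "continuous_on {0..1} g"
    using g(1) arc_def path_def by blast
  have "Z = {0..1} \<inter> g -` K" unfolding Z_def by auto
  then have "closed Z"
    using continuous_closed_preimage[OF contg closed_atLeastAtMost assms(2)] by simp
  moreover have "Z \<noteq> {}" "bdd_below Z"
    using assms(3) g(2) unfolding Z_def path_image_def by (auto intro!: bdd_belowI[of _ 0])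
  ultimately have I: "Inf Z \<in> Z" using closed_contains_Inf by blast
  define t where "t = Inf Z"
  have t: "t \<in> {0..1}" "g t \<in> K" using I unfolding t_def Z_def by auto
  have "t \<noteq> 0" using t assms(4) g(3) unfolding pathstart_def by auto
  then have t0: "0 < t" "t \<le> 1" using t by auto
  have first: "g s \<notin> K" if "0 \<le> s" "s < t" for s
    using that t cInf_lower[of s Z] \<open>bdd_below Z\<close> unfolding t_def Z_def by force
  show ?thesis
  proof
    show "g t \<in> K" by (rule t)
    show "g t \<in> A" using t g(2) unfolding path_image_def by blast
    show "arc_from_to (g ` {0..t}) a (g t)"
      using arc_from_to_subpath[OF g(1), of 0 t] t0 g(3) by (simp add: pathstart_def)
    show "g ` {0..t} \<subseteq> A" using t0 g(2) unfolding path_image_def by auto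
    show "g ` {0..t} \<inter> K = {g t}"
      using first t t0 by (force simp: image_iff)
  qed
qed

lemma arc_from_to_segment:
  fixes a b :: "'a::real_normed_vector"
  assumes "a \<noteq> b"
  shows "arc_from_to (closed_segment a b) a b"
  unfolding arc_from_to_def using assms
  by (intro exI[of _ "linepath a b"]) (auto simp: arc_linepath)

lemma path_connected_imp_arc_from_to:
  fixes S :: "'a::{complete_space,real_normed_vector} set"
  assumes "path_connected S" "a \<in> S" "b \<in> S" "a \<noteq> b"
  obtains A where "arc_from_to A a b" "A \<subseteq> S"
proof -
  obtain g where "path g" "path_image g \<subseteq> S" "pathstart g = a" "pathfinish g = b"
    using assms unfolding path_connected_def by blast
  then obtain q where "arc q" "path_image q \<subseteq> S" "pathstart q = a" "pathfinish q = b"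
    using path_contains_arc[of g a b] assms(4) by (metis order_trans)
  then have "arc_from_to (path_image q) a b" unfolding arc_from_to_def by blast
  then show ?thesis using that \<open>path_image q \<subseteq> S\<close> by blast
qed

subsection \<open>Separation in the plane\<close>

text \<open>The coordinate bijections carry Janiszewski's theorem and the Jordan curve theorem,
  which are stated over \<open>complex\<close>, to the plane \<open>real ^ 2\<close>.\<close>

definition to_complex :: "real ^ 2 \<Rightarrow> complex" where
  "to_complex x = Complex (x $ 1) (x $ 2)"

definition of_complex :: "complex \<Rightarrow> real ^ 2" where
  "of_complex z = vector [Re z, Im z]"

lemma of_to_complex [simp]: "of_complex (to_complex x) = x"
  by (simp add: of_complex_def to_complex_def vec_eq_iff forall_2)

lemma to_of_complex [simp]: "to_complex (of_complex z) = z"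
  by (simp add: of_complex_def to_complex_def)

lemma linear_to_complex: "linear to_complex"
  by (rule linearI) (auto simp: to_complex_def complex_eq_iff)

lemma linear_of_complex: "linear of_complex"
  by (rule linearI) (auto simp: of_complex_def vec_eq_iff forall_2)

lemma continuous_to_complex: "continuous_on S to_complex"
  by (simp add: linear_continuous_on linear_conv_bounded_linear[symmetric] linear_to_complex)

lemma continuous_of_complex: "continuous_on S of_complex"
  by (simp add: linear_continuous_on linear_conv_bounded_linear[symmetric] linear_of_complex)

lemma inj_to_complex: "inj to_complex"
  by (metis injI of_to_complex)

lemma bij_to_complex: "bij to_complex"
  by (metis bij_def inj_to_complex surjI to_of_complex)

lemma bij_of_complex: "bij of_complex"
  by (metis bij_def injI of_to_complex surjI to_of_complex)

lemma image_to_complex_Compl: "to_complex ` (- S) = - (to_complex ` S)"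
  by (simp add: bij_image_Compl_eq bij_to_complex)

lemma image_of_complex_Compl: "of_complex ` (- S) = - (of_complex ` S)"
  by (simp add: bij_image_Compl_eq bij_of_complex)

lemma of_complex_image_image [simp]: "of_complex ` to_complex ` S = S"
  by (simp add: image_comp o_def)

lemma open_of_complex_image: "open S \<Longrightarrow> open (of_complex ` S)"
proof -
  assume "open S"
  then have "open (to_complex -` S)"
    using continuous_to_complex[of UNIV] by (simp add: open_vimage)
  also have "to_complex -` S = of_complex ` S"
    by (auto simp: image_iff) (metis of_to_complex)
  finally show ?thesis .
qed

lemma closed_to_complex_image: "closed S \<Longrightarrow> closed (to_complex ` S)"
proof -
  assume "closed S"
  then have "closed (of_complex -` S)"
    using continuous_of_complex[of UNIV] by (simp add: closed_vimage)
  also have "of_complex -` S = to_complex ` S"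
    by (auto simp: image_iff) (metis to_of_complex)
  finally show ?thesis .
qed

lemma connected_component_image:
  assumes "connected_component S a b" "continuous_on S h"
  shows "connected_component (h ` S) (h a) (h b)"
proof -
  obtain T where T: "connected T" "T \<subseteq> S" "a \<in> T" "b \<in> T"
    using assms(1) unfolding connected_component_def by blast
  then have "connected (h ` T)"
    using assms(2) connected_continuous_image continuous_on_subset by blast
  then show ?thesis
    unfolding connected_component_def using T by blast
qed

text \<open>Each use below arranges the two sets so that their overlap is a given continuum: a
  crosscut, an auxiliary continuum off \<open>D\<close>, or a continuum across the curve.\<close>

lemma Janiszewski_plane:
  fixes a b :: "real ^ 2"
  assumes "compact S" "closed T" "connected (S \<inter> T)"
    "connected_component (- S) a b" "connected_component (- T) a b"
  shows "connected_component (- (S \<union> T)) a b"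
proof -
  let ?h = to_complex
  have "connected_component (- (?h ` S \<union> ?h ` T)) (?h a) (?h b)"
  proof (rule Janiszewski)
    show "compact (?h ` S)"
      using assms(1) continuous_to_complex compact_continuous_image by blast
    show "closed (?h ` T)" using assms(2) by (rule closed_to_complex_image)
    have "?h ` S \<inter> ?h ` T = ?h ` (S \<inter> T)"
      by (simp add: image_Int inj_to_complex)
    then show "connected (?h ` S \<inter> ?h ` T)"
      using assms(3) continuous_to_complex connected_continuous_image by metis
    show "connected_component (- ?h ` S) (?h a) (?h b)" "connected_component (- ?h ` T) (?h a) (?h b)"
      using connected_component_image[OF assms(4) continuous_to_complex]
        connected_component_image[OF assms(5) continuous_to_complex]
      by (simp_all add: image_to_complex_Compl)
  qed
  then have "connected_component (- (?h ` (S \<union> T))) (?h a) (?h b)"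
    by (simp add: image_Un)
  then have "connected_component (?h ` (- (S \<union> T))) (?h a) (?h b)"
    by (simp only: image_to_complex_Compl)
  from connected_component_image[OF this continuous_of_complex] show ?thesis
    by simp
qed

lemma frontier_of_complex_image: "frontier (of_complex ` S) = of_complex ` frontier S"
proof -
  have cl: "closure (of_complex ` T) = of_complex ` closure T" for T
    by (rule closure_bij_homeomorphic_image_eq[where A = UNIV and B = UNIV and A' = UNIV and B' = UNIV and g = to_complex])
      (auto simp: continuous_to_complex continuous_of_complex bij_of_complex bij_is_surj bij_is_inj
        homeomorphism_def surj_def intro: exI[of _ "to_complex _"] exI[of _ "of_complex _"])
  have "frontier (of_complex ` S) = closure (of_complex ` S) \<inter> closure (of_complex ` (- S))"
    by (simp add: frontier_closures image_of_complex_Compl)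
  also have "\<dots> = of_complex ` (closure S \<inter> closure (- S))"
    unfolding cl by (rule image_Int[symmetric]) (rule bij_is_inj[OF bij_of_complex])
  finally show ?thesis by (simp add: frontier_closures)
qed

lemma Jordan_arcs:
  fixes A :: "(real ^ 2) set"
  assumes "arc_from_to A a b" "arc_from_to B a b" "A \<inter> B = {a, b}"
  obtains I J where "open I" "connected I" "I \<noteq> {}" "open J" "connected J" "J \<noteq> {}"
    "I \<inter> J = {}" "I \<union> J = - (A \<union> B)" "frontier I = A \<union> B" "frontier J = A \<union> B"
proof -
  obtain g h where g: "arc g" "path_image g = A" "pathstart g = a" "pathfinish g = b"
    and h: "arc h" "path_image h = B" "pathstart h = b" "pathfinish h = a"
    using assms(1) arc_from_to_sym[OF assms(2)] unfolding arc_from_to_def by blast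
  have sp: "simple_path (g +++ h)"
    using g h assms(3) by (intro simple_path_join_loop) auto
  let ?c = "to_complex \<circ> (g +++ h)"
  have "simple_path ?c"
  proof -
    have "path ?c" using sp simple_path_imp_path path_continuous_image continuous_to_complex by blast
    then show ?thesis using sp inj_to_complex
      unfolding simple_path_def loop_free_def by (simp add: inj_eq)
  qed
  moreover have "pathfinish ?c = pathstart ?c"
    using g h by (simp add: pathfinish_compose pathstart_compose)
  ultimately obtain I J where IJ: "I \<noteq> {}" "open I" "connected I" "J \<noteq> {}" "open J" "connected J"
    "I \<inter> J = {}" "I \<union> J = - path_image ?c" "frontier I = path_image ?c" "frontier J = path_image ?c"
    using Jordan_curve by metis
  have pi: "path_image ?c = to_complex ` (A \<union> B)"
    using g h by (simp add: path_image_compose path_image_join)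
  show ?thesis
  proof
    show "open (of_complex ` I)" "open (of_complex ` J)" using IJ open_of_complex_image by blast+
    show "connected (of_complex ` I)" "connected (of_complex ` J)"
      using IJ continuous_of_complex connected_continuous_image by blast+
    show "of_complex ` I \<noteq> {}" "of_complex ` J \<noteq> {}" using IJ by auto
    show "of_complex ` I \<inter> of_complex ` J = {}"
      using IJ bij_of_complex by (metis bij_betw_imp_inj_on image_Int image_empty)
    have "of_complex ` (I \<union> J) = - (of_complex ` path_image ?c)"
      using IJ(8) image_of_complex_Compl by metis
    then show "of_complex ` I \<union> of_complex ` J = - (A \<union> B)"
      unfolding pi by (simp add: image_Un)
    show "frontier (of_complex ` I) = A \<union> B" "frontier (of_complex ` J) = A \<union> B"
      using IJ pi frontier_of_complex_image by (metis of_complex_image_image)+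
  qed
qed


section \<open>Crosscuts of a Jordan curve\<close>

lemma connected_in_one_side:
  assumes "connected F" "F \<subseteq> U \<union> V" "open U" "open V" "U \<inter> V = {}"
  shows "F \<subseteq> U \<or> F \<subseteq> V"
proof (rule ccontr)
  assume "\<not> ?thesis"
  then have "U \<inter> F \<noteq> {}" "V \<inter> F \<noteq> {}" using assms(2) by auto
  then show False
    using connectedD[OF assms(1,3,4)] assms by auto
qed

lemma connected_component_subset:
  "connected F \<Longrightarrow> F \<subseteq> S \<Longrightarrow> a \<in> F \<Longrightarrow> b \<in> F \<Longrightarrow> connected_component S a b"
  unfolding connected_component_def by blast

lemma closure_disjoint_open: "open U \<Longrightarrow> U \<inter> V = {} \<Longrightarrow> U \<inter> closure V = {}"
  by (metis Int_commute open_Int_closure_eq_empty)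

text \<open>Of the two sides of the Jordan curve \<open>C1 \<union> cc\<close>, \<open>R\<close> is
  the one without the open arc \<open>C2 - {d, q}\<close>. It therefore misses
  \<open>C1 \<union> C2\<close> and lies in \<open>I\<close> or in \<open>J\<close>; its closure
  contains \<open>cc\<close>, whose interior lies in the open set \<open>I\<close>, so it lies in
  \<open>I\<close>.\<close>

lemma theta_side:
  fixes C1 :: "(real ^ 2) set"
  assumes arcs: "arc_from_to C1 d q" "arc_from_to C2 d q" "arc_from_to cc d q"
    and ints: "C1 \<inter> C2 = {d, q}" "cc \<inter> (C1 \<union> C2) = {d, q}"
    and IJ: "open I" "open J" "I \<inter> J = {}" "I \<union> J = - (C1 \<union> C2)"
    and ccI: "cc - {d, q} \<subseteq> I"
  obtains R V where "open R" "connected R" "R \<subseteq> I" "R \<inter> cc = {}" "frontier R = C1 \<union> cc"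
    "open V" "connected V" "R \<inter> V = {}" "R \<union> V = - (C1 \<union> cc)" "C2 - {d, q} \<subseteq> V"
    "closure R \<inter> (C2 - {d, q}) = {}"
proof -
  note result = that
  have C1cc: "C1 \<inter> cc = {d, q}" using ints arc_from_to_ends[OF arcs(1)] by auto
  obtain U V where UV: "open U" "connected U" "U \<noteq> {}" "open V" "connected V" "V \<noteq> {}"
    "U \<inter> V = {}" "U \<union> V = - (C1 \<union> cc)" "frontier U = C1 \<union> cc" "frontier V = C1 \<union> cc"
    using Jordan_arcs[OF arcs(1,3) C1cc] by metis
  have conC2: "connected (C2 - {d, q})"
  proof -
    obtain g where g: "arc g" "path_image g = C2" "pathstart g = d" "pathfinish g = q"
      using arcs(2) unfolding arc_from_to_def by blast
    then have "C2 - {d, q} = g ` {0<..<1}"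
      using path_image_def[of g] unfolding arc_def inj_on_def pathstart_def pathfinish_def
      by (force simp: less_le)
    moreover have "continuous_on {0<..<1} g"
      using g(1) unfolding arc_def path_def by (meson continuous_on_subset greaterThanLessThan_subseteq_atLeastAtMost_iff order_refl)
    ultimately show ?thesis by (simp add: connected_continuous_image)
  qed
  have neC2: "C2 - {d, q} \<noteq> {}"
  proof
    assume "C2 - {d, q} = {}"
    then have "C2 = {d, q}" using arc_from_to_ends[OF arcs(2)] by auto
    then have "finite C2" by simp
    moreover have "connected C2" "d \<noteq> q" using arcs(2) arc_from_to_connected arc_from_to_ends by blast+
    ultimately show False using \<open>C2 = {d, q}\<close> connected_finite_iff_sing by (metis doubleton_eq_iff insert_not_empty singletonD insertI1 insert_iff)
  qed
  have C2UV: "C2 - {d, q} \<subseteq> U \<union> V" using UV(8) ints by auto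
  \<comment> \<open>Which side plays which role is still open: the open arc of \<open>C2\<close> is
    connected, so one side contains it, and that side is taken as \<open>V\<close>.\<close>
  have main: thesis if UV: "open U" "connected U" "open V" "connected V"
    "U \<inter> V = {}" "U \<union> V = - (C1 \<union> cc)" "frontier U = C1 \<union> cc" and C2V: "C2 - {d, q} \<subseteq> V" "U \<noteq> {}" for U V
  proof (rule result[of U V])
    show "U \<inter> cc = {}" using UV by auto
    have "U \<inter> (C1 \<union> C2) = {}" using UV C2V ints arc_from_to_ends[OF arcs(1)] by blast
    then have "U \<subseteq> I \<union> J" using IJ(4) by auto
    then have "U \<subseteq> I \<or> U \<subseteq> J" using connected_in_one_side[OF UV(2) _ IJ(1,2,3)] by blast
    moreover have "\<not> U \<subseteq> J"
    proof
      assume "U \<subseteq> J"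
      then have "closure U \<inter> I = {}" using closure_disjoint_open[of I U] IJ by blast
      moreover have "cc - {d, q} \<subseteq> closure U" using UV(7) by (auto simp: frontier_def)
      moreover have "cc - {d, q} \<noteq> {}"
      proof
        assume "cc - {d, q} = {}"
        then have "cc = {d, q}" using arc_from_to_ends[OF arcs(3)] by auto
        moreover have "connected cc" "d \<noteq> q" using arcs(3) arc_from_to_connected arc_from_to_ends by blast+
        ultimately show False using connected_finite_iff_sing[of cc] by auto
      qed
      ultimately show False using ccI by blast
    qed
    ultimately show "U \<subseteq> I" by blast
    show "closure U \<inter> (C2 - {d, q}) = {}"
      using closure_disjoint_open[of V U] UV C2V by blast
  qed (use UV C2V in auto)
  have "C2 - {d, q} \<subseteq> U \<or> C2 - {d, q} \<subseteq> V"
    by (rule connected_in_one_side[OF conC2 C2UV UV(1,4,7)])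
  then show thesis
    using main[of U V] main[of V U] UV by (metis Int_commute Un_commute)
qed

text \<open>\<open>R1\<close> and \<open>R2\<close> are the regions that \<open>theta_side\<close>
  cuts off with either boundary arc. If they met, they would coincide, and so would their frontiers,
  which contain different arcs. That they exhaust \<open>I - cc\<close> is an instance of
  Janiszewski's theorem.\<close>

lemma theta_sides:
  fixes C1 :: "(real ^ 2) set"
  assumes arcs: "arc_from_to C1 d q" "arc_from_to C2 d q" "arc_from_to cc d q"
    and ints: "C1 \<inter> C2 = {d, q}" "cc \<inter> (C1 \<union> C2) = {d, q}"
    and IJ: "open I" "open J" "J \<noteq> {}" "connected J" "I \<inter> J = {}" "I \<union> J = - (C1 \<union> C2)" "frontier J = C1 \<union> C2"
    and ccI: "cc - {d, q} \<subseteq> I"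
  obtains R1 R2 where "open R1" "open R2" "R1 \<inter> R2 = {}" "R1 \<union> R2 = I - cc"
    "closure R1 \<inter> (C2 - {d, q}) = {}" "closure R2 \<inter> (C1 - {d, q}) = {}"
proof -
  obtain R1 V1 where R1: "open R1" "connected R1" "R1 \<subseteq> I" "R1 \<inter> cc = {}" "frontier R1 = C1 \<union> cc"
    "open V1" "connected V1" "R1 \<inter> V1 = {}" "R1 \<union> V1 = - (C1 \<union> cc)" "C2 - {d, q} \<subseteq> V1" "closure R1 \<inter> (C2 - {d, q}) = {}"
    using theta_side[OF arcs ints IJ(1,2,5,6) ccI] by metis
  have ints': "C2 \<inter> C1 = {d, q}" "cc \<inter> (C2 \<union> C1) = {d, q}" and IJ': "I \<union> J = - (C2 \<union> C1)"
    using ints IJ by auto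
  obtain R2 V2 where R2: "open R2" "connected R2" "R2 \<subseteq> I" "R2 \<inter> cc = {}" "frontier R2 = C2 \<union> cc"
    "open V2" "connected V2" "R2 \<inter> V2 = {}" "R2 \<union> V2 = - (C2 \<union> cc)" "C1 - {d, q} \<subseteq> V2" "closure R2 \<inter> (C1 - {d, q}) = {}"
    using theta_side[OF arcs(2,1,3) ints' IJ(1,2,5) IJ' ccI] by metis
  have dis: "R1 \<inter> R2 = {}"
  proof (rule ccontr)
    assume ne: "R1 \<inter> R2 \<noteq> {}"
    have "R2 \<subseteq> R1 \<union> V1" using R1(9) R2(3,4) IJ(6) by auto
    then have a: "R2 \<subseteq> R1" using connected_in_one_side[OF R2(2) _ R1(1,6,8)] ne R1(8) by auto
    have "R1 \<subseteq> R2 \<union> V2" using R2(9) R1(3,4) IJ(6) by auto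
    then have b: "R1 \<subseteq> R2" using connected_in_one_side[OF R1(2) _ R2(1,6,8)] ne R2(8) by auto
    from a b have "C1 \<union> cc = C2 \<union> cc" using R1(5) R2(5) by auto
    moreover have "C1 - {d, q} \<subseteq> V2" by (rule R2)
    moreover have "V2 \<inter> (C2 \<union> cc) = {}" using R2(9) by blast
    moreover have "C1 - {d, q} \<noteq> {}"
    proof
      assume "C1 - {d, q} = {}"
      then have "C1 = {d, q}" using arc_from_to_ends[OF arcs(1)] by auto
      moreover have "connected C1" "d \<noteq> q" using arcs(1) arc_from_to_connected arc_from_to_ends by blast+
      ultimately show False using connected_finite_iff_sing[of C1] by auto
    qed
    ultimately show False by blast
  qed
  have JV: "J \<subseteq> V" if V: "open R" "open V" "R \<inter> V = {}" "R \<union> V = - (C \<union> cc)" "R \<subseteq> I" "C \<subseteq> C1 \<union> C2" for R V C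
  proof -
    have "cc \<subseteq> I \<union> (C1 \<union> C2)" using ccI arc_from_to_ends[OF arcs(1)] by auto
    then have "J \<inter> (C \<union> cc) = {}" using IJ(5,6) V(6) by blast
    then show ?thesis using V(4,5) IJ(5) by blast
  qed
  have J1: "J \<subseteq> V1" and J2: "J \<subseteq> V2"
    using JV[OF R1(1,6,8,9,3)] JV[OF R2(1,6,8,9,3)] by auto
  have cover: "I - cc \<subseteq> R1 \<union> R2"
  proof
    fix x assume x: "x \<in> I - cc"
    show "x \<in> R1 \<union> R2"
    proof (rule ccontr)
      assume "x \<notin> R1 \<union> R2"
      then have xV: "x \<in> V1" "x \<in> V2" using x R1(9) R2(9) IJ(6) by auto
      obtain o' where o': "o' \<in> J" using IJ(3) by blast
      \<comment> \<open>A point of \<open>I - cc\<close> in neither region lies, like all of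
        \<open>J\<close>, in \<open>V1\<close> and in \<open>V2\<close>. The two curves overlap in
        the arc \<open>cc\<close>, so the point would be joined to \<open>o'\<close> in
        \<open>J\<close> off the whole theta curve.\<close>
      have "connected_component (- ((C1 \<union> cc) \<union> (C2 \<union> cc))) x o'"
      proof (rule Janiszewski_plane)
        show "compact (C1 \<union> cc)" "closed (C2 \<union> cc)"
          using arcs arc_from_to_compact compact_Un compact_imp_closed by metis+
        have "(C1 \<union> cc) \<inter> (C2 \<union> cc) = cc" using ints by auto
        then show "connected ((C1 \<union> cc) \<inter> (C2 \<union> cc))" using arcs(3) arc_from_to_connected by metis
        show "connected_component (- (C1 \<union> cc)) x o'"
          by (rule connected_component_subset[OF R1(7)]) (use R1(9) xV J1 o' in auto)
        show "connected_component (- (C2 \<union> cc)) x o'"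
          by (rule connected_component_subset[OF R2(7)]) (use R2(9) xV J2 o' in auto)
      qed
      then obtain K where K: "connected K" "K \<subseteq> - ((C1 \<union> cc) \<union> (C2 \<union> cc))" "x \<in> K" "o' \<in> K"
        unfolding connected_component_def by blast
      have "K \<subseteq> I \<union> J" using K(2) IJ(6) by auto
      then have "K \<subseteq> I \<or> K \<subseteq> J" using connected_in_one_side[OF K(1) _ IJ(1,2,5)] by blast
      then show False using K x o' IJ(5) by blast
    qed
  qed
  show thesis
    by (rule that[OF R1(1) R2(1) dis]) (use cover R1 R2 in auto)
qed

section \<open>Continua that cross a region\<close>

lemma compact_subset_continuum:
  fixes W :: "'a::euclidean_space set"
  assumes "open W" "connected W" "compact K" "K \<subseteq> W"
  obtains L where "compact L" "connected L" "K \<subseteq> L" "L \<subseteq> W"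
proof (cases "K = {}")
  case True
  then show ?thesis using that[of "{}"] by auto
next
  case False
  then obtain k where k: "k \<in> K" by blast
  have "\<exists>L. x \<in> interior L \<and> compact L \<and> connected L \<and> k \<in> L \<and> L \<subseteq> W" if x: "x \<in> K" for x
  proof -
    obtain e where e: "e > 0" "cball x e \<subseteq> W" using assms x open_contains_cball by blast
    obtain g where g: "path g" "path_image g \<subseteq> W" "pathstart g = x" "pathfinish g = k"
      using assms x k connected_open_path_connected unfolding path_connected_def by (metis subsetD)
    have "x \<in> path_image g" "k \<in> path_image g" using g by (metis pathstart_in_path_image pathfinish_in_path_image)+
    have "cball x e \<inter> path_image g \<noteq> {}"
      using e \<open>x \<in> path_image g\<close> by (metis IntI centre_in_cball empty_iff less_imp_le)
    then have "connected (cball x e \<union> path_image g)"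
      using g(1) connected_path_image by (intro connected_Un) auto
    moreover have "x \<in> interior (cball x e \<union> path_image g)"
      using e by (auto simp: mem_interior intro!: exI[of _ e])
    ultimately show ?thesis
      using e g \<open>k \<in> path_image g\<close>
      by (intro exI[of _ "cball x e \<union> path_image g"]) (auto intro!: compact_Un compact_path_image)
  qed
  then obtain L where L: "\<And>x. x \<in> K \<Longrightarrow> x \<in> interior (L x) \<and> compact (L x) \<and> connected (L x) \<and> k \<in> L x \<and> L x \<subseteq> W"
    by metis
  obtain F where F: "F \<subseteq> K" "finite F" "K \<subseteq> (\<Union>x\<in>F. interior (L x))"
  proof (rule compactE_image[OF assms(3), of K "\<lambda>x. interior (L x)"])
    show "K \<subseteq> (\<Union>x\<in>K. interior (L x))" using L by blast
  qed auto
  have "F \<noteq> {}" using F k by auto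
  show ?thesis
  proof
    show "compact (\<Union>x\<in>F. L x)" using F L by (intro compact_UN) auto
    show "connected (\<Union>x\<in>F. L x)"
      by (rule connected_Union) (use L F k \<open>F \<noteq> {}\<close> in blast)+
    show "K \<subseteq> (\<Union>x\<in>F. L x)" using F interior_subset by fastforce
    show "(\<Union>x\<in>F. L x) \<subseteq> W" using F L by blast
  qed
qed

text \<open>If every component of \<open>F\<close> through a point of \<open>G\<close> missed
  \<open>Y\<close>, each would lie in a relatively clopen part of \<open>F\<close> that misses
  \<open>Y\<close> (Sura-Bura). Finitely many of these parts cover \<open>F \<inter> G\<close>, and
  their union yields a forbidden splitting.\<close>

lemma component_meets_both:
  fixes F :: "'a::euclidean_space set"
  assumes "compact F" "closed Y" "closed G"
    and no_split: "\<And>H1 H2. closed H1 \<Longrightarrow> closed H2 \<Longrightarrow> H1 \<union> H2 = F \<Longrightarrow> H1 \<inter> H2 = {} \<Longrightarrow> H1 \<inter> Y = {} \<Longrightarrow> H2 \<inter> G = {} \<Longrightarrow> False"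
  obtains K where "compact K" "connected K" "K \<subseteq> F" "K \<inter> Y \<noteq> {}" "K \<inter> G \<noteq> {}"
proof (rule ccontr)
  note result = that
  assume no: "\<not> thesis"
  have "\<exists>H. closed H \<and> openin (top_of_set F) H \<and> x \<in> H \<and> H \<inter> Y = {}" if x: "x \<in> F \<inter> G" for x
  proof -
    define C where "C = connected_component_set F x"
    have C: "C \<in> components F" "connected C" "C \<subseteq> F" "x \<in> C" "compact C"
      unfolding C_def using x assms(1) by (auto simp: componentsI connected_component_subset
          connected_component_refl_eq compact_components connected_component_in dest: connected_component_in)
    have CY: "C \<subseteq> - Y"
    proof (rule ccontr)
      assume "\<not> C \<subseteq> - Y"
      then have "C \<inter> Y \<noteq> {}" "C \<inter> G \<noteq> {}" using C(4) x by auto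
      then show False using no result[OF C(5,2,3)] by blast
    qed
    obtain K where "openin (top_of_set F) K" "compact K" "C \<subseteq> K" "K \<subseteq> - Y"
      using Sura_Bura_clopen_subset[OF _ C(1) C(5) _ CY] assms compact_imp_closed closed_imp_locally_compact by (metis open_Compl)
    then show ?thesis using C(4) compact_imp_closed by (intro exI[of _ K]) auto
  qed
  then obtain H where H: "\<And>x. x \<in> F \<inter> G \<Longrightarrow> closed (H x) \<and> openin (top_of_set F) (H x) \<and> x \<in> H x \<and> H x \<inter> Y = {}"
    by metis
  have "compact (F \<inter> G)" using assms by blast
  moreover have "\<exists>T. open T \<and> H x = F \<inter> T" if "x \<in> F \<inter> G" for x
    using H[OF that] openin_open by metis
  then obtain T where T: "\<And>x. x \<in> F \<inter> G \<Longrightarrow> open (T x) \<and> H x = F \<inter> T x" by metis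
  moreover have "F \<inter> G \<subseteq> (\<Union>x\<in>F \<inter> G. T x)" using T H by blast
  ultimately obtain S where S: "S \<subseteq> F \<inter> G" "finite S" "F \<inter> G \<subseteq> (\<Union>x\<in>S. T x)"
    using compactE_image[of "F \<inter> G" "F \<inter> G" T] by metis
  define H1 where "H1 = (\<Union>x\<in>S. H x)"
  have "closed H1" unfolding H1_def using S H by (intro closed_UN) auto
  moreover have "closed (F - H1)"
  proof -
    have "F - H1 = F \<inter> - (\<Union>x\<in>S. T x)" unfolding H1_def using T S by blast
    moreover have "open (\<Union>x\<in>S. T x)" using T S by blast
    ultimately show ?thesis using assms(1) compact_imp_closed by (metis closed_Compl closed_Int)
  qed
  moreover have "H1 \<subseteq> F" unfolding H1_def using T S by blast
  moreover have "H1 \<inter> Y = {}" unfolding H1_def using H S by blast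
  moreover have "(F - H1) \<inter> G = {}" unfolding H1_def using S T by blast
  ultimately show False using no_split[of H1 "F - H1"] by blast
qed

text \<open>A closed set with connected open complement inherits the unicoherence of the plane.\<close>

lemma frontier_component_meets_both:
  fixes D :: "(real ^ 2) set"
  assumes D: "closed D" "connected (- D)"
    and U: "bounded U" "a \<in> U" "b \<notin> closure U" "open U"
    and Y: "connected Y" "closed Y" "Y \<subseteq> D" "a \<in> Y" "b \<in> Y"
    and G: "connected G" "closed G" "G \<subseteq> D" "a \<in> G" "b \<in> G"
  obtains K where "compact K" "connected K" "K \<subseteq> frontier U \<inter> D" "K \<inter> Y \<noteq> {}" "K \<inter> G \<noteq> {}"
proof -
  have cF: "compact (frontier U)" using U(1) by (simp add: compact_frontier_bounded)
  have "False" if H: "closed H1" "closed H2" "H1 \<union> H2 = frontier U \<inter> D" "H1 \<inter> H2 = {}" "H1 \<inter> Y = {}" "H2 \<inter> G = {}" for H1 H2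
  proof -
    obtain O1 O2 where O: "open O1" "open O2" "H1 \<subseteq> O1" "H2 \<subseteq> O2" "O1 \<inter> O2 = {}"
      using separation_normal[OF H(1,2,4)] by metis
    have "compact (frontier U - (O1 \<union> O2))" using cF O by (simp add: compact_diff open_Un)
    moreover have "frontier U - (O1 \<union> O2) \<subseteq> - D" using H O by blast
    ultimately obtain L where L: "compact L" "connected L" "frontier U - (O1 \<union> O2) \<subseteq> L" "L \<subseteq> - D"
      using compact_subset_continuum[of "- D" "frontier U - (O1 \<union> O2)"] D by (metis open_Compl)
    \<comment> \<open>Adding \<open>L\<close> to both sets makes their overlap exactly
      \<open>L\<close>. \<open>Y\<close> meets the frontier only inside \<open>O2\<close> and
      \<open>G\<close> only inside \<open>O1\<close>, so each of them joins \<open>a\<close> to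
      \<open>b\<close> off one of the two sets; a connection off both would pass from
      \<open>U\<close> to its outside without meeting the frontier.\<close>
    have "connected_component (- (((frontier U - O1) \<union> L) \<union> ((frontier U - O2) \<union> L))) a b"
    proof (rule Janiszewski_plane)
      show "compact ((frontier U - O1) \<union> L)" "closed ((frontier U - O2) \<union> L)"
        using cF O L by (auto simp: compact_diff compact_imp_closed closed_Diff)
      have "((frontier U - O1) \<union> L) \<inter> ((frontier U - O2) \<union> L) = L" using L(3) by blast
      then show "connected (((frontier U - O1) \<union> L) \<inter> ((frontier U - O2) \<union> L))" using L(2) by simp
      have "Y \<inter> ((frontier U - O2) \<union> L) = {}" using H(3,5) O(4) L(4) Y(3) by blast
      then have "Y \<subseteq> - ((frontier U - O2) \<union> L)" by blast
      then show "connected_component (- ((frontier U - O2) \<union> L)) a b"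
        by (rule connected_component_subset[OF Y(1) _ Y(4,5)])
      have "G \<inter> ((frontier U - O1) \<union> L) = {}" using H(3,6) O(3) L(4) G(3) by blast
      then have "G \<subseteq> - ((frontier U - O1) \<union> L)" by blast
      then show "connected_component (- ((frontier U - O1) \<union> L)) a b"
        by (rule connected_component_subset[OF G(1) _ G(4,5)])
    qed
    then obtain T where T: "connected T" "T \<subseteq> - (((frontier U - O1) \<union> L) \<union> ((frontier U - O2) \<union> L))" "a \<in> T" "b \<in> T"
      unfolding connected_component_def by blast
    then have "T \<inter> frontier U = {}" using O(5) by blast
    moreover have "T \<inter> U \<noteq> {}" "T - U \<noteq> {}" using T U closure_subset by blast+
    ultimately show False using connected_Int_frontier[OF T(1)] by blast
  qed
  then show thesis
    using component_meets_both[of "frontier U \<inter> D" Y G] cF D(1) Y(2) G(2) that by (metis compact_Int_closed)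
qed

lemma connected_arc_minus_end:
  fixes A :: "'a::real_normed_vector set"
  assumes "arc_from_to A a b"
  shows "connected (A - {b})"
proof -
  obtain g where g: "arc g" "path_image g = A" "pathstart g = a" "pathfinish g = b"
    using assms unfolding arc_from_to_def by blast
  have inj: "inj_on g {0..1}" using g(1) unfolding arc_def by blast
  have "A - {b} = g ` {0..<1}"
  proof -
    have "{0..1::real} = insert 1 {0..<1}" by auto
    then have "A = insert b (g ` {0..<1})"
      using g unfolding path_image_def pathfinish_def by (metis image_insert)
    moreover have "b \<notin> g ` {0..<1}"
      using inj g(4) unfolding pathfinish_def inj_on_def by force
    ultimately show ?thesis by auto
  qed
  moreover have "continuous_on {0..<1} g"
    using g(1) unfolding arc_def path_def by (meson atLeastLessThan_subseteq_atLeastAtMost_iff continuous_on_subset order_refl)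
  ultimately show ?thesis by (simp add: connected_continuous_image)
qed

text \<open>The curve is a quadrilateral with opposite sides \<open>S\<close>, \<open>G\<close> and
  \<open>A1\<close>, \<open>A2\<close>, and \<open>K\<close> and \<open>H\<close> connect opposite
  sides outside \<open>J\<close>. A crosscut \<open>d\<close> of \<open>J\<close> from
  \<open>A1\<close> to \<open>A2\<close> separates the part of \<open>J\<close> near
  \<open>S\<close> from the part near \<open>G\<close>; if \<open>H\<close> missed \<open>K\<close>,
  Janiszewski's theorem would join the two parts inside \<open>J - d\<close>.\<close>

lemma crossing_continua:
  fixes S :: "(real ^ 2) set"
  assumes arcs: "arc_from_to S u n" "arc_from_to A1 u a" "arc_from_to G a a'" "arc_from_to A2 n a'"
    and ints: "S \<inter> A1 = {u}" "S \<inter> A2 = {n}" "A1 \<inter> G = {a}" "G \<inter> A2 = {a'}" "S \<inter> G = {}" "A1 \<inter> A2 = {}"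
    and IJ: "open I" "connected I" "I \<noteq> {}" "open J" "connected J" "I \<inter> J = {}"
      "I \<union> J = - (S \<union> A1 \<union> G \<union> A2)" "frontier I = S \<union> A1 \<union> G \<union> A2" "frontier J = S \<union> A1 \<union> G \<union> A2"
    and K: "compact K" "connected K" "K \<subseteq> - J" "A1 \<subseteq> K" "A2 \<subseteq> K"
    and H: "connected H" "H \<subseteq> - J" "H \<inter> K = {}" "H \<inter> S \<noteq> {}" "H \<inter> G \<noteq> {}"
  shows False
proof -
  let ?C = "S \<union> A1 \<union> G \<union> A2"
  have ends: "u \<in> S" "n \<in> S" "u \<noteq> n" "u \<in> A1" "a \<in> A1" "u \<noteq> a" "a \<in> G" "a' \<in> G" "a \<noteq> a'" "n \<in> A2" "a' \<in> A2" "n \<noteq> a'"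
    using arcs arc_from_to_ends by metis+
  have cl: "closed S" "closed A1" "closed G" "closed A2" using arcs arc_from_to_closed by metis+
  have ope: "openin (top_of_set (frontier J)) (A1 - {u, a})" "openin (top_of_set (frontier J)) (A2 - {n, a'})"
  proof -
    have "A1 - {u, a} = ?C - (S \<union> G \<union> A2)" "A2 - {n, a'} = ?C - (S \<union> A1 \<union> G)"
      using ints by auto
    moreover have "closed (S \<union> G \<union> A2)" "closed (S \<union> A1 \<union> G)" using cl by auto
    ultimately show "openin (top_of_set (frontier J)) (A1 - {u, a})" "openin (top_of_set (frontier J)) (A2 - {n, a'})"
      unfolding IJ(9) by (metis Diff_eq open_Compl openin_open_Int)+
  qed
  have ne: "A - {x, y} \<noteq> {}" if "arc_from_to A x y" for A :: "(real ^ 2) set" and x y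
  proof
    assume "A - {x, y} = {}"
    then have "A = {x, y}" using arc_from_to_ends[OF that] by auto
    moreover have "connected A" "x \<noteq> y" using that arc_from_to_connected arc_from_to_ends by blast+
    ultimately show False using connected_finite_iff_sing[of A] by auto
  qed
  have "A1 - {u, a} \<noteq> A2 - {n, a'}"
  proof
    assume eq: "A1 - {u, a} = A2 - {n, a'}"
    obtain z where "z \<in> A1 - {u, a}" using ne[OF arcs(2)] by blast
    then show False using eq ints(6) by auto
  qed
  \<comment> \<open>Accessible points are dense in the frontier, so both open sides contain an end
    of a crosscut in \<open>J\<close>.\<close>
  then obtain g where g: "arc g" "pathstart g \<in> A1 - {u, a}" "pathfinish g \<in> A2 - {n, a'}" "g ` {0<..<1} \<subseteq> J"
    using dense_accessible_frontier_point_pairs[OF IJ(4,5) ope ne[OF arcs(2)] ne[OF arcs(4)]] by metis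
  define b where "b = pathstart g"
  define b' where "b' = pathfinish g"
  define d where "d = path_image g"
  have darc: "arc_from_to d b b'" unfolding arc_from_to_def d_def b_def b'_def using g by blast
  have b: "b \<in> A1" "b \<noteq> u" "b \<noteq> a" "b' \<in> A2" "b' \<noteq> n" "b' \<noteq> a'" using g unfolding b_def b'_def by auto
  have dJ: "d - {b, b'} \<subseteq> J"
  proof
    fix x assume "x \<in> d - {b, b'}"
    then obtain t where t: "t \<in> {0..1}" "x = g t" "x \<noteq> g 0" "x \<noteq> g 1"
      unfolding d_def path_image_def b_def b'_def pathstart_def pathfinish_def by auto
    then have "t \<in> {0<..<1}" by (metis atLeastAtMost_iff greaterThanLessThan_iff less_eq_real_def)
    then show "x \<in> J" using t g(4) by blast
  qed
  obtain P Q where PQ: "arc_from_to P u b" "arc_from_to Q b a" "A1 = P \<union> Q" "P \<inter> Q = {b}"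
    using arc_from_to_split[OF arcs(2)] b by metis
  obtain P' Q' where PQ': "arc_from_to P' n b'" "arc_from_to Q' b' a'" "A2 = P' \<union> Q'" "P' \<inter> Q' = {b'}"
    using arc_from_to_split[OF arcs(4)] b by metis
  have un: "u \<in> P" "u \<notin> Q" "n \<in> P'" "n \<notin> Q'" "a \<in> Q" "a \<notin> P" "a' \<in> Q'" "a' \<notin> P'"
    using arc_from_to_ends[OF PQ(1)] arc_from_to_ends[OF PQ(2)] PQ(4) arc_from_to_ends[OF PQ'(1)] arc_from_to_ends[OF PQ'(2)] PQ'(4)
      b by auto
  define C1 where "C1 = P \<union> S \<union> P'"
  define C2 where "C2 = Q \<union> G \<union> Q'"
  have bC: "b \<in> P" "b \<in> Q" "b' \<in> P'" "b' \<in> Q'" using PQ(4) PQ'(4) by auto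
  have sub: "P \<subseteq> A1" "Q \<subseteq> A1" "P' \<subseteq> A2" "Q' \<subseteq> A2" using PQ PQ' by auto
  have I1: "P \<inter> S = {u}" using sub(1) ints(1) un(1) by auto
  have I2: "S \<inter> P' = {n}" using sub(3) ints(2) un(3) by auto
  have I3: "P \<inter> P' = {}" "P \<inter> Q' = {}" "Q \<inter> P' = {}" "Q \<inter> Q' = {}" using sub ints(6) by blast+
  have I4: "Q \<inter> G = {a}" using sub(2) ints(3) un(5) by auto
  have I5: "G \<inter> Q' = {a'}" using sub(4) ints(4) un(7) by auto
  have I6: "P \<inter> G = {}" using sub(1) ints(3) un(6) by auto
  have I7: "P' \<inter> G = {}" using sub(3) ints(4) un(8) by auto
  have I8: "S \<inter> Q = {}" using sub(2) ints(1) un(2) by auto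
  have I9: "S \<inter> Q' = {}" using sub(4) ints(2) un(4) by auto
  have "arc_from_to (P \<union> S) b n"
    by (rule arc_from_to_join[OF arc_from_to_sym[OF PQ(1)] arcs(1) I1])
  then have C1: "arc_from_to C1 b b'" unfolding C1_def
    by (rule arc_from_to_join[OF _ PQ'(1)]) (simp add: Int_Un_distrib2 I2 I3)
  have "arc_from_to (Q \<union> G) b a'"
    by (rule arc_from_to_join[OF PQ(2) arcs(3) I4])
  then have C2: "arc_from_to C2 b b'" unfolding C2_def
    by (rule arc_from_to_join[OF _ arc_from_to_sym[OF PQ'(2)]]) (simp add: Int_Un_distrib2 I3 I5)
  have C12: "C1 \<union> C2 = ?C" unfolding C1_def C2_def using PQ PQ' by auto
  have C1C2: "C1 \<inter> C2 = {b, b'}"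
    using I3(3) unfolding C1_def C2_def
    by (simp add: Int_Un_distrib Int_Un_distrib2 PQ(4) PQ'(4) I3 I6 I7 I8 I9 ints(5) Int_commute[of P' Q] insert_commute)
  have dC: "d \<inter> (C1 \<union> C2) = {b, b'}"
    using dJ IJ(7) bC arc_from_to_ends[OF darc] C12 unfolding C1_def by blast
  have IJ': "J \<inter> I = {}" "J \<union> I = - (C1 \<union> C2)" "frontier I = C1 \<union> C2"
    using IJ(6,7,8) C12 by auto
  obtain R1 R2 where R: "open R1" "open R2" "R1 \<inter> R2 = {}" "R1 \<union> R2 = J - d"
    "closure R1 \<inter> (C2 - {b, b'}) = {}" "closure R2 \<inter> (C1 - {b, b'}) = {}"
    using theta_sides[OF C1 C2 darc C1C2 dC IJ(4,1,3,2) IJ' dJ] by metis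
  have dcl: "closed d" using darc arc_from_to_closed by blast
  have Hd: "H \<inter> d = {}" using H(2,3) dJ K(4,5) b by blast
  obtain s where s: "s \<in> H" "s \<in> S" using H by blast
  obtain h where h: "h \<in> H" "h \<in> G" using H by blast
  \<comment> \<open>\<open>z\<close> is a point of \<open>J\<close> in a ball around
    \<open>x\<close> that avoids \<open>K \<union> d\<close>; as the ball also avoids one of the two
    regions, \<open>z\<close> belongs to the other.\<close>
  have near: "\<exists>B z. connected B \<and> x \<in> B \<and> z \<in> B \<and> B \<subseteq> - (K \<union> d) \<and> z \<in> R"
    if x: "x \<in> H" "x \<in> ?C" and R: "x \<notin> closure R'" "J - d \<subseteq> R \<union> R'" for x R R'
  proof -
    have "open (- (K \<union> d \<union> closure R'))" using K(1) dcl compact_imp_closed by auto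
    moreover have "x \<in> - (K \<union> d \<union> closure R')" using x R H(3) Hd by blast
    ultimately obtain e where e: "e > 0" "ball x e \<subseteq> - (K \<union> d \<union> closure R')"
      by (meson open_contains_ball)
    have "x \<in> closure J" using x IJ(9) by (auto simp: frontier_def)
    then obtain z where z: "z \<in> J" "dist z x < e" using e(1) closure_approachable by blast
    then have "z \<in> ball x e" by (simp add: dist_commute)
    moreover have "z \<in> R" using z e \<open>z \<in> ball x e\<close> R(2) closure_subset by blast
    ultimately show ?thesis using e by (intro exI[of _ "ball x e"] exI[of _ z]) auto
  qed
  have "s \<notin> K" "h \<notin> K" using s h H by auto
  have "s \<notin> closure R2" using s R(6) b K \<open>s \<notin> K\<close> unfolding C1_def by blast
  then obtain B s' where B: "connected B" "s \<in> B" "s' \<in> B" "B \<subseteq> - (K \<union> d)" "s' \<in> R1"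
    using near[of s R2 R1] s R(4) by blast
  have "h \<notin> closure R1" using h R(5) b K \<open>h \<notin> K\<close> unfolding C2_def by blast
  then obtain B' h' where B': "connected B'" "h \<in> B'" "h' \<in> B'" "B' \<subseteq> - (K \<union> d)" "h' \<in> R2"
    using near[of h R1 R2] h R(4) by blast
  have "connected_component (- ((K \<union> d) \<union> (- J))) s' h'"
  proof (rule Janiszewski_plane)
    show "compact (K \<union> d)" using K(1) darc arc_from_to_compact by blast
    show "closed (- J)" using IJ(4) by auto
    \<comment> \<open>The crosscut meets \<open>- J\<close> only in its ends, and these belong to
      \<open>K\<close>, so the overlap is connected.\<close>
    have "(K \<union> d) \<inter> - J = K" using K dJ b by blast
    then show "connected ((K \<union> d) \<inter> - J)" using K(2) by simp
    have "connected (B \<union> H)" by (rule connected_Un[OF B(1) H(1)]) (use B s in blast)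
    then have "connected ((B \<union> H) \<union> B')" by (rule connected_Un[OF _ B'(1)]) (use B' h in blast)
    moreover have "B \<union> H \<union> B' \<subseteq> - (K \<union> d)" using B(4) B'(4) H(3) Hd by blast
    ultimately show "connected_component (- (K \<union> d)) s' h'"
      by (rule connected_component_subset) (use B B' in auto)
    show "connected_component (- (- J)) s' h'"
      by (rule connected_component_subset[OF IJ(5)]) (use B B' R(4) in auto)
  qed
  then obtain T where T: "connected T" "T \<subseteq> - ((K \<union> d) \<union> (- J))" "s' \<in> T" "h' \<in> T"
    unfolding connected_component_def by blast
  then have "T \<subseteq> R1 \<union> R2" using R(4) by blast
  then show False
    using connected_in_one_side[OF T(1) _ R(1,2,3)] T(3,4) B(5) B'(5) R(3) by blast
qed

section \<open>Joining by continua, and the partition on one side of a curve\<close>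

definition cjoin :: "'a::metric_space set \<Rightarrow> 'a \<Rightarrow> 'a \<Rightarrow> bool" where
  "cjoin M x y \<longleftrightarrow> (\<exists>K. compact K \<and> connected K \<and> K \<subseteq> M \<and> x \<in> K \<and> y \<in> K)"

lemma cjoinI: "compact K \<Longrightarrow> connected K \<Longrightarrow> K \<subseteq> M \<Longrightarrow> x \<in> K \<Longrightarrow> y \<in> K \<Longrightarrow> cjoin M x y"
  unfolding cjoin_def by blast

lemma cjoinE:
  assumes "cjoin M x y"
  obtains K where "compact K" "connected K" "K \<subseteq> M" "x \<in> K" "y \<in> K"
  using assms unfolding cjoin_def by blast

lemma cjoin_mono: "cjoin M x y \<Longrightarrow> M \<subseteq> N \<Longrightarrow> cjoin N x y"
  unfolding cjoin_def by blast

lemma cjoin_sym: "cjoin M x y \<Longrightarrow> cjoin M y x"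
  unfolding cjoin_def by blast

lemma cjoin_trans:
  assumes "cjoin M x y" "cjoin M y z"
  shows "cjoin M x z"
proof -
  obtain K where K: "compact K" "connected K" "K \<subseteq> M" "x \<in> K" "y \<in> K" using assms(1) by (rule cjoinE)
  obtain L where L: "compact L" "connected L" "L \<subseteq> M" "y \<in> L" "z \<in> L" using assms(2) by (rule cjoinE)
  have "connected (K \<union> L)" by (rule connected_Un[OF K(2) L(2)]) (use K L in blast)
  then show ?thesis using K L by (intro cjoinI[of "K \<union> L"]) auto
qed

text \<open>Connectedness im kleinen at every point, with continua as the connecting sets so that it
  feeds directly into \<open>cjoin\<close>.\<close>

definition conn_im_kleinen :: "'a::metric_space set \<Rightarrow> bool" where
  "conn_im_kleinen A \<longleftrightarrow> (\<forall>x\<in>A. \<forall>e>0. \<exists>d>0. \<forall>c\<in>A. dist x c < d \<longrightarrow> cjoin (A \<inter> ball x e) x c)"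

lemma conn_im_kleinen_arc:
  fixes A :: "'a::real_normed_vector set"
  assumes "arc_from_to A a b"
  shows "conn_im_kleinen A"
  unfolding conn_im_kleinen_def
proof (intro ballI allI impI)
  fix x and e :: real assume x: "x \<in> A" and e: "e > 0"
  obtain g where g: "arc g" "path_image g = A"
    using assms unfolding arc_from_to_def by blast
  have inj: "inj_on g {0..1}" and cg: "continuous_on {0..1} g"
    using g(1) unfolding arc_def path_def by blast+
  obtain t where t: "t \<in> {0..1}" "g t = x" using x g(2) unfolding path_image_def by blast
  obtain r where r: "r > 0" "\<And>s. s \<in> {0..1} \<Longrightarrow> dist s t < r \<Longrightarrow> dist (g s) x < e"
    using cg t e unfolding continuous_on_iff by metis
  have "compact (g ` ({0..1} - ball t r))"
    by (intro compact_continuous_image continuous_on_subset[OF cg] compact_diff) auto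
  then have "open (- (g ` ({0..1} - ball t r)))" by (simp add: compact_imp_closed open_Compl)
  moreover have "x \<notin> g ` ({0..1} - ball t r)"
  proof
    assume "x \<in> g ` ({0..1} - ball t r)"
    then obtain s where "s \<in> {0..1}" "s \<notin> ball t r" "g s = g t" using t by auto
    then have "s = t" using inj t unfolding inj_on_def by blast
    then show False using \<open>s \<notin> ball t r\<close> r(1) by simp
  qed
  ultimately obtain d where d: "d > 0" "ball x d \<subseteq> - (g ` ({0..1} - ball t r))"
    by (meson ComplI open_contains_ball)
  have "cjoin (A \<inter> ball x e) x c" if c: "c \<in> A" "dist x c < d" for c
  proof -
    obtain s where s: "s \<in> {0..1}" "g s = c" using c g(2) unfolding path_image_def by blast
    have "c \<notin> g ` ({0..1} - ball t r)" using d(2) c by auto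
    then have str: "dist t s < r" using s by auto
    have sub: "closed_segment s t \<subseteq> {0..1}" "closed_segment s t \<subseteq> ball t r"
      using s t str r(1) by (simp_all add: closed_segment_subset)
    show ?thesis
    proof (rule cjoinI[of "g ` closed_segment s t"])
      show "compact (g ` closed_segment s t)" "connected (g ` closed_segment s t)"
        using continuous_on_subset[OF cg sub(1)] by (auto intro: compact_continuous_image connected_continuous_image)
      show "g ` closed_segment s t \<subseteq> A \<inter> ball x e"
        using sub r(2) g(2) unfolding path_image_def by (force simp: dist_commute)
    qed (use s t in auto)
  qed
  then show "\<exists>d>0. \<forall>c\<in>A. dist x c < d \<longrightarrow> cjoin (A \<inter> ball x e) x c" using d(1) by blast
qed

lemma conn_im_kleinen_Un:
  assumes "conn_im_kleinen A" "conn_im_kleinen B" "closed A" "closed B"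
  shows "conn_im_kleinen (A \<union> B)"
  unfolding conn_im_kleinen_def
proof (intro ballI allI impI)
  fix x and e :: real assume x: "x \<in> A \<union> B" and e: "e > 0"
  have one: "\<exists>d>0. \<forall>c\<in>M. dist x c < d \<longrightarrow> cjoin (M \<inter> ball x e) x c"
    if M: "conn_im_kleinen M" "closed M" for M
  proof (cases "x \<in> M")
    case True
    then show ?thesis using M(1) e unfolding conn_im_kleinen_def by blast
  next
    case False
    then obtain d where "d > 0" "ball x d \<subseteq> - M"
      using M(2) by (metis ComplI open_Compl open_contains_ball)
    then show ?thesis by (intro exI[of _ d]) auto
  qed
  obtain d1 where d1: "d1 > 0" "\<forall>c\<in>A. dist x c < d1 \<longrightarrow> cjoin (A \<inter> ball x e) x c"
    using one[OF assms(1,3)] by blast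
  obtain d2 where d2: "d2 > 0" "\<forall>c\<in>B. dist x c < d2 \<longrightarrow> cjoin (B \<inter> ball x e) x c"
    using one[OF assms(2,4)] by blast
  have "cjoin ((A \<union> B) \<inter> ball x e) x c" if "c \<in> A \<union> B" "dist x c < min d1 d2" for c
    using that d1(2) d2(2) cjoin_mono[of "A \<inter> ball x e" x c "(A \<union> B) \<inter> ball x e"]
      cjoin_mono[of "B \<inter> ball x e" x c "(A \<union> B) \<inter> ball x e"] by auto
  then show "\<exists>d>0. \<forall>c\<in>A \<union> B. dist x c < d \<longrightarrow> cjoin ((A \<union> B) \<inter> ball x e) x c"
    using d1(1) d2(1) by (intro exI[of _ "min d1 d2"]) auto
qed

text \<open>\<open>U\<close> leaves \<open>D\<close> only through \<open>C\<close>. If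
  \<open>U \<inter> D\<close> split, the connected set \<open>U \<inter> C\<close> would lie in one
  piece; the other piece would lie in \<open>I\<close> and split off from all of
  \<open>U\<close>.\<close>

lemma connected_Int_closed_domain:
  fixes U :: "'a::metric_space set"
  assumes "connected U" "compact U" "closed D" "closed C" "open I" "D = I \<union> C" "I \<inter> C = {}" "connected (U \<inter> C)" "U \<inter> C \<noteq> {}"
  shows "connected (U \<inter> D)"
proof (rule ccontr)
  assume nc: "\<not> connected (U \<inter> D)"
  have clU: "closed U" using compact_imp_closed[OF assms(2)] .
  then have clUD: "closed (U \<inter> D)" using assms(3) by (rule closed_Int)
  obtain K1 K2 where K: "closed K1" "closed K2" "K1 \<noteq> {}" "K2 \<noteq> {}" "K1 \<union> K2 = U \<inter> D" "K1 \<inter> K2 = {}"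
    using nc unfolding connected_closed_set[OF clUD] by metis
  have main: False if K: "closed K1" "closed K2" "K2 \<noteq> {}" "K1 \<union> K2 = U \<inter> D" "K1 \<inter> K2 = {}" "U \<inter> C \<subseteq> K1" for K1 K2
  proof -
    have "K2 \<subseteq> I" using K assms by auto
    have "U = K2 \<union> (K1 \<union> (U - I))" using K(4) assms(6) by auto
    moreover have "closed (K1 \<union> (U - I))" using K(1) clU assms(5) by (intro closed_Un closed_Diff)
    moreover have "K2 \<inter> (K1 \<union> (U - I)) = {}" using K(5) \<open>K2 \<subseteq> I\<close> by blast
    moreover have "K1 \<union> (U - I) \<noteq> {}" using K(6) assms(9) by blast
    ultimately show False
      using assms(1) K(2,3) unfolding connected_closed_set[OF clU] by metis
  qed
  have sub: "U \<inter> C \<subseteq> K1 \<union> K2" using K assms by auto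
  have "U \<inter> C \<subseteq> K1 \<or> U \<inter> C \<subseteq> K2"
  proof (rule ccontr)
    assume "\<not> ?thesis"
    then have "K1 \<inter> (U \<inter> C) \<noteq> {}" "K2 \<inter> (U \<inter> C) \<noteq> {}" using sub by auto
    moreover have "K1 \<inter> K2 \<inter> (U \<inter> C) = {}" using K by auto
    ultimately show False using connected_closedD[OF assms(8) _ sub] K(1,2) by metis
  qed
  then show False using main[of K1 K2] main[of K2 K1] K by (metis Int_commute Un_commute)
qed

text \<open>\<open>H\<close> is a barrier in the closed side \<open>- J\<close>, and
  \<open>P\<close> collects the points of \<open>E\<close> that continua off \<open>H\<close> join
  to \<open>U\<close>. Nearby points can always be joined, so \<open>P\<close> and its complement
  are relatively closed. A join between \<open>U\<close> and \<open>V\<close> would be a continuum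
  across the side that misses \<open>H\<close>, against \<open>crossing_continua\<close>.\<close>

lemma partition_of_crossing:
  fixes S :: "(real ^ 2) set"
  assumes arcs: "arc_from_to S u n" "arc_from_to A1 u a" "arc_from_to G a a'" "arc_from_to A2 n a'"
    and ints: "S \<inter> A1 = {u}" "S \<inter> A2 = {n}" "A1 \<inter> G = {a}" "G \<inter> A2 = {a'}" "S \<inter> G = {}" "A1 \<inter> A2 = {}"
    and IJ: "open I" "connected I" "I \<noteq> {}" "open J" "connected J" "I \<inter> J = {}"
      "I \<union> J = - (S \<union> A1 \<union> G \<union> A2)" "frontier I = S \<union> A1 \<union> G \<union> A2" "frontier J = S \<union> A1 \<union> G \<union> A2"
    and UV: "compact U" "connected U" "compact V" "connected V" "U \<subseteq> E" "V \<subseteq> E"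
    and C: "U \<inter> (S \<union> A1 \<union> G \<union> A2) = A1" "V \<inter> (S \<union> A1 \<union> G \<union> A2) = A2" "E \<inter> (S \<union> A1 \<union> G \<union> A2) \<subseteq> A1 \<union> A2"
    and H: "compact H" "connected H" "H \<subseteq> - J" "H \<inter> E = {}" "H \<inter> S \<noteq> {}" "H \<inter> G \<noteq> {}"
  obtains P where "P \<subseteq> E - J" "closedin (top_of_set E) P" "closedin (top_of_set E) (E - J - P)"
    "U - J \<subseteq> P" "(V - J) \<inter> P = {}"
proof -
  let ?C = "S \<union> A1 \<union> G \<union> A2"
  have clC: "closed ?C" using IJ(8) by (metis frontier_closed)
  have lcC: "conn_im_kleinen ?C"
    using arcs by (intro conn_im_kleinen_Un) (auto intro: conn_im_kleinen_arc arc_from_to_closed)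
  define D where "D = - J"
  have D: "closed D" "D = I \<union> ?C" "I \<inter> ?C = {}" using IJ(4,6,7) unfolding D_def by auto
  have A12: "A1 \<noteq> {}" "A2 \<noteq> {}" "connected A1" "connected A2"
    using arcs(2,4) arc_from_to_ends arc_from_to_connected by blast+
  have UD: "connected (U \<inter> D)" "connected (V \<inter> D)"
    using connected_Int_closed_domain[OF UV(2,1) D(1) clC IJ(1) D(2,3)]
      connected_Int_closed_domain[OF UV(4,3) D(1) clC IJ(1) D(2,3)] C A12 by auto
  define join where "join = cjoin (D - H)"
  have join_trans: "join x z" if "join x y" "join y z" for x y z
    using that cjoin_trans unfolding join_def by metis
  have join_sym: "join x y \<Longrightarrow> join y x" for x y unfolding join_def by (rule cjoin_sym)
  have joinU: "join x y" if "x \<in> U \<inter> D" "y \<in> U \<inter> D" for x y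
    unfolding join_def using that UD UV(1,5) D(1) H(4) by (intro cjoinI[of "U \<inter> D"]) auto
  \<comment> \<open>Near a point of \<open>I\<close> straight segments serve. Near a point of the
    curve, a point of \<open>I\<close> is first led straight to the curve and then along it, which
    is possible because the curve is connected im kleinen.\<close>
  have local: "\<exists>e>0. \<forall>y\<in>E \<inter> D. dist x y < e \<longrightarrow> join x y" if x: "x \<in> E \<inter> D" for x
  proof -
    have "x \<notin> H" using x H(4) by blast
    then obtain e0 where e0: "e0 > 0" "ball x e0 \<subseteq> - H"
      using H(1) compact_imp_closed by (metis ComplI open_Compl open_contains_ball)
    show ?thesis
    proof (cases "x \<in> I")
      case True
      then obtain e where e: "e > 0" "ball x e \<subseteq> I" using IJ(1) open_contains_ball by blast
      have "join x y" if "dist x y < min e e0" for y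
      proof -
        have "closed_segment x y \<subseteq> ball x e" "closed_segment x y \<subseteq> ball x e0"
          using that e e0 by (simp_all add: closed_segment_subset)
        then show ?thesis unfolding join_def using e(2) e0(2) D(2)
          by (intro cjoinI[of "closed_segment x y"]) auto
      qed
      then show ?thesis using e e0 by (intro exI[of _ "min e e0"]) auto
    next
      case False
      then have xC: "x \<in> ?C" using x D(2) by blast
      obtain d where d: "d > 0" "\<forall>c\<in>?C. dist x c < d \<longrightarrow> cjoin (?C \<inter> ball x e0) x c"
        using lcC xC e0(1) unfolding conn_im_kleinen_def by metis
      have "?C \<inter> ball x e0 \<subseteq> D - H" using e0(2) D(2) by blast
      then have joinC: "join x c" if "c \<in> ?C" "dist x c < d" for c
        using d(2) that cjoin_mono unfolding join_def by metis
      have "join x y" if y: "y \<in> E \<inter> D" "dist x y < min d e0" for y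
      proof (cases "y \<in> ?C")
        case True then show ?thesis using joinC y by simp
      next
        case False
        then have yI: "y \<in> I" "y \<noteq> x" using y D(2) xC by auto
        obtain c A where c: "c \<in> ?C" "c \<in> closed_segment y x" "arc_from_to A y c" "A \<subseteq> closed_segment y x" "A \<inter> ?C = {c}"
          using arc_first_hit[OF arc_from_to_segment[OF yI(2)] clC] xC False ends_in_segment(2) by (metis IntI empty_iff)
        have "closed_segment y x \<subseteq> ball x (min d e0)" using y d(1) e0(1) by (intro closed_segment_subset) auto
        then have "c \<in> ball x (min d e0)" "A \<subseteq> ball x e0" using c(2,4) by auto
        then have "dist x c < d" "A \<subseteq> - H" using e0(2) by auto
        have "A - {c} \<subseteq> I"
        proof -
          have "A - {c} \<subseteq> I \<union> J" using c(5) IJ(7) by blast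
          then have "A - {c} \<subseteq> I \<or> A - {c} \<subseteq> J"
            using connected_in_one_side[OF connected_arc_minus_end[OF c(3)] _ IJ(1,4,6)] by blast
          moreover have "y \<in> A - {c}" using arc_from_to_ends[OF c(3)] by blast
          ultimately show ?thesis using yI IJ(6) by blast
        qed
        then have "A \<subseteq> D - H" using D(2) c(1) \<open>A \<subseteq> - H\<close> by blast
        then have "join c y"
          unfolding join_def using arc_from_to_ends[OF c(3)]
          by (intro cjoinI[of A]) (auto intro: arc_from_to_compact[OF c(3)] arc_from_to_connected[OF c(3)])
        then show ?thesis using joinC[OF c(1) \<open>dist x c < d\<close>] join_trans by blast
      qed
      then show ?thesis using d(1) e0(1) by (intro exI[of _ "min d e0"]) auto
    qed
  qed
  define P where "P = {x \<in> E \<inter> D. \<exists>y \<in> U \<inter> D. join x y}"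
  have noJoin: False if xy: "x \<in> V \<inter> D" "y \<in> U \<inter> D" "join x y" for x y
  proof -
    obtain K where K: "compact K" "connected K" "K \<subseteq> D - H" "x \<in> K" "y \<in> K"
      using xy(3) unfolding join_def by (rule cjoinE)
    have con: "connected (K \<union> (U \<inter> D))" by (rule connected_Un[OF K(2) UD(1)]) (use K xy in blast)
    have "connected ((K \<union> (U \<inter> D)) \<union> (V \<inter> D))" by (rule connected_Un[OF con UD(2)]) (use K xy in blast)
    moreover have "compact ((K \<union> (U \<inter> D)) \<union> (V \<inter> D))" using K UV D(1) by (auto intro!: compact_Un compact_Int_closed)
    moreover have "(K \<union> (U \<inter> D)) \<union> (V \<inter> D) \<subseteq> - J" using K(3) unfolding D_def by blast
    moreover have "A1 \<subseteq> (K \<union> (U \<inter> D)) \<union> (V \<inter> D)" "A2 \<subseteq> (K \<union> (U \<inter> D)) \<union> (V \<inter> D)" using C(1,2) D(2) by blast+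
    moreover have "H \<inter> ((K \<union> (U \<inter> D)) \<union> (V \<inter> D)) = {}" using K(3) H(4) UV(5,6) by blast
    ultimately show False
      using crossing_continua[OF arcs ints IJ, of "(K \<union> (U \<inter> D)) \<union> (V \<inter> D)" H] H(2,3,5,6) by blast
  qed
  have clED: "closedin (top_of_set E) (E \<inter> D)" using D(1) by (metis closedin_closed_Int)
  have "openin (top_of_set (E \<inter> D)) P"
    unfolding openin_contains_ball
  proof (intro conjI ballI)
    fix x assume xP: "x \<in> P"
    then obtain e where e: "e > 0" "\<And>y. y \<in> E \<inter> D \<Longrightarrow> dist x y < e \<Longrightarrow> join x y" using local unfolding P_def by blast
    have "y \<in> P" if "y \<in> E \<inter> D" "dist x y < e" for y
      using e(2)[OF that] xP that(1) join_trans join_sym unfolding P_def by blast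
    then show "\<exists>e>0. ball x e \<inter> (E \<inter> D) \<subseteq> P" using e(1) by (intro exI[of _ e]) auto
  qed (auto simp: P_def)
  then have "closedin (top_of_set (E \<inter> D)) (E \<inter> D - P)" by (metis closedin_diff closedin_subtopology_refl subset_UNIV topspace_euclidean)
  then have 1: "closedin (top_of_set E) (E \<inter> D - P)" using clED closedin_trans by blast
  have "openin (top_of_set (E \<inter> D)) (E \<inter> D - P)"
    unfolding openin_contains_ball
  proof (intro conjI ballI)
    fix x assume xP: "x \<in> E \<inter> D - P"
    then obtain e where e: "e > 0" "\<And>y. y \<in> E \<inter> D \<Longrightarrow> dist x y < e \<Longrightarrow> join x y" using local by blast
    have "y \<in> E \<inter> D - P" if "y \<in> E \<inter> D" "dist x y < e" for y
      using e(2)[OF that] xP that(1) join_trans unfolding P_def by blast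
    then show "\<exists>e>0. ball x e \<inter> (E \<inter> D) \<subseteq> E \<inter> D - P" using e(1) by (intro exI[of _ e]) auto
  qed auto
  then have "closedin (top_of_set (E \<inter> D)) (E \<inter> D - (E \<inter> D - P))" by (metis closedin_diff closedin_subtopology_refl subset_UNIV topspace_euclidean)
  moreover have "E \<inter> D - (E \<inter> D - P) = P" unfolding P_def by auto
  ultimately have 2: "closedin (top_of_set E) P" using clED closedin_trans by metis
  show thesis
  proof (rule that[OF _ 2])
    show "P \<subseteq> E - J" unfolding P_def D_def by auto
    have "E - J - P = E \<inter> D - P" unfolding D_def by auto
    then show "closedin (top_of_set E) (E - J - P)" using 1 by simp
    show "U - J \<subseteq> P" using joinU UV(5) unfolding P_def D_def by blast
    show "(V - J) \<inter> P = {}" using noJoin unfolding P_def D_def by blast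
  qed
qed

section \<open>Hausdorff distance and limits in compact sets\<close>

lemma infdist_le_hausdorff_dist:
  fixes A B :: "'a::metric_space set"
  assumes "compact A" "compact B" "B \<noteq> {}" "a \<in> A"
  shows "infdist a B \<le> hausdorff_dist A B"
proof -
  have "bounded ((\<lambda>a. infdist a B) ` A)"
    by (intro compact_imp_bounded compact_continuous_image continuous_intros assms)
  then have "infdist a B \<le> (SUP a\<in>A. infdist a B)"
    using assms(4) by (intro cSUP_upper) (auto simp: bounded_imp_bdd_above)
  then show ?thesis unfolding hausdorff_dist_def by simp
qed

lemma hausdorff_dist_commute: "hausdorff_dist A B = hausdorff_dist B A"
  unfolding hausdorff_dist_def by (simp add: max.commute)

lemma hausdorff_dist_le:
  fixes A B :: "'a::metric_space set"
  assumes "A \<noteq> {}" "B \<noteq> {}" "\<And>a. a \<in> A \<Longrightarrow> infdist a B \<le> e" "\<And>b. b \<in> B \<Longrightarrow> infdist b A \<le> e"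
  shows "hausdorff_dist A B \<le> e"
  unfolding hausdorff_dist_def using assms by (simp add: cSUP_least)

lemma hausdorff_dist_nonneg:
  fixes A B :: "'a::metric_space set"
  assumes "compact A" "compact B" "A \<noteq> {}" "B \<noteq> {}"
  shows "0 \<le> hausdorff_dist A B"
proof -
  obtain a where "a \<in> A" using assms by blast
  then show ?thesis using infdist_le_hausdorff_dist[OF assms(1,2,4)] infdist_nonneg order_trans by metis
qed

lemma compact_unique_limit:
  fixes u :: "nat \<Rightarrow> 'a::metric_space"
  assumes "compact K" "\<And>n. u n \<in> K" "\<And>q l. strict_mono q \<Longrightarrow> (u \<circ> q) \<longlonglongrightarrow> l \<Longrightarrow> l \<in> K \<Longrightarrow> l = L"
  shows "u \<longlonglongrightarrow> L"
proof (rule ccontr)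
  assume "\<not> u \<longlonglongrightarrow> L"
  then obtain e where e: "e > 0" "\<forall>N. \<exists>n\<ge>N. e \<le> dist (u n) L"
    unfolding lim_sequentially by (meson not_le)
  then have "infinite {n. e \<le> dist (u n) L}" unfolding infinite_nat_iff_unbounded_le by blast
  then obtain q :: "nat \<Rightarrow> nat" where q: "strict_mono q" "\<And>n. q n \<in> {n. e \<le> dist (u n) L}"
    using infinite_enumerate by blast
  obtain l r where r: "l \<in> K" "strict_mono r" "((u \<circ> q) \<circ> r) \<longlonglongrightarrow> l"
    using assms(1,2) unfolding compact_def by (metis comp_apply)
  then have "l = L" using assms(3)[of "q \<circ> r" l] q(1) by (simp add: strict_mono_o comp_assoc)
  then have "(\<lambda>n. dist (((u \<circ> q) \<circ> r) n) L) \<longlonglongrightarrow> 0" using r(3) tendsto_dist_iff by blast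
  then have "e \<le> 0" by (rule LIMSEQ_le_const) (use q(2) in \<open>auto\<close>)
  then show False using e(1) by simp
qed

subsection \<open>Arcs in dendroids\<close>

lemma dendroidD:
  assumes "dendroid X"
  shows "compact X" "connected X"
    "\<And>K L. compact K \<Longrightarrow> connected K \<Longrightarrow> K \<subseteq> X \<Longrightarrow> compact L \<Longrightarrow> connected L \<Longrightarrow> L \<subseteq> X \<Longrightarrow> connected (K \<inter> L)"
    "\<And>x y. x \<in> X \<Longrightarrow> y \<in> X \<Longrightarrow> x \<noteq> y \<Longrightarrow> \<exists>A. A \<subseteq> X \<and> arc_from_to A x y"
  using assms unfolding dendroid_def continuum_def hereditarily_unicoherent_def arcwise_connected_def by auto

text \<open>Unicoherence makes \<open>A \<inter> K\<close> connected; it contains both ends of the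
  arc, so it is the whole arc. Applied to two arcs with the same ends it gives uniqueness.\<close>

lemma arc_subset_continuum:
  fixes X :: "'a::real_normed_vector set"
  assumes "dendroid X" "arc_from_to A x y" "A \<subseteq> X" "compact K" "connected K" "K \<subseteq> X" "x \<in> K" "y \<in> K"
  shows "A \<subseteq> K"
proof -
  have "connected (A \<inter> K)"
    by (rule dendroidD(3)[OF assms(1) arc_from_to_compact[OF assms(2)] arc_from_to_connected[OF assms(2)] assms(3,4,5,6)])
  then have "A \<inter> K = A"
    using connected_subset_arc_eq[OF assms(2)] arc_from_to_ends[OF assms(2)] assms by blast
  then show ?thesis by blast
qed

lemma the_arc_eq:
  fixes X :: "'a::real_normed_vector set"
  assumes "dendroid X" "arc_from_to A x y" "A \<subseteq> X"
  shows "the_arc X x y = A"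
proof -
  have sub: "B \<subseteq> B'" if "B \<subseteq> X" "arc_from_to B x y" "B' \<subseteq> X" "arc_from_to B' x y" for B B'
    using arc_subset_continuum[OF assms(1) that(2,1) arc_from_to_compact[OF that(4)] arc_from_to_connected[OF that(4)] that(3)]
      arc_from_to_ends[OF that(4)] by simp
  have "(THE A. A \<subseteq> X \<and> arc_from_to A x y) = A"
    by (rule the_equality) (use sub assms in \<open>blast+\<close>)
  then show ?thesis unfolding the_arc_def using arc_from_to_ends[OF assms(2)] by auto
qed

lemma the_arc_arc:
  fixes X :: "'a::real_normed_vector set"
  assumes "dendroid X" "x \<in> X" "y \<in> X" "x \<noteq> y"
  shows "arc_from_to (the_arc X x y) x y" "the_arc X x y \<subseteq> X"
  using dendroidD(4)[OF assms] the_arc_eq[OF assms(1)] by metis+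

lemma the_arc_refl [simp]: "the_arc X x x = {x}"
  unfolding the_arc_def by simp

locale dendroid_space =
  fixes X :: "'a::euclidean_space set"
  assumes dend: "dendroid X"
begin

abbreviation A where "A \<equiv> the_arc X"

lemma compact_X: "compact X" and connected_X: "connected X"
  using dendroidD[OF dend] by blast+

lemma closed_X: "closed X" using compact_X compact_imp_closed by blast

lemma A_compact: "x \<in> X \<Longrightarrow> y \<in> X \<Longrightarrow> compact (A x y)"
  by (cases "x = y") (auto intro: arc_from_to_compact the_arc_arc[OF dend])

lemma A_closed: "x \<in> X \<Longrightarrow> y \<in> X \<Longrightarrow> closed (A x y)"
  using A_compact compact_imp_closed by blast

lemma A_connected: "x \<in> X \<Longrightarrow> y \<in> X \<Longrightarrow> connected (A x y)"
  by (cases "x = y") (auto intro: arc_from_to_connected the_arc_arc[OF dend])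

lemma A_subset: "x \<in> X \<Longrightarrow> y \<in> X \<Longrightarrow> A x y \<subseteq> X"
  by (cases "x = y") (auto dest: the_arc_arc[OF dend])

lemma A_ends: "x \<in> X \<Longrightarrow> y \<in> X \<Longrightarrow> x \<in> A x y \<and> y \<in> A x y"
  by (cases "x = y") (auto dest: the_arc_arc[OF dend] arc_from_to_ends)

text \<open>This characterizes \<open>A x y\<close> as the least continuum through its ends and
  reduces inclusions between arcs to the membership of two points.\<close>

lemma A_min:
  assumes "compact K" "connected K" "K \<subseteq> X" "x \<in> K" "y \<in> K"
  shows "A x y \<subseteq> K"
proof (cases "x = y")
  case False
  then have "arc_from_to (A x y) x y" "A x y \<subseteq> X" using the_arc_arc[OF dend, of x y] assms by blast+
  then show ?thesis using arc_subset_continuum[OF dend] assms by blast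
qed (use assms in auto)

lemma A_commute:
  assumes "x \<in> X" "y \<in> X"
  shows "A x y = A y x"
proof -
  have "A x y \<subseteq> A y x" if "x \<in> X" "y \<in> X" for x y
    using A_min[OF A_compact[OF that(2,1)] A_connected[OF that(2,1)] A_subset[OF that(2,1)]] A_ends[OF that(2,1)]
    by simp
  then show ?thesis using assms by blast
qed

lemma A_eqI: "arc_from_to B x y \<Longrightarrow> B \<subseteq> X \<Longrightarrow> A x y = B"
  by (rule the_arc_eq[OF dend])

lemma A_triangle:
  assumes "x \<in> X" "y \<in> X" "z \<in> X"
  shows "A x y \<subseteq> A x z \<union> A z y"
proof (rule A_min)
  show "connected (A x z \<union> A z y)"
    using assms A_connected A_ends by (intro connected_Un) blast+
qed (use assms A_compact A_subset A_ends in blast)+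

lemma A_sub:
  assumes "x \<in> X" "y \<in> X" "z \<in> A x y"
  shows "A x z \<union> A z y = A x y" "A x z \<inter> A z y = {z}"
proof -
  have "A x z \<union> A z y = A x y \<and> A x z \<inter> A z y = {z}"
  proof (cases "z = x \<or> z = y")
    case True
    then show ?thesis using A_ends[OF assms(1,2)] by auto
  next
    case False
    then have xy: "x \<noteq> y" using assms by auto
    obtain B C where BC: "arc_from_to B x z" "arc_from_to C z y" "A x y = B \<union> C" "B \<inter> C = {z}"
      using arc_from_to_split[OF the_arc_arc(1)[OF dend assms(1,2) xy] assms(3)] False by metis
    have "A x z = B" "A z y = C"
      using A_eqI[OF BC(1)] A_eqI[OF BC(2)] A_subset[OF assms(1,2)] BC(3) by auto
    then show ?thesis using BC by auto
  qed
  then show "A x z \<union> A z y = A x y" "A x z \<inter> A z y = {z}" by blast+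
qed

lemma A_sub1: "x \<in> X \<Longrightarrow> y \<in> X \<Longrightarrow> z \<in> A x y \<Longrightarrow> A x z \<subseteq> A x y"
  using A_sub(1) by blast

lemma A_sub2: "x \<in> X \<Longrightarrow> y \<in> X \<Longrightarrow> z \<in> A x y \<Longrightarrow> A z y \<subseteq> A x y"
  using A_sub(1) by blast

lemma A_in: "x \<in> X \<Longrightarrow> y \<in> X \<Longrightarrow> z \<in> A x y \<Longrightarrow> z \<in> X"
  using A_subset by blast

lemma A_convex:
  assumes "x \<in> X" "y \<in> X" "a \<in> A x y" "b \<in> A x y"
  shows "A a b \<subseteq> A x y"
  using assms A_min[of "A x y" a b] A_compact A_connected A_subset by blast

lemma interior_not_endpoint:
  assumes "x \<in> X" "y \<in> X" "z \<in> A x y" "z \<noteq> x" "z \<noteq> y"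
  shows "z \<notin> endpoints X"
proof -
  have "x \<noteq> y" using assms by auto
  then have "arc_from_to (A x y) x y" "A x y \<subseteq> X" using the_arc_arc[OF dend] assms by blast+
  then show ?thesis unfolding endpoints_def using assms by blast
qed

end

section \<open>The order of a smooth dendroid from its root\<close>

locale rooted_dendroid = dendroid_space X for X :: "'a::euclidean_space set" +
  fixes p :: 'a
  assumes p: "p \<in> X"
    and smooth: "\<And>s x. (\<And>n. s n \<in> X) \<Longrightarrow> x \<in> X \<Longrightarrow> s \<longlonglongrightarrow> x \<Longrightarrow>
        (\<lambda>n. hausdorff_dist (the_arc X (s n) p) (the_arc X x p)) \<longlonglongrightarrow> 0"
begin

definition le :: "'a \<Rightarrow> 'a \<Rightarrow> bool" where
  "le x y \<longleftrightarrow> y \<in> X \<and> x \<in> A p y"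

lemma leD: "le x y \<Longrightarrow> x \<in> X \<and> y \<in> X \<and> x \<in> A p y"
  unfolding le_def using A_in p by blast

lemma le_refl: "x \<in> X \<Longrightarrow> le x x"
  unfolding le_def using A_ends p by blast

lemma p_le: "x \<in> X \<Longrightarrow> le p x"
  unfolding le_def using A_ends p by blast

lemma le_trans: "le x y \<Longrightarrow> le y z \<Longrightarrow> le x z"
  unfolding le_def using A_sub1[OF p] by blast

lemma le_antisym:
  assumes "le x y" "le y x"
  shows "x = y"
proof -
  have *: "x \<in> X" "y \<in> X" "x \<in> A p y" "y \<in> A p x" using assms leD by blast+
  then have "y \<in> A x y" using A_ends by blast
  then have "y \<in> A p x \<inter> A x y" using * by blast
  then show ?thesis unfolding A_sub(2)[OF p *(2,3)] by simp
qed

text \<open>If neither point were below the other, each would lie on the arc from the other one to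
  \<open>z\<close>; but \<open>A x y\<close> and \<open>A y z\<close> share only
  \<open>y\<close>.\<close>

lemma le_linear:
  assumes "le x z" "le y z"
  shows "le x y \<or> le y x"
proof -
  have *: "x \<in> X" "y \<in> X" "z \<in> X" "x \<in> A p z" "y \<in> A p z" using assms leD by blast+
  show ?thesis
  proof (rule ccontr)
    assume "\<not> ?thesis"
    then have n: "x \<notin> A p y" "y \<notin> A p x" unfolding le_def using * by auto
    then have yx: "y \<in> A x z" "x \<in> A y z"
      using A_sub(1)[OF p *(3,4)] A_sub(1)[OF p *(3,5)] * by blast+
    have "A x y \<inter> A y z = {y}" using A_sub(2)[OF *(1,3) yx(1)] .
    moreover have "x \<in> A x y" using A_ends * by blast
    ultimately have "x = y" using yx(2) by blast
    then show False using n A_ends p * by blast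
  qed
qed

text \<open>Between comparable ends, arcs are order intervals; this is the dictionary between arcs
  and \<open>le\<close> used from here on.\<close>

lemma A_le_iff:
  assumes "le x y"
  shows "z \<in> A x y \<longleftrightarrow> le x z \<and> le z y"
proof -
  have *: "x \<in> X" "y \<in> X" "x \<in> A p y" using assms leD by blast+
  show ?thesis
  proof
    assume z: "z \<in> A x y"
    then have zX: "z \<in> X" "le z y" using A_sub2[OF p *(2,3)] A_in[OF *(1,2)] * unfolding le_def by blast+
    have "le x z \<or> le z x" using le_linear assms zX by blast
    moreover have "z = x" if "le z x"
      using that A_sub(2)[OF p *(2,3)] z unfolding le_def by blast
    ultimately show "le x z \<and> le z y" using zX le_refl by blast
  next
    assume z: "le x z \<and> le z y"
    then have "z \<in> A p y" unfolding le_def by blast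
    then have "z \<in> A p x \<or> z \<in> A x y" using A_sub(1)[OF p *(2,3)] by blast
    moreover have "z = x" if "z \<in> A p x" using that z le_antisym * unfolding le_def by blast
    ultimately show "z \<in> A x y" using A_ends * by blast
  qed
qed

text \<open>The arc is contained in the union of the arcs from its ends to the root. Consequently an
  upward closed set that meets an arc contains one of its ends, which is how upward closed
  neighbourhoods are controlled later.\<close>

lemma A_down: "x \<in> X \<Longrightarrow> y \<in> X \<Longrightarrow> z \<in> A x y \<Longrightarrow> le z x \<or> le z y"
  using A_triangle[of x y p] A_commute[of x p] p unfolding le_def by blast

lemma less_not_endpoint: "le x y \<Longrightarrow> x \<noteq> y \<Longrightarrow> x \<noteq> p \<Longrightarrow> x \<notin> endpoints X"
  using interior_not_endpoint[of p y x] p leD by blast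

lemma smooth':
  assumes "\<And>n. s n \<in> X" "x \<in> X" "s \<longlonglongrightarrow> x"
  shows "(\<lambda>n. hausdorff_dist (A p (s n)) (A p x)) \<longlonglongrightarrow> 0"
  using smooth[OF assms] A_commute p assms by simp

text \<open>One half of smoothness: the arcs to \<open>b n\<close> come to lie near the arc to
  \<open>y\<close>, so limits of their points lie on it.\<close>

lemma le_closed:
  assumes "\<And>n. le (a n) (b n)" "a \<longlonglongrightarrow> x" "b \<longlonglongrightarrow> y"
  shows "le x y"
proof -
  have aX: "\<And>n. a n \<in> X" "\<And>n. b n \<in> X" using assms(1) leD by blast+
  have y: "y \<in> X" using closed_sequentially[OF closed_X, of b y] aX assms by blast
  have "(\<lambda>n. infdist (a n) (A p y)) \<longlonglongrightarrow> infdist x (A p y)"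
    using assms(2) by (intro tendsto_infdist)
  moreover have "(\<lambda>n. infdist (a n) (A p y)) \<longlonglongrightarrow> 0"
  proof (rule tendsto_sandwich[OF _ _ tendsto_const smooth'[OF aX(2) y assms(3)]])
    have "infdist (a n) (A p y) \<le> hausdorff_dist (A p (b n)) (A p y)" for n
      using infdist_le_hausdorff_dist[OF A_compact[OF p aX(2)] A_compact[OF p y]] A_ends[OF p y]
        assms(1)[of n] unfolding le_def by blast
    then show "\<forall>\<^sub>F n in sequentially. infdist (a n) (A p y) \<le> hausdorff_dist (A p (b n)) (A p y)" by simp
  qed (simp add: infdist_nonneg)
  ultimately have "infdist x (A p y) = 0" using LIMSEQ_unique by blast
  then have "x \<in> A p y"
    using in_closed_iff_infdist_zero[OF A_closed[OF p y]] A_ends[OF p y] by blast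
  then show ?thesis unfolding le_def using y by blast
qed

text \<open>The other half of smoothness: the arc to \<open>y\<close> lies near the arcs to
  \<open>b n\<close>, so \<open>a n\<close> can be a point of \<open>A p (b n)\<close> nearest to
  \<open>x\<close>.\<close>

lemma le_lower_limit:
  assumes "\<And>n. b n \<in> X" "b \<longlonglongrightarrow> y" "le x y"
  obtains a where "\<And>n. le (a n) (b n)" "a \<longlonglongrightarrow> x"
proof -
  have y: "y \<in> X" "x \<in> A p y" using assms(3) leD by blast+
  have "\<exists>a\<in>A p (b n). infdist x (A p (b n)) = dist x a" for n
    using infdist_attains_inf[OF A_closed[OF p assms(1)]] A_ends[OF p assms(1)] by blast
  then obtain a where a: "\<And>n. a n \<in> A p (b n)" "\<And>n. infdist x (A p (b n)) = dist x (a n)" by metis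
  have "dist (a n) x \<le> hausdorff_dist (A p (b n)) (A p y)" for n
    using infdist_le_hausdorff_dist[OF A_compact[OF p y(1)] A_compact[OF p assms(1)] _ y(2)]
      A_ends[OF p assms(1)] a(2) hausdorff_dist_commute dist_commute by (metis empty_iff)
  then have "(\<lambda>n. dist (a n) x) \<longlonglongrightarrow> 0"
    by (intro tendsto_sandwich[OF _ _ tendsto_const smooth'[OF assms(1) y(1) assms(2)]]) auto
  then have "a \<longlonglongrightarrow> x" using tendsto_dist_iff by blast
  then show thesis using that a(1) assms(1) unfolding le_def by blast
qed

subsection \<open>A strictly increasing height\<close>

text \<open>Moving a point of one arc to a nearest point of the other changes the 1-Lipschitz
  function \<open>g\<close> by at most the Hausdorff distance. With smoothness, the maximum of
  \<open>g\<close> along the arc from \<open>p\<close> depends continuously on its end.\<close>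

lemma SUP_arc_diff_le:
  assumes g: "\<And>x y. \<bar>g x - g y\<bar> \<le> dist x y" and xy: "x \<in> X" "y \<in> X"
  shows "\<bar>(SUP z\<in>A p x. g z) - (SUP z\<in>A p y. g z)\<bar> \<le> hausdorff_dist (A p x) (A p y)"
proof -
  have bdd: "bdd_above (g ` A p x)" if "x \<in> X" for x
  proof -
    have "continuous_on (A p x) g"
      unfolding continuous_on_iff using g by (metis dist_real_def le_less_trans)
    then show ?thesis using A_compact[OF p that] by (meson bounded_imp_bdd_above compact_continuous_image compact_imp_bounded)
  qed
  have main: "(SUP z\<in>A p x. g z) \<le> (SUP z\<in>A p y. g z) + hausdorff_dist (A p x) (A p y)" if xy: "x \<in> X" "y \<in> X" for x y
  proof (rule cSUP_least)
    fix z assume z: "z \<in> A p x"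
    obtain w where w: "w \<in> A p y" "infdist z (A p y) = dist z w"
      using infdist_attains_inf[OF A_closed[OF p xy(2)]] A_ends[OF p xy(2)] by blast
    have "g z \<le> g w + dist z w" using g[of z w] by simp
    moreover have "g w \<le> (SUP z\<in>A p y. g z)" by (rule cSUP_upper[OF w(1) bdd[OF xy(2)]])
    moreover have "dist z w \<le> hausdorff_dist (A p x) (A p y)"
      using infdist_le_hausdorff_dist[OF A_compact[OF p xy(1)] A_compact[OF p xy(2)] _ z] w by auto
    ultimately show "g z \<le> (SUP z\<in>A p y. g z) + hausdorff_dist (A p x) (A p y)" by simp
  qed (use A_ends[OF p xy(1)] in blast)
  show ?thesis using main[OF xy] main[OF xy(2,1)] by (simp add: hausdorff_dist_commute)
qed

text \<open>The height is a weighted sum of the maxima of countably many tent functions along the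
  arc from \<open>p\<close>. Each maximum grows with the arc; for strict growth some tent has to
  vanish on \<open>A p x\<close> and be positive at \<open>y\<close>.\<close>

lemma height_exists:
  "\<exists>f :: 'a \<Rightarrow> real. continuous_on X f \<and> (\<forall>x y. le x y \<and> x \<noteq> y \<longrightarrow> f x < f y)"
proof -
  obtain D :: "'a set" where D: "countable D" "\<And>S. open S \<Longrightarrow> S \<noteq> {} \<Longrightarrow> \<exists>d\<in>D. d \<in> S"
    using countable_dense_setE by metis
  define I where "I = D \<times> (\<rat> :: real set)"
  have "countable I" unfolding I_def using D(1) countable_rat by blast
  moreover have "I \<noteq> {}" unfolding I_def using D(2)[of UNIV] Rats_0 by auto
  ultimately obtain e :: "nat \<Rightarrow> 'a \<times> real" where e: "range e = I" by (metis uncountable_def)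
  \<comment> \<open>Tents with centres in a countable dense set and rational radii, cut off at 1 so
    that the series has a geometric majorant.\<close>
  define g where "g n z = min 1 (max 0 (snd (e n) - dist z (fst (e n))))" for n z
  have g01: "0 \<le> g n z" "g n z \<le> 1" for n z unfolding g_def by auto
  have gl: "\<bar>g n x - g n y\<bar> \<le> dist x y" for n x y
  proof -
    have "\<bar>dist x (fst (e n)) - dist y (fst (e n))\<bar> \<le> dist x y"
      using dist_triangle[of x "fst (e n)" y] dist_triangle[of y "fst (e n)" x] dist_commute[of x y] by linarith
    then show ?thesis unfolding g_def by linarith
  qed
  define s where "s n x = (SUP z\<in>A p x. g n z)" for n x
  have bdd: "bdd_above (g n ` A p x)" for n x using g01 by (auto intro!: bdd_aboveI[of _ 1])
  have s01: "0 \<le> s n x" "s n x \<le> 1" if "x \<in> X" for n x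
  proof -
    have "g n x \<le> s n x" unfolding s_def using bdd A_ends[OF p that] by (intro cSUP_upper) auto
    then show "0 \<le> s n x" using g01(1)[of n x] by linarith
    show "s n x \<le> 1" unfolding s_def using g01 A_ends[OF p that] by (intro cSUP_least) auto
  qed
  have scont: "continuous_on X (s n)" for n
    unfolding continuous_on_sequentially
  proof (intro allI ballI impI)
    fix u x assume ux: "x \<in> X" "(\<forall>m. u m \<in> X) \<and> u \<longlonglongrightarrow> x"
    have "dist ((s n \<circ> u) m) (s n x) \<le> hausdorff_dist (A p (u m)) (A p x)" for m
      using SUP_arc_diff_le[of "g n" "u m" x] gl ux unfolding s_def by (simp add: dist_real_def)
    moreover have "(\<lambda>m. hausdorff_dist (A p (u m)) (A p x)) \<longlonglongrightarrow> 0" using smooth'[of u x] ux by blast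
    ultimately have "(\<lambda>m. dist ((s n \<circ> u) m) (s n x)) \<longlonglongrightarrow> 0"
      using tendsto_sandwich[of "\<lambda>m. 0" "\<lambda>m. dist ((s n \<circ> u) m) (s n x)" sequentially "\<lambda>m. hausdorff_dist (A p (u m)) (A p x)" 0]
      by simp
    then show "(s n \<circ> u) \<longlonglongrightarrow> s n x" using tendsto_dist_iff by blast
  qed
  define f where "f x = (\<Sum>n. (1/2)^n * s n x)" for x
  have summ: "summable (\<lambda>n. (1/2)^n * s n x)" if "x \<in> X" for x
    by (rule summable_comparison_test'[OF summable_geometric[of "1/2::real"], of 0])
      (use s01[OF that] in \<open>auto simp: mult_left_le\<close>)
  have "continuous_on X f"
  proof (rule uniform_limit_theorem)
    show "uniform_limit X (\<lambda>n x. \<Sum>i<n. (1/2)^i * s i x) f sequentially"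
      unfolding f_def
      by (rule Weierstrass_m_test[OF _ summable_geometric[of "1/2::real"]])
        (use s01 in \<open>auto simp: mult_left_le abs_mult\<close>)
    show "\<forall>\<^sub>F n in sequentially. continuous_on X (\<lambda>x. \<Sum>i<n. (1/2)^i * s i x)"
      by (intro always_eventually allI continuous_intros scont)
  qed simp
  moreover have "f x < f y" if xy: "le x y" "x \<noteq> y" for x y
  proof -
    have X: "x \<in> X" "y \<in> X" "x \<in> A p y" using xy leD by blast+
    have sub: "A p x \<subseteq> A p y" using A_sub1[OF p X(2,3)] .
    have mono: "s n x \<le> s n y" for n unfolding s_def
      using sub bdd A_ends[OF p X(1)] by (intro cSUP_subset_mono) auto
    have "y \<notin> A p x" using xy le_antisym X unfolding le_def by blast
    then have "infdist y (A p x) > 0"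
      using infdist_pos_not_in_closed[OF A_closed[OF p X(1)]] A_ends[OF p X(1)] by blast
    then obtain eps where eps: "eps > 0" "eps = infdist y (A p x)" by blast
    \<comment> \<open>The centre is within a quarter of \<open>eps\<close> of \<open>y\<close> and
      the radius \<open>q\<close> lies between a quarter and a half of \<open>eps\<close>, so the
      tent reaches \<open>y\<close>. Points of \<open>A p x\<close> are more than three quarters of
      \<open>eps\<close> away from the centre.\<close>
    obtain d where d: "d \<in> D" "dist y d < eps / 4" using D(2)[of "ball y (eps/4)"] eps(1) by auto
    obtain q where q: "q \<in> \<rat>" "eps / 4 < q" "q < eps / 2" using Rats_dense_in_real[of "eps/4" "eps/2"] eps(1) by auto
    have "(d, q) \<in> range e" unfolding e I_def using d q by auto
    then obtain n where n: "e n = (d, q)" by auto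
    have "g n z = 0" if "z \<in> A p x" for z
    proof -
      have "eps \<le> dist y z" using that eps(2) infdist_le by blast
      moreover have "dist y z \<le> dist y d + dist z d" using dist_triangle[of y z d] by (simp add: dist_commute)
      ultimately have "q \<le> dist z d" using d(2) q(3) eps(1) by linarith
      then show ?thesis unfolding g_def n by simp
    qed
    moreover have "A p x \<noteq> {}" using A_ends[OF p X(1)] by blast
    ultimately have "s n x = 0" unfolding s_def by (simp add: image_constant_conv)
    moreover have "0 < g n y" unfolding g_def n using d(2) q(2) by simp
    moreover have "g n y \<le> s n y" unfolding s_def using bdd A_ends[OF p X(2)] by (intro cSUP_upper) auto
    ultimately have "s n x < s n y" by linarith
    then have "0 < (\<Sum>n. (1/2)^n * s n y - (1/2)^n * s n x)"
      using mono by (intro suminf_pos2[of _ n] summable_diff summ X) (auto simp: mult_left_mono)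
    also have "\<dots> = f y - f x" unfolding f_def by (rule suminf_diff[symmetric]) (intro summ X)+
    finally show ?thesis by simp
  qed
  ultimately show ?thesis by blast
qed

end

section \<open>Levels, projections down to a level, and upper sets\<close>

locale height_dendroid = rooted_dendroid X p for X :: "'a::euclidean_space set" and p :: 'a +
  fixes f :: "'a \<Rightarrow> real"
  assumes cont_f: "continuous_on X f"
    and strict_f: "\<And>x y. le x y \<Longrightarrow> x \<noteq> y \<Longrightarrow> f x < f y"
begin

lemma mono_f: "le x y \<Longrightarrow> f x \<le> f y"
  using strict_f by (cases "x = y") (auto intro: less_imp_le)

lemma f_p: "x \<in> X \<Longrightarrow> f p \<le> f x"
  using mono_f p_le by blast

lemma f_lim: "(\<And>n. u n \<in> X) \<Longrightarrow> x \<in> X \<Longrightarrow> u \<longlonglongrightarrow> x \<Longrightarrow> (\<lambda>n. f (u n)) \<longlonglongrightarrow> f x"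
  using cont_f unfolding continuous_on_sequentially comp_def by blast

lemma le_eq_height: "le x z \<Longrightarrow> le y z \<Longrightarrow> f x = f y \<Longrightarrow> x = y"
  using le_linear strict_f by (metis less_irrefl)

lemma le_of_height: "le x z \<Longrightarrow> le y z \<Longrightarrow> f x \<le> f y \<Longrightarrow> le x y"
  using le_linear strict_f le_refl leD by (metis not_less)

text \<open>The projection down to level \<open>s\<close>. The description is proper when
  \<open>s\<close> lies between \<open>f p\<close> and \<open>f x\<close>; elsewhere the value
  carries no information.\<close>

definition r :: "real \<Rightarrow> 'a \<Rightarrow> 'a" where
  "r s x = (THE z. le z x \<and> f z = s)"

lemma r:
  assumes "x \<in> X" "f p \<le> s" "s \<le> f x"
  shows "le (r s x) x" "f (r s x) = s"
proof -
  have "connected (f ` A p x)"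
    by (intro connected_continuous_image continuous_on_subset[OF cont_f] A_connected A_subset p assms)
  moreover have "f p \<in> f ` A p x" "f x \<in> f ` A p x" using A_ends[OF p assms(1)] by auto
  ultimately have "{f p..f x} \<subseteq> f ` A p x" by (rule connected_contains_Icc)
  then have "s \<in> f ` A p x" using assms(2,3) by auto
  then obtain z where "le z x \<and> f z = s" unfolding le_def using assms(1) by blast
  then have "\<exists>!z. le z x \<and> f z = s" using le_eq_height by blast
  then have "le (r s x) x \<and> f (r s x) = s" unfolding r_def by (rule theI')
  then show "le (r s x) x" "f (r s x) = s" by blast+
qed

lemma r_in: "x \<in> X \<Longrightarrow> f p \<le> s \<Longrightarrow> s \<le> f x \<Longrightarrow> r s x \<in> X"
  using r(1) leD by blast

lemma r_eqI: "le z x \<Longrightarrow> f z = s \<Longrightarrow> r s x = z"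
  unfolding r_def by (rule the_equality) (auto intro: le_eq_height)

lemma r_mono:
  assumes "le x y" "f p \<le> s" "s \<le> f x"
  shows "r s y = r s x"
  using r[of x s] assms leD le_trans by (intro r_eqI) blast+

lemma r_self: "x \<in> X \<Longrightarrow> r (f x) x = x"
  by (rule r_eqI) (auto intro: le_refl)

text \<open>A subsequential limit lies below \<open>x\<close> because the order is closed, and it
  has height \<open>t\<close>; so compactness leaves one candidate. Joint continuity in height and
  point is what the contraction of \<open>X\<close> and the closeness of arcs require.\<close>

lemma r_cont:
  assumes "\<And>n. u n \<in> X" "x \<in> X" "u \<longlonglongrightarrow> x" "s \<longlonglongrightarrow> t" "\<And>n. f p \<le> s n" "\<And>n. s n \<le> f (u n)"
  shows "(\<lambda>n. r (s n) (u n)) \<longlonglongrightarrow> r t x"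
proof (rule compact_unique_limit[OF compact_X])
  show "r (s n) (u n) \<in> X" for n using r_in assms by blast
  fix q l assume q: "strict_mono (q :: nat \<Rightarrow> nat)" "((\<lambda>n. r (s n) (u n)) \<circ> q) \<longlonglongrightarrow> l" "l \<in> X"
  have uq: "(u \<circ> q) \<longlonglongrightarrow> x" "(s \<circ> q) \<longlonglongrightarrow> t" using assms q(1) LIMSEQ_subseq_LIMSEQ by blast+
  have "le l x"
    by (rule le_closed[OF _ q(2) uq(1)]) (use r assms in auto)
  moreover have "f l = t"
  proof -
    have "(\<lambda>n. f (((\<lambda>n. r (s n) (u n)) \<circ> q) n)) \<longlonglongrightarrow> f l"
      using f_lim[of "(\<lambda>n. r (s n) (u n)) \<circ> q", OF _ q(3,2)] r_in[OF assms(1,5,6)] by (simp add: comp_def)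
    moreover have "(\<lambda>n. f (((\<lambda>n. r (s n) (u n)) \<circ> q) n)) = s \<circ> q"
      using r(2) assms by (auto simp: fun_eq_iff)
    ultimately show ?thesis using uq(2) LIMSEQ_unique by metis
  qed
  ultimately show "l = r t x" using r_eqI by metis
qed

lemma r_continuous_on:
  assumes "f p \<le> s"
  shows "continuous_on {x \<in> X. s \<le> f x} (r s)"
  unfolding continuous_on_sequentially comp_def
  using r_cont[where s = "\<lambda>_. s" and t = s] assms by auto

lemma compact_ge: "compact {x \<in> X. s \<le> f x}"
proof -
  have "closedin (top_of_set X) (X \<inter> f -` {s..})"
    by (intro continuous_closedin_preimage cont_f) auto
  moreover have "X \<inter> f -` {s..} = {x \<in> X. s \<le> f x}" by auto
  ultimately show ?thesis using compact_X closedin_compact by metis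
qed

definition up :: "'a set \<Rightarrow> 'a set" where
  "up K = {y. \<exists>x\<in>K. le x y}"

lemma up_subset: "up K \<subseteq> X"
  unfolding up_def using leD by blast

lemma subset_up: "K \<subseteq> X \<Longrightarrow> K \<subseteq> up K"
  unfolding up_def using le_refl by blast

lemma up_closed: "x \<in> up K \<Longrightarrow> le x y \<Longrightarrow> y \<in> up K"
  unfolding up_def using le_trans by blast

text \<open>The order is closed: limits of points above points of \<open>K\<close> lie above a limit
  in \<open>K\<close>.\<close>

lemma compact_up:
  assumes "compact K"
  shows "compact (up K)"
  unfolding compact_def
proof (intro allI impI)
  fix u assume u: "\<forall>n :: nat. u n \<in> up K"
  then have uX: "\<And>n. u n \<in> X" using up_subset by blast
  obtain k where k: "\<And>n. k n \<in> K" "\<And>n. le (k n) (u n)" using u unfolding up_def by (simp, metis)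
  obtain x q where x: "x \<in> K" "strict_mono (q :: nat \<Rightarrow> nat)" "(k \<circ> q) \<longlonglongrightarrow> x"
    using assms k(1) unfolding compact_def by metis
  obtain y q' where y: "y \<in> X" "strict_mono (q' :: nat \<Rightarrow> nat)" "((u \<circ> q) \<circ> q') \<longlonglongrightarrow> y"
    using compact_X uX unfolding compact_def by (metis comp_apply)
  have "le x y"
    by (rule le_closed[OF _ LIMSEQ_subseq_LIMSEQ[OF x(3) y(2)] y(3)]) (use k in auto)
  then have "y \<in> up K" unfolding up_def using x(1) by blast
  moreover have "strict_mono (q \<circ> q')" using x(2) y(2) by (rule strict_mono_o)
  ultimately show "\<exists>l\<in>up K. \<exists>r. strict_mono r \<and> (u \<circ> r) \<longlonglongrightarrow> l"
    using y(3) by (metis comp_assoc)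
qed

lemma A_subset_up:
  assumes "le x y"
  shows "A x y \<subseteq> up {x}"
  using A_le_iff[OF assms] unfolding up_def by blast

lemma connected_up: "connected (up {x})"
proof (cases "x \<in> X")
  case True
  have "up {x} = (\<Union>y\<in>up {x}. A x y)"
  proof
    show "up {x} \<subseteq> (\<Union>y\<in>up {x}. A x y)" using A_ends[OF True] up_subset by blast
    show "(\<Union>y\<in>up {x}. A x y) \<subseteq> up {x}" using A_subset_up[of x] unfolding up_def[of "{x}"] by blast
  qed
  moreover have "connected (\<Union>y\<in>up {x}. A x y)"
  proof (rule connected_Union)
    show "\<And>S. S \<in> (A x) ` up {x} \<Longrightarrow> connected S" using A_connected[OF True] up_subset by blast
    show "\<Inter> ((A x) ` up {x}) \<noteq> {}" using A_ends[OF True] up_subset by blast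
  qed
  ultimately show ?thesis by simp
next
  case False
  then have "up {x} = {}" unfolding up_def using leD by blast
  then show ?thesis by simp
qed

text \<open>Every point slides down its arc to the root while its height decreases linearly from
  \<open>f x\<close> to \<open>f p\<close>.\<close>

lemma contractible_X: "contractible X"
proof -
  define s where "s z = f p + (1 - fst z) * (f (snd z) - f p)" for z :: "real \<times> 'a"
  define h where "h z = r (s z) (snd z)" for z
  have s: "f p \<le> s z" "s z \<le> f (snd z)" if "z \<in> {0..1} \<times> X" for z
  proof -
    have "0 \<le> f (snd z) - f p" using f_p that by (auto simp: mem_Times_iff)
    moreover have "0 \<le> 1 - fst z" "1 - fst z \<le> 1" using that by (auto simp: mem_Times_iff)
    ultimately have "0 \<le> (1 - fst z) * (f (snd z) - f p)" "(1 - fst z) * (f (snd z) - f p) \<le> f (snd z) - f p"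
      by (auto intro: mult_left_le_one_le)
    then show "f p \<le> s z" "s z \<le> f (snd z)" unfolding s_def by auto
  qed
  have "continuous_on ({0..1} \<times> X) h"
    unfolding continuous_on_sequentially
  proof (intro allI ballI impI)
    fix u :: "nat \<Rightarrow> real \<times> 'a" and z assume u: "z \<in> {0..1} \<times> X" "(\<forall>n. u n \<in> {0..1} \<times> X) \<and> u \<longlonglongrightarrow> z"
    have X: "\<And>n. snd (u n) \<in> X" "snd z \<in> X" using u by (auto simp: mem_Times_iff)
    have lim: "(\<lambda>n. snd (u n)) \<longlonglongrightarrow> snd z" "(\<lambda>n. fst (u n)) \<longlonglongrightarrow> fst z"
      using u by (auto intro: tendsto_snd tendsto_fst)
    have "(\<lambda>n. s (u n)) \<longlonglongrightarrow> s z"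
      unfolding s_def by (intro tendsto_intros lim f_lim X)
    then have "(\<lambda>n. r (s (u n)) (snd (u n))) \<longlonglongrightarrow> r (s z) (snd z)"
      by (intro r_cont X lim) (use s u in auto)
    then show "(h \<circ> u) \<longlonglongrightarrow> h z" unfolding h_def comp_def .
  qed
  moreover have "h ` ({0..1} \<times> X) \<subseteq> X" unfolding h_def using r_in s by (force simp: mem_Times_iff)
  moreover have "h (0, x) = x" if "x \<in> X" for x unfolding h_def s_def using r_self[OF that] by simp
  moreover have "h (1, x) = p" if "x \<in> X" for x unfolding h_def s_def using r_eqI[OF p_le[OF that]] by simp
  ultimately have "homotopic_with_canon (\<lambda>x. True) X X id (\<lambda>x. p)"
    by (subst homotopic_with) (auto intro!: exI[of _ h])
  then show ?thesis unfolding contractible_def by blast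
qed

text \<open>The points of height \<open>s\<close> from which \<open>X\<close> continues up to height
  \<open>t\<close>. For \<open>s < t\<close> the arcs from these points up to the level
  \<open>t\<close> are nondegenerate.\<close>

definition N :: "real \<Rightarrow> real \<Rightarrow> 'a set" where
  "N s t = r s ` {x \<in> X. t \<le> f x}"

lemma compact_N:
  assumes "f p \<le> s" "s \<le> t"
  shows "compact (N s t)"
  unfolding N_def
  by (intro compact_continuous_image continuous_on_subset[OF r_continuous_on[OF assms(1)]] compact_ge) (use assms in auto)


text \<open>Borsuk's criterion: a compact set does not separate the space if all its maps to the
  unit sphere are nullhomotopic, and this holds for contractible sets.\<close>

lemma connected_Compl_X:
  assumes "2 \<le> DIM('a)"
  shows "connected (- X)"
  unfolding Borsuk_separation_theorem[OF compact_X assms]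
  using nullhomotopic_from_contractible[OF _ _ contractible_X] by (metis Pi_iff image_subset_iff)

end

text \<open>A ball inside \<open>X\<close> would contain two different arcs between \<open>x\<close>
  and \<open>y\<close>: the segment through the centre \<open>m\<close> and an arc around
  \<open>m\<close>.\<close>

lemma (in dendroid_space) interior_empty:
  assumes "2 \<le> DIM('a)"
  shows "interior X = {}"
proof (rule ccontr)
  assume "interior X \<noteq> {}"
  then obtain m e where m: "e > 0" "ball m e \<subseteq> X" by (metis all_not_in_conv mem_interior)
  obtain b :: 'a where b: "b \<in> Basis" using nonempty_Basis by blast
  define x where "x = m + (e/2) *\<^sub>R b"
  define y where "y = m - (e/2) *\<^sub>R b"
  have "x - y = e *\<^sub>R b" unfolding x_def y_def by (simp add: scaleR_add_left[symmetric])
  moreover have "e *\<^sub>R b \<noteq> 0" using m(1) b nonzero_Basis by simp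
  ultimately have "x \<noteq> y" by auto
  then have xy: "x \<in> ball m e" "y \<in> ball m e" "x \<noteq> m" "y \<noteq> m" "x \<noteq> y"
    using m(1) b unfolding x_def y_def by (auto simp: dist_norm nonzero_Basis)
  have mid: "m \<in> closed_segment x y"
    using midpoint_in_closed_segment[of x y] unfolding midpoint_def x_def y_def
    by (simp add: scaleR_2[symmetric])
  have "closed_segment x y \<subseteq> X" using xy m(2) by (meson closed_segment_subset convex_ball order_trans)
  then have "A x y = closed_segment x y" using A_eqI[OF arc_from_to_segment[OF xy(5)]] by blast
  moreover have "path_connected (ball m e - {m})"
    using assms by (rule path_connected_punctured_ball)
  then obtain B where B: "arc_from_to B x y" "B \<subseteq> ball m e - {m}"
    using path_connected_imp_arc_from_to[of "ball m e - {m}" x y] xy by auto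
  then have "A x y = B" using A_eqI m(2) by blast
  ultimately show False using mid B by auto
qed

subsection \<open>Plane dendroids\<close>

lemma closed_segment_dist:
  fixes k :: "'a::euclidean_space"
  assumes "y \<in> closed_segment k x" "y \<noteq> x"
  shows "dist k y < dist k x"
proof -
  obtain u where u: "0 \<le> u" "u \<le> 1" "y = (1 - u) *\<^sub>R k + u *\<^sub>R x"
    using assms(1) unfolding closed_segment_def by blast
  have "u \<noteq> 1" using assms(2) u(3) by auto
  moreover have "k \<noteq> x" using assms by auto
  moreover have "dist k y = u * dist k x"
  proof -
    have "k - y = u *\<^sub>R (k - x)" unfolding u(3) by (simp add: algebra_simps)
    then show ?thesis unfolding dist_norm using u(1) by simp
  qed
  ultimately show ?thesis using u by auto
qed

lemma closed_segment_minus_end: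
  fixes k :: "'a::euclidean_space"
  assumes "y \<in> closed_segment k x" "y \<noteq> x"
  shows "closed_segment k y \<subseteq> closed_segment k x" "x \<notin> closed_segment k y"
proof -
  show "closed_segment k y \<subseteq> closed_segment k x"
    using assms(1) by (simp add: subset_closed_segment)
  show "x \<notin> closed_segment k y"
  proof
    assume x: "x \<in> closed_segment k y"
    have "dist k y < dist k x" by (rule closed_segment_dist[OF assms])
    moreover have "dist k x \<le> dist k y" using closed_segment_dist[OF x] by (cases "x = y") auto
    ultimately show False by simp
  qed
qed

text \<open>Another point of \<open>X\<close> on the segment would be closer to \<open>k\<close>.
  Points off \<open>X\<close> are connected to \<open>X\<close> in this way whenever an accessible
  point is wanted.\<close>

lemma nearest_point:
  fixes X :: "'a::euclidean_space set"
  assumes "closed X" "X \<noteq> {}"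
  obtains x where "x \<in> X" "dist k x = infdist k X" "closed_segment k x \<inter> X = {x}"
proof -
  obtain x where x: "x \<in> X" "infdist k X = dist k x"
    using infdist_attains_inf[OF assms] by blast
  have "y = x" if "y \<in> closed_segment k x" "y \<in> X" for y
    using closed_segment_dist[OF that(1)] infdist_le[OF that(2), of k] x(2) by auto
  then show thesis using that x by auto
qed

lemma Int_singleton_subset:
  assumes "S \<inter> X = {x}"
  shows "T \<subseteq> S \<Longrightarrow> x \<notin> T \<Longrightarrow> T \<inter> X = {}" "Y \<subseteq> X \<Longrightarrow> x \<notin> Y \<Longrightarrow> S \<inter> Y = {}"
proof -
  have "y = x" if "y \<in> S" "y \<in> X" for y using assms that by (metis IntI singletonD)
  then show "T \<subseteq> S \<Longrightarrow> x \<notin> T \<Longrightarrow> T \<inter> X = {}" "Y \<subseteq> X \<Longrightarrow> x \<notin> Y \<Longrightarrow> S \<inter> Y = {}"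
    by (metis disjoint_iff subsetD)+
qed

lemma arc_interior_subcontinuum:
  fixes G :: "'a::real_normed_vector set"
  assumes "arc_from_to G a b" "g \<in> G - {a, b}" "h \<in> G - {a, b}"
  obtains Q where "compact Q" "connected Q" "Q \<subseteq> G - {a, b}" "g \<in> Q" "h \<in> Q"
proof -
  obtain q where q: "arc q" "path_image q = G" "pathstart q = a" "pathfinish q = b"
    using assms(1) unfolding arc_from_to_def by blast
  have inj: "inj_on q {0..1}" and cq: "continuous_on {0..1} q" using q(1) unfolding arc_def path_def by blast+
  obtain s t where st: "s \<in> {0..1}" "q s = g" "t \<in> {0..1}" "q t = h"
    using assms(2,3) q(2) unfolding path_image_def by blast
  have "s \<noteq> 0" "s \<noteq> 1" "t \<noteq> 0" "t \<noteq> 1"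
    using st assms(2,3) q(3,4) unfolding pathstart_def pathfinish_def by auto
  then have "s \<in> {0<..<1}" "t \<in> {0<..<1}" using st by (auto simp: less_le)
  then have sub: "closed_segment s t \<subseteq> {0<..<1}"
    by (simp add: closed_segment_subset)
  then have sub': "closed_segment s t \<subseteq> {0..1}" by (rule order_trans) auto
  show thesis
  proof (rule that[of "q ` closed_segment s t"])
    show "compact (q ` closed_segment s t)" "connected (q ` closed_segment s t)"
      using continuous_on_subset[OF cq sub'] by (auto intro: compact_continuous_image connected_continuous_image)
    have "q w \<noteq> a \<and> q w \<noteq> b" if "w \<in> {0<..<1}" for w
      using inj that q(3,4) unfolding pathstart_def pathfinish_def inj_on_def by force
    then show "q ` closed_segment s t \<subseteq> G - {a, b}"
      using sub sub' q(2) unfolding path_image_def by blast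
    show "g \<in> q ` closed_segment s t" "h \<in> q ` closed_segment s t" using st by auto
  qed
qed

lemma component_closed_union:
  fixes C :: "'a::real_normed_vector set"
  assumes "closed C" "W \<in> components (- C)"
  shows "closed (W \<union> C)" "open W"
proof -
  show o: "open W" using assms open_components by blast
  have "closedin (top_of_set (- C)) W" using assms(2) by (rule closedin_component)
  then obtain T where T: "closed T" "W = - C \<inter> T" using closedin_closed by metis
  then have "W \<union> C = T \<union> C" by auto
  then show "closed (W \<union> C)" using T(1) assms(1) by auto
qed

lemma (in dendroid_space) A_concat:
  assumes "x \<in> X" "y \<in> X" "z \<in> X" "A x z \<inter> A z y = {z}"
  shows "A x y = A x z \<union> A z y"
proof (cases "x = z \<or> z = y")
  case True
  then show ?thesis using A_ends assms by auto
next
  case False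
  then have "arc_from_to (A x z) x z" "arc_from_to (A z y) z y"
    using the_arc_arc[OF dend] assms by blast+
  then have "arc_from_to (A x z \<union> A z y) x y" using arc_from_to_join assms(4) by blast
  then show ?thesis using A_eqI A_subset assms by blast
qed

lemma (in dendroid_space) A_between:
  assumes "x \<in> X" "y \<in> X" "z \<in> A x y" "s \<in> A x z" "t \<in> A z y"
  shows "z \<in> A s t"
proof -
  have zX: "z \<in> X" using A_in[OF assms(1,2,3)] .
  have sX: "s \<in> X" using A_in[OF assms(1) zX assms(4)] .
  have tX: "t \<in> X" using A_in[OF zX assms(2,5)] .
  have "A s z \<subseteq> A x z" using A_sub2[OF assms(1) zX assms(4)] .
  moreover have "A z t \<subseteq> A z y" using A_sub1[OF zX assms(2,5)] .
  moreover have "A x z \<inter> A z y = {z}" by (rule A_sub(2)[OF assms(1,2,3)])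
  ultimately have "A s z \<inter> A z t = {z}" using A_ends[OF sX zX] A_ends[OF zX tX] by blast
  then have "A s t = A s z \<union> A z t" using A_concat[OF sX tX zX] by blast
  then show ?thesis using A_ends[OF sX zX] by blast
qed

locale planar_dendroid = height_dendroid X p f for X :: "(real ^ 2) set" and p f +
  assumes hdE: "hereditarily_disconnected (endpoints X)"
begin

text \<open>The root may be an endpoint although it is minimal for \<open>le\<close>; all other
  endpoints are maximal, which is \<open>E_maximal\<close>. The root is put back by
  \<open>zero_dim_insert\<close>.\<close>

definition E where "E = endpoints X - {p}"

lemma E_subset: "E \<subseteq> X" unfolding E_def endpoints_def by blast

lemma p_notin_E: "p \<notin> E" unfolding E_def by blast

lemma E_A:
  assumes "x \<in> X" "y \<in> X" "z \<in> A x y" "z \<in> E"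
  shows "z = x \<or> z = y"
  using interior_not_endpoint[OF assms(1,2,3)] assms(4) unfolding E_def by blast

lemma E_maximal: "x \<in> E \<Longrightarrow> le x y \<Longrightarrow> y = x"
  using less_not_endpoint unfolding E_def by blast

lemma E_not_connected:
  assumes "M \<subseteq> E" "x \<in> M" "y \<in> M" "x \<noteq> y"
  shows "\<not> connected M"
  using assms hdE unfolding hereditarily_disconnected_def E_def by blast

lemma connected_Compl: "connected (- X)"
  by (rule connected_Compl_X) simp

lemma open_Compl_X: "open (- X)" using closed_X by blast

lemma near_Compl:
  assumes "x \<in> X" "e > 0"
  obtains a where "a \<notin> X" "dist a x < e"
proof -
  have "\<not> ball x e \<subseteq> X"
  proof
    assume "ball x e \<subseteq> X"
    then have "ball x e \<subseteq> interior X" by (simp add: interior_maximal)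
    moreover have "interior X = {}" by (rule interior_empty) simp
    ultimately show False using assms(2) by auto
  qed
  then show thesis using that by (metis dist_commute mem_ball subsetI)
qed

lemma path_in_Compl:
  assumes "a \<notin> X" "b \<notin> X" "a \<noteq> b"
  obtains B where "arc_from_to B a b" "B \<inter> X = {}"
proof -
  have "path_connected (- X)" using connected_open_path_connected[OF open_Compl_X connected_Compl] .
  then show thesis
    using path_connected_imp_arc_from_to[of "- X" a b] assms that by (metis Compl_iff disjoint_eq_subset_Compl)
qed

text \<open>The form in which hereditary disconnectedness is applied. It gives no control over the
  part to which \<open>y\<close> belongs, and this is what complicates the next lemma.\<close>

lemma separated_parts:
  assumes "M \<subseteq> E" "x \<in> M" "y \<in> M" "x \<noteq> y"
  obtains P Q where "P \<union> Q = M" "x \<in> P" "Q \<noteq> {}" "P \<inter> closure Q = {}" "Q \<inter> closure P = {}"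
proof -
  obtain A B where AB: "open A" "open B" "M \<subseteq> A \<union> B" "A \<inter> B \<inter> M = {}" "A \<inter> M \<noteq> {}" "B \<inter> M \<noteq> {}"
    using E_not_connected[OF assms] unfolding connected_def by blast
  note result = that
  have *: thesis if AB: "open A" "open B" "M \<subseteq> A \<union> B" "A \<inter> B \<inter> M = {}" "B \<inter> M \<noteq> {}" and "x \<in> A" for A B
  proof (rule result[of "A \<inter> M" "B \<inter> M"])
    show "(A \<inter> M) \<inter> closure (B \<inter> M) = {}"
      using closure_disjoint_open[OF AB(1), of "B \<inter> M"] AB(4) by blast
    show "(B \<inter> M) \<inter> closure (A \<inter> M) = {}"
      using closure_disjoint_open[OF AB(2), of "A \<inter> M"] AB(4) by blast
  qed (use AB \<open>x \<in> A\<close> assms in blast)+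
  have "x \<in> A \<or> x \<in> B" using AB assms by blast
  then show thesis using *[of A B] *[of B A] AB by (metis Int_commute Un_commute)
qed

text \<open>The frontier of the points closer to one part of a separation than to the other
  avoids the separated set, and by unicoherence one of its components crosses the region.\<close>

lemma crossing_continuum:
  assumes C: "C = Z \<union> closed_segment k1 x1 \<union> closed_segment k2 x2 \<union> A x1 x2"
    and Z: "compact Z" "connected Z" "Z \<inter> X = {}" "k1 \<in> Z" "k2 \<in> Z"
    and x: "x1 \<in> E" "x2 \<in> E" "x1 \<noteq> x2" "closed_segment k1 x1 \<inter> X = {x1}" "closed_segment k2 x2 \<inter> X = {x2}"
    and W: "W \<in> components (- C)"
  obtains K where "compact K" "connected K" "K \<inter> W = {}" "K \<inter> E = {}" "K \<inter> X \<noteq> {}" "K \<inter> Z \<noteq> {}"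
proof (rule ccontr)
  note result = that
  assume no: "\<not> thesis"
  have X12: "x1 \<in> X" "x2 \<in> X" using x E_subset by auto
  have Aprop: "compact (A x1 x2)" "connected (A x1 x2)" "A x1 x2 \<subseteq> X" "x1 \<in> A x1 x2" "x2 \<in> A x1 x2"
    using A_compact A_connected A_subset A_ends X12 by blast+
  have compC: "compact C" unfolding C using Z(1) Aprop(1) by (intro compact_Un) auto
  then have clC: "closed C" by (rule compact_imp_closed)
  have WC: "W \<inter> C = {}" using W in_components_subset by blast
  have conW: "connected W" using W in_components_connected by blast
  define D where "D = - W"
  have D: "closed D" "connected (- D)" "C \<subseteq> D"
    unfolding D_def using component_closed_union(2)[OF clC W] conW WC by auto
  define V where "V = - (W \<union> C)"
  have V: "open V" "V \<inter> W = {}" "V \<subseteq> D" "D = V \<union> C"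
    using open_Compl[OF component_closed_union(1)[OF clC W]] WC unfolding V_def D_def by auto
  have cover: "- C = V \<union> W" unfolding V_def using WC by auto
  have CX: "C \<inter> X = A x1 x2"
  proof -
    have "C \<inter> X = (Z \<inter> X) \<union> (closed_segment k1 x1 \<inter> X) \<union> (closed_segment k2 x2 \<inter> X) \<union> (A x1 x2 \<inter> X)"
      unfolding C by (simp only: Int_Un_distrib2)
    also have "\<dots> = {x1} \<union> {x2} \<union> A x1 x2" unfolding Z(3) x(4,5) using Aprop(3) by auto
    finally show ?thesis using Aprop(4,5) by auto
  qed
  have CE: "C \<inter> E = {x1, x2}" using CX E_A[OF X12] E_subset x(1,2) Aprop(4,5) by blast
  have inV: "B - {c} \<subseteq> V" if "arc_from_to B a c" "B \<inter> C = {c}" "a \<in> V" for B a c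
  proof -
    have "B - {c} \<subseteq> V \<union> W" using that(2) cover by blast
    moreover have "open W" using component_closed_union(2)[OF clC W] .
    ultimately have "B - {c} \<subseteq> V \<or> B - {c} \<subseteq> W"
      using connected_in_one_side[OF connected_arc_minus_end[OF that(1)] _ V(1)] V(2) by blast
    moreover have "a \<in> B - {c}" using arc_from_to_ends[OF that(1)] by blast
    ultimately show ?thesis using V(2) that(3) by blast
  qed
  \<comment> \<open>An arc off \<open>X\<close> from \<open>a\<close> towards \<open>k1\<close> is
    followed to its first point on \<open>C\<close>. That point is on \<open>Z\<close> or on one of
    the segments, since the rest of \<open>C\<close> lies in \<open>X\<close>; from a segment one
    continues along it to \<open>Z\<close>.\<close>
  have to_Z: "\<exists>K. compact K \<and> connected K \<and> K \<subseteq> D \<and> K \<inter> X = {} \<and> K \<inter> Z \<noteq> {} \<and> a \<in> K"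
    if a: "a \<in> V" "a \<notin> X" for a
  proof -
    have k1X: "k1 \<notin> X" using Z by blast
    have aC: "a \<notin> C" using a(1) cover by blast
    then have "a \<noteq> k1" unfolding C by auto
    then obtain B where B: "arc_from_to B a k1" "B \<inter> X = {}" using path_in_Compl[OF a(2) k1X] by metis
    have "k1 \<in> B \<inter> C" using arc_from_to_ends[OF B(1)] unfolding C by auto
    then obtain c B' where c: "c \<in> C" "c \<in> B" "arc_from_to B' a c" "B' \<subseteq> B" "B' \<inter> C = {c}"
      using arc_first_hit[OF B(1) clC _ aC] by (metis empty_iff)
    have B'D: "B' \<subseteq> D" using inV[OF c(3,5) a(1)] V(3) c(1) D(3) by blast
    have B'c: "compact B'" "connected B'" "a \<in> B'" "c \<in> B'"
      using arc_from_to_compact[OF c(3)] arc_from_to_connected[OF c(3)] arc_from_to_ends[OF c(3)] by auto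
    have B'X: "B' \<inter> X = {}" using c(4) B(2) by blast
    have cX: "c \<notin> X" using c(2) B(2) by blast
    have seg: ?thesis if s: "k \<in> Z" "closed_segment k x \<inter> X = {x}" "c \<in> closed_segment k x" "closed_segment k x \<subseteq> C" for k x
    proof -
      have "c \<noteq> x" using s(2) cX by blast
      note sub = closed_segment_minus_end[OF s(3) this]
      have "connected (B' \<union> closed_segment k c)" using B'c by (intro connected_Un) auto
      moreover have "compact (B' \<union> closed_segment k c)" using B'c by auto
      moreover have "closed_segment k c \<inter> X = {}" by (rule Int_singleton_subset(1)[OF s(2) sub])
      moreover have "closed_segment k c \<subseteq> D" using sub(1) s(4) D(3) by blast
      moreover have "k \<in> closed_segment k c" by simp
      ultimately show ?thesis using B'X B'D s(1) B'c(3)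
        by (intro exI[of _ "B' \<union> closed_segment k c"]) blast
    qed
    have "c \<notin> A x1 x2" using cX Aprop(3) by blast
    then consider "c \<in> Z" | "c \<in> closed_segment k1 x1" | "c \<in> closed_segment k2 x2" using c(1) unfolding C by blast
    then show ?thesis
    proof cases
      case 1
      then show ?thesis using B'c B'X B'D by blast
    next
      case 2
      then show ?thesis using seg[OF Z(4) x(4)] unfolding C by blast
    next
      case 3
      then show ?thesis using seg[OF Z(5) x(5)] unfolding C by blast
    qed
  qed
  define M where "M = E \<inter> D"
  have xM: "x1 \<in> M" "x2 \<in> M" unfolding M_def using x(1,2) D(3) CX Aprop by blast+
  have ME: "M \<subseteq> E" unfolding M_def by simp
  obtain P Q where PQ: "P \<union> Q = M" "x1 \<in> P" "Q \<noteq> {}" "P \<inter> closure Q = {}" "Q \<inter> closure P = {}"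
    using separated_parts[OF ME xM x(3)] by metis
  have PQdis: "P \<inter> Q = {}" using PQ(4) closure_subset by blast
  \<comment> \<open>\<open>Q\<close> may miss \<open>x2\<close>, so a point of \<open>Q\<close>
    accessible from \<open>Z\<close> inside \<open>D\<close> is needed. Near any \<open>y\<close> in
    \<open>Q\<close>, the point \<open>x'\<close> of \<open>X\<close> nearest to a suitable point
    off \<open>X\<close> will do: were it not in \<open>E\<close>, the access route would itself be
    the continuum sought.\<close>
  have "\<exists>x' l L. x' \<in> Q \<and> closed_segment l x' \<inter> X = {x'} \<and> closed_segment l x' \<subseteq> D \<and>
      compact L \<and> connected L \<and> L \<subseteq> D \<and> L \<inter> X = {} \<and> l \<in> L \<and> L \<inter> Z \<noteq> {}"
  proof (cases "x2 \<in> Q")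
    case True
    have "closed_segment k2 x2 \<subseteq> D" "k2 \<in> D" using D(3) Z(5) unfolding C by auto
    moreover have "{k2} \<inter> X = {}" "{k2} \<inter> Z \<noteq> {}" using Z by auto
    ultimately show ?thesis using True x(5) by (intro exI[of _ x2] exI[of _ k2] exI[of _ "{k2}"] conjI) simp_all
  next
    case False
    obtain y where y: "y \<in> Q" using PQ(3) by blast
    have yE: "y \<in> E" "y \<in> D" using y PQ(1) unfolding M_def by auto
    have "y \<noteq> x1" "y \<noteq> x2" using y False PQ(2) PQdis by auto
    then have "y \<in> V" using CE yE V(4) by blast
    then obtain e1 where e1: "e1 > 0" "ball y e1 \<subseteq> V" using V(1) open_contains_ball by blast
    have "open (- closure P)" "y \<in> - closure P" using PQ(5) y by auto
    then obtain e2 where e2: "e2 > 0" "ball y e2 \<subseteq> - closure P" by (meson open_contains_ball)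
    define e where "e = min e1 e2 / 2"
    have e: "e > 0" "ball y (2 * e) \<subseteq> V" "ball y (2 * e) \<inter> P = {}"
      using e1 e2 closure_subset[of P] unfolding e_def by (auto simp: subset_eq)
    have yX: "y \<in> X" using yE E_subset by blast
    obtain a where a: "a \<notin> X" "dist a y < e" using near_Compl[OF yX e(1)] by metis
    obtain x' where x': "x' \<in> X" "dist a x' = infdist a X" "closed_segment a x' \<inter> X = {x'}"
      using nearest_point[OF closed_X, of a] yX by (metis empty_iff)
    have "dist a x' \<le> dist a y" unfolding x'(2) by (rule infdist_le[OF yX])
    then have "dist y x' < 2 * e" using a(2) dist_triangle[of y x' a] dist_commute[of y a] by linarith
    then have ball: "x' \<in> ball y (2 * e)" "a \<in> ball y (2 * e)" using a(2) e(1) by (auto simp: dist_commute)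
    then have seg: "closed_segment a x' \<subseteq> ball y (2 * e)" by (intro closed_segment_subset) auto
    then have segD: "closed_segment a x' \<subseteq> D" using e(2) V(3) by blast
    have aV: "a \<in> V" using ball e(2) by blast
    obtain L where L: "compact L" "connected L" "L \<subseteq> D" "L \<inter> X = {}" "L \<inter> Z \<noteq> {}" "a \<in> L"
      using to_Z[OF aV a(1)] by metis
    have "x' \<in> E"
    proof (rule ccontr)
      assume nE: "x' \<notin> E"
      have "connected (L \<union> closed_segment a x')" using L(2,6) by (intro connected_Un) auto
      moreover have "compact (L \<union> closed_segment a x')" using L(1) by auto
      moreover have "(L \<union> closed_segment a x') \<inter> W = {}" using L(3) segD unfolding D_def by blast
      moreover have "(L \<union> closed_segment a x') \<inter> E = {}"
        using L(4) Int_singleton_subset(2)[OF x'(3) E_subset nE] E_subset by blast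
      moreover have "(L \<union> closed_segment a x') \<inter> X \<noteq> {}" using x' by auto
      moreover have "(L \<union> closed_segment a x') \<inter> Z \<noteq> {}" using L(5) by blast
      ultimately show False using no result[of "L \<union> closed_segment a x'"] by blast
    qed
    then have "x' \<in> M" unfolding M_def using segD by auto
    then have "x' \<in> Q" using PQ(1) e(3) ball by blast
    then show ?thesis using x'(3) segD L
      by (intro exI[of _ x'] exI[of _ a] exI[of _ L] conjI) simp_all
  qed
  then obtain x' l L where x'Q: "x' \<in> Q" and l: "closed_segment l x' \<inter> X = {x'}" "closed_segment l x' \<subseteq> D"
    and L: "compact L" "connected L" "L \<subseteq> D" "L \<inter> X = {}" "l \<in> L" "L \<inter> Z \<noteq> {}"
    by blast
  have x': "x' \<in> E" "x' \<in> D" "x' \<in> X" using x'Q PQ(1) E_subset unfolding M_def by auto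
  define G where "G = Z \<union> closed_segment k1 x1 \<union> (L \<union> closed_segment l x')"
  have Gcon: "connected G"
  proof -
    have 1: "connected (Z \<union> closed_segment k1 x1)" using Z by (intro connected_Un) auto
    have 2: "connected (L \<union> closed_segment l x')" using L by (intro connected_Un) auto
    have 3: "(Z \<union> closed_segment k1 x1) \<inter> (L \<union> closed_segment l x') \<noteq> {}" using L(6) by blast
    show ?thesis unfolding G_def by (rule connected_Un[OF 1 2 3])
  qed
  have Gcl: "closed G" unfolding G_def using Z(1) L(1) compact_imp_closed by (intro closed_Un) auto
  have GD: "G \<subseteq> D" unfolding G_def using D(3) L(3) l(2) unfolding C by blast
  \<comment> \<open>To end in \<open>D\<close>, an excursion of this arc into \<open>W\<close> would
    have to return through \<open>A x1 x2\<close>; by convexity of arcs it would then lie on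
    \<open>A x1 x2\<close>, which is part of \<open>C\<close>.\<close>
  have YD: "A x1 x' \<subseteq> D"
  proof (rule ccontr)
    assume "\<not> A x1 x' \<subseteq> D"
    then obtain z where z: "z \<in> A x1 x'" "z \<in> W" unfolding D_def by blast
    have zX: "z \<in> X" using A_in[OF X12(1) x'(3) z(1)] .
    have "A z x' \<inter> C \<noteq> {}"
    proof
      assume "A z x' \<inter> C = {}"
      then have "A z x' \<subseteq> V \<union> W" using cover by blast
      then have "A z x' \<subseteq> V \<or> A z x' \<subseteq> W"
        using connected_in_one_side[OF A_connected[OF zX x'(3)] _ V(1) component_closed_union(2)[OF clC W] V(2)] by blast
      then show False using A_ends[OF zX x'(3)] z(2) x'(2) V(2) unfolding D_def by blast
    qed
    then obtain s where s: "s \<in> A z x'" "s \<in> C" by blast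
    then have s2: "s \<in> A x1 x2" using CX A_in[OF zX x'(3)] by blast
    have "z \<in> A x1 s"
      using A_between[OF X12(1) x'(3) z(1) _ s(1)] A_ends[OF X12(1) zX] by blast
    then have "z \<in> A x1 x2" using A_sub1[OF X12 s2] by blast
    then show False using z(2) WC CX by blast
  qed
  obtain R where R: "R > 0" "X \<subseteq> ball 0 R" using compact_X compact_imp_bounded bounded_subset_ballD by metis
  \<comment> \<open>The points closer to \<open>P\<close> than to \<open>Q\<close>, within a ball
    that contains \<open>X\<close> and makes the frontier compact. \<open>G\<close> and
    \<open>A x1 x'\<close> are two connections in \<open>D\<close> from \<open>x1\<close>, inside
    \<open>O1\<close>, to \<open>x'\<close>, outside its closure.\<close>
  define O1 where "O1 = {z. infdist z P < infdist z Q} \<inter> ball 0 R"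
  have "P \<noteq> {}" using PQ(2) by blast
  have "open O1" unfolding O1_def
    by (intro open_Int open_Collect_less continuous_intros) auto
  have "bounded O1" unfolding O1_def by (simp add: bounded_Int)
  have x1O: "x1 \<in> O1"
  proof -
    have "x1 \<notin> closure Q" using PQ(2,4) by blast
    then have "infdist x1 Q > 0" using PQ(3) in_closure_iff_infdist_zero infdist_nonneg by (metis less_le)
    then show ?thesis unfolding O1_def using PQ(2) R(2) X12(1) by auto
  qed
  have clO: "closure O1 \<subseteq> {z. infdist z P \<le> infdist z Q}"
    by (rule closure_minimal) (auto simp: O1_def intro!: closed_Collect_le continuous_intros)
  have "infdist x' P > 0" using PQ(5) x'Q \<open>P \<noteq> {}\<close> in_closure_iff_infdist_zero infdist_nonneg by (metis IntI empty_iff less_le)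
  then have x'O: "x' \<notin> closure O1" using clO x'Q by auto
  have Yc: "connected (A x1 x')" "closed (A x1 x')" "x1 \<in> A x1 x'" "x' \<in> A x1 x'"
    using A_connected A_closed A_ends X12(1) x'(3) by blast+
  have Gx: "x1 \<in> G" "x' \<in> G" unfolding G_def by auto
  obtain K where K: "compact K" "connected K" "K \<subseteq> frontier O1 \<inter> D" "K \<inter> A x1 x' \<noteq> {}" "K \<inter> G \<noteq> {}"
    using frontier_component_meets_both[OF D(1,2) \<open>bounded O1\<close> x1O x'O \<open>open O1\<close> Yc(1,2) YD Yc(3,4) Gcon Gcl GD Gx] by metis
  \<comment> \<open>On the frontier the distances to \<open>P\<close> and \<open>Q\<close> agree, so
    a point of \<open>E\<close> there would lie in the closure of both separated parts.\<close>
  have KE: "K \<inter> E = {}"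
  proof (rule ccontr)
    assume "K \<inter> E \<noteq> {}"
    then obtain z where z: "z \<in> K" "z \<in> E" by blast
    then have zM: "z \<in> M" "z \<in> frontier O1" "z \<in> ball 0 R" unfolding M_def using K(3) R(2) E_subset by auto
    have "z \<notin> O1" using zM(2) \<open>open O1\<close> by (simp add: frontier_def interior_open)
    then have "infdist z P \<ge> infdist z Q" using zM(3) unfolding O1_def by auto
    moreover have "infdist z P \<le> infdist z Q" using zM(2) clO by (auto simp: frontier_def)
    ultimately have eq: "infdist z P = infdist z Q" by simp
    have "z \<in> P \<or> z \<in> Q" using zM(1) PQ(1) by blast
    then have "infdist z P = 0" "infdist z Q = 0" using eq by auto
    then have "z \<in> closure P" "z \<in> closure Q" using \<open>P \<noteq> {}\<close> PQ(3) in_closure_iff_infdist_zero by metis+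
    then show False using \<open>z \<in> P \<or> z \<in> Q\<close> PQ(4,5) by blast
  qed
  have KX: "K \<inter> X \<noteq> {}" using K(4) A_subset[OF X12(1) x'(3)] by blast
  have KW: "K \<inter> W = {}" using K(3) unfolding D_def by blast
  have fin: False if T: "compact T" "connected T" "T \<subseteq> D" "T \<inter> X = {}" "T \<inter> Z \<noteq> {}" "T \<inter> K \<noteq> {}" for T
  proof -
    have "connected (K \<union> T)" using K(2) T(2,6) by (intro connected_Un) auto
    moreover have "compact (K \<union> T)" using K(1) T(1) by auto
    moreover have "(K \<union> T) \<inter> W = {}" using KW T(3) unfolding D_def by blast
    moreover have "(K \<union> T) \<inter> E = {}" using KE T(4) E_subset by blast
    ultimately show False using no result[of "K \<union> T"] KX T(5) by blast
  qed
  \<comment> \<open>If \<open>h\<close> is not already on \<open>Z\<close>, the continuum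
    \<open>K\<close> is prolonged along a segment, along \<open>L\<close>, or both, to
    \<open>Z\<close> without touching \<open>X\<close>.\<close>
  obtain h where h: "h \<in> K" "h \<in> G" using K(5) by blast
  have hx: "h \<noteq> x1" "h \<noteq> x'" using h(1) KE x(1) x'(1) by auto
  consider "h \<in> Z" | "h \<in> closed_segment k1 x1" | "h \<in> L" | "h \<in> closed_segment l x'" using h(2) unfolding G_def by blast
  then show False
  proof cases
    case 1
    then show False using no result[of K] K(1,2) KW KE KX h(1) by blast
  next
    case 2
    note sub = closed_segment_minus_end[OF 2 hx(1)]
    show False
    proof (rule fin[of "closed_segment k1 h"])
      show "closed_segment k1 h \<subseteq> D" using sub(1) D(3) unfolding C by blast
      show "closed_segment k1 h \<inter> X = {}" by (rule Int_singleton_subset(1)[OF x(4) sub])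
      show "closed_segment k1 h \<inter> Z \<noteq> {}" using Z(4) by auto
      show "closed_segment k1 h \<inter> K \<noteq> {}" using h(1) by auto
    qed auto
  next
    case 3
    then show False using fin[of L] L h(1) by blast
  next
    case 4
    note sub = closed_segment_minus_end[OF 4 hx(2)]
    show False
    proof (rule fin[of "L \<union> closed_segment l h"])
      show "compact (L \<union> closed_segment l h)" using L(1) by auto
      show "connected (L \<union> closed_segment l h)" using L(2,5) by (intro connected_Un) auto
      show "L \<union> closed_segment l h \<subseteq> D" using sub(1) l(2) L(3) by blast
      show "(L \<union> closed_segment l h) \<inter> X = {}" using Int_singleton_subset(1)[OF l(1) sub] L(4) by blast
      show "(L \<union> closed_segment l h) \<inter> Z \<noteq> {}" using L(6) by blast
      show "(L \<union> closed_segment l h) \<inter> K \<noteq> {}" using h(1) by auto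
    qed
  qed
qed

end

subsection \<open>Clopen partitions of the endpoint set\<close>

context planar_dendroid
begin

text \<open>A connected neighbourhood that is upward closed for \<open>le\<close>. Off
  \<open>X\<close> it is only the disc, which is convex; the straight segments of the frame below
  come from this.\<close>

definition thick :: "real ^ 2 \<Rightarrow> real \<Rightarrow> (real ^ 2) set" where
  "thick u \<rho> = cball u \<rho> \<union> up (X \<inter> cball u \<rho>)"

lemma compact_thick: "compact (thick u \<rho>)"
  unfolding thick_def using compact_X by (intro compact_Un compact_cball compact_up compact_Int)

lemma cball_subset_thick: "cball u \<rho> \<subseteq> thick u \<rho>"
  unfolding thick_def by blast

lemma thick_up: "x \<in> thick u \<rho> \<Longrightarrow> le x y \<Longrightarrow> y \<in> thick u \<rho>"
  unfolding thick_def up_def using leD le_trans by blast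

lemma thick_minus_X: "x \<in> thick u \<rho> \<Longrightarrow> x \<notin> X \<Longrightarrow> x \<in> cball u \<rho>"
  unfolding thick_def using up_subset by blast

lemma thick_mono: "\<rho> \<le> \<rho>' \<Longrightarrow> thick u \<rho> \<subseteq> thick u \<rho>'"
  unfolding thick_def up_def by (auto simp: mem_cball)

lemma connected_thick:
  assumes "\<rho> > 0"
  shows "connected (thick u \<rho>)"
proof -
  define F where "F = insert (cball u \<rho>) ((\<lambda>x. cball u \<rho> \<union> up {x}) ` (X \<inter> cball u \<rho>))"
  have eq: "thick u \<rho> = \<Union> F"
    unfolding thick_def up_def F_def by auto
  have "u \<in> \<Inter> F" unfolding F_def using assms by auto
  moreover have "connected S" if "S \<in> F" for S
  proof -
    have "connected (cball u \<rho> \<union> up {x})" if "x \<in> X \<inter> cball u \<rho>" for x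
      using that connected_up subset_up[of "{x}"] by (intro connected_Un) auto
    then show ?thesis using that unfolding F_def by auto
  qed
  ultimately show ?thesis unfolding eq by (intro connected_Union) auto
qed

text \<open>If every radius failed, points of \<open>K\<close> above points ever closer to
  \<open>c\<close> would accumulate at a point of \<open>K\<close>, and since \<open>le\<close> is
  closed it would lie above \<open>c\<close>.\<close>

lemma thick_avoids:
  assumes "compact K" "K \<inter> up {c} = {}" "c \<in> X"
  obtains \<rho> where "\<rho> > 0" "K \<inter> thick c \<rho> = {}"
proof (rule ccontr)
  note result = that
  assume no: "\<not> thesis"
  have "c \<notin> K" using assms(2,3) subset_up[of "{c}"] by auto
  moreover have "closed K" using assms(1) by (rule compact_imp_closed)
  ultimately obtain e where e: "e > 0" "cball c e \<inter> K = {}"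
    by (metis ComplI Int_Un_eq(1) disjoint_eq_subset_Compl open_Compl open_contains_cball)
  have ex: "\<exists>z x. z \<in> K \<and> x \<in> X \<and> dist c x \<le> \<rho> \<and> le x z" if "\<rho> > 0" for \<rho>
  proof -
    have "min \<rho> e > 0" using that e by simp
    then have "K \<inter> thick c (min \<rho> e) \<noteq> {}" using no result by blast
    then obtain z where z: "z \<in> K" "z \<in> thick c (min \<rho> e)" by blast
    have "z \<notin> cball c (min \<rho> e)" using e(2) z(1) by auto
    then obtain x where "x \<in> X" "x \<in> cball c (min \<rho> e)" "le x z" using z(2) unfolding thick_def up_def by blast
    then show ?thesis using z(1) by (intro exI[of _ z] exI[of _ x]) auto
  qed
  have "\<exists>z x. \<forall>n. z n \<in> K \<and> x n \<in> X \<and> dist c (x n) \<le> inverse (real (Suc n)) \<and> le (x n) (z n)"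
    using ex[of "inverse (real (Suc _))"] by (metis inverse_positive_iff_positive of_nat_0_less_iff zero_less_Suc)
  then obtain z x where zx: "\<And>n. z n \<in> K" "\<And>n. x n \<in> X" "\<And>n. dist c (x n) \<le> inverse (real (Suc n))" "\<And>n. le (x n) (z n)"
    by blast
  obtain l q where q: "l \<in> K" "strict_mono q" "(z \<circ> q) \<longlonglongrightarrow> l"
    using assms(1) zx(1) unfolding compact_def by metis
  have "x \<longlonglongrightarrow> c"
  proof (rule metric_LIMSEQ_I)
    fix r :: real assume "r > 0"
    then obtain N where N: "inverse (real (Suc N)) < r" using reals_Archimedean by blast
    have "dist (x n) c < r" if "n \<ge> N" for n
    proof -
      have "inverse (real (Suc n)) \<le> inverse (real (Suc N))" using that by (simp add: le_imp_inverse_le)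
      then show ?thesis using zx(3)[of n] N unfolding dist_commute[of "x n" c] by linarith
    qed
    then show "\<exists>N. \<forall>n\<ge>N. dist (x n) c < r" by blast
  qed
  then have "(x \<circ> q) \<longlonglongrightarrow> c" by (rule LIMSEQ_subseq_LIMSEQ[OF _ q(2)])
  then have "le c l" using le_closed[of "x \<circ> q" "z \<circ> q"] zx(4) q(3) by simp
  then show False using assms(2) q(1) unfolding up_def by blast
qed

lemma up_disjoint:
  assumes "\<not> le u n" "\<not> le n u"
  shows "up {u} \<inter> up {n} = {}"
  using assms le_linear unfolding up_def by blast

text \<open>The upper sets of \<open>u\<close> and \<open>n\<close> are disjoint because the points
  below a given point form a chain. They are thickened one after the other, each time away from a
  compact set that includes the root.\<close>

lemma disjoint_thick:
  assumes "u \<in> X" "n \<in> X" "\<not> le u n" "\<not> le n u"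
  obtains \<rho> where "\<rho> > 0" "thick u \<rho> \<inter> thick n \<rho> = {}" "p \<notin> thick u \<rho>" "p \<notin> thick n \<rho>"
proof -
  have up_p: "p \<notin> up {x}" if "x \<in> X" "x \<noteq> p" for x
    using that p_le le_antisym unfolding up_def by blast
  have np: "u \<noteq> p" "n \<noteq> p" using assms p_le by auto
  have "compact (insert p (up {n}))" by (simp add: compact_up)
  moreover have "insert p (up {n}) \<inter> up {u} = {}" using up_disjoint[OF assms(3,4)] up_p[OF assms(1) np(1)] by blast
  ultimately obtain r1 where r1: "r1 > 0" "insert p (up {n}) \<inter> thick u r1 = {}" using thick_avoids assms(1) by metis
  have "compact (insert p (thick u r1))" by (simp add: compact_thick)
  moreover have "insert p (thick u r1) \<inter> up {n} = {}" using r1(2) up_p[OF assms(2) np(2)] by blast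
  ultimately obtain r2 where r2: "r2 > 0" "insert p (thick u r1) \<inter> thick n r2 = {}" using thick_avoids assms(2) by metis
  have m: "thick u (min r1 r2) \<subseteq> thick u r1" "thick n (min r1 r2) \<subseteq> thick n r2" by (simp_all add: thick_mono)
  show thesis
  proof (rule that[of "min r1 r2"])
    show "min r1 r2 > 0" using r1 r2 by simp
    show "thick u (min r1 r2) \<inter> thick n (min r1 r2) = {}" using m r2(2) by blast
    show "p \<notin> thick u (min r1 r2)" using m r1(2) by blast
    show "p \<notin> thick n (min r1 r2)" using m r2(2) by blast
  qed
qed

text \<open>The first point of \<open>A p u\<close> in the thick set belongs to the disc itself:
  otherwise it would lie above a point of the disc that comes earlier on the same arc.\<close>

lemma first_point:
  assumes "u \<in> X" "\<rho> > 0" "p \<notin> thick u \<rho>"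
  obtains c where "c \<in> X" "c \<in> cball u \<rho>" "le c u" "\<And>z. z \<in> thick u \<rho> \<Longrightarrow> le z u \<Longrightarrow> le c z"
proof -
  have ut: "u \<in> thick u \<rho>" using assms cball_subset_thick[of u \<rho>] by auto
  then have "p \<noteq> u" using assms by auto
  then have arc: "arc_from_to (A p u) p u" using the_arc_arc[OF dend p assms(1)] by blast
  have "closed (thick u \<rho>)" using compact_thick compact_imp_closed by blast
  moreover have "A p u \<inter> thick u \<rho> \<noteq> {}" using ut A_ends[OF p assms(1)] by blast
  ultimately obtain c B where c: "c \<in> thick u \<rho>" "c \<in> A p u" "arc_from_to B p c" "B \<subseteq> A p u" "B \<inter> thick u \<rho> = {c}"
    using arc_first_hit[OF arc _ _ assms(3)] by metis
  have "B \<subseteq> X" using c(4) A_subset[OF p assms(1)] by blast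
  then have B: "A p c = B" using A_eqI c(3) by blast
  have le: "le c u" "c \<in> X" using c(2) assms(1) A_in[OF p assms(1)] unfolding le_def by auto
  have only: "z = c" if "z \<in> thick u \<rho>" "le z c" for z
    using that c(5) B unfolding le_def by (metis IntI singletonD)
  show thesis
  proof (rule that[OF le(2) _ le(1)])
    show "c \<in> cball u \<rho>"
    proof (rule ccontr)
      assume "c \<notin> cball u \<rho>"
      then obtain x where x: "x \<in> X" "x \<in> cball u \<rho>" "le x c" using c(1) unfolding thick_def up_def by blast
      then have "x = c" using only cball_subset_thick by blast
      then show False using x \<open>c \<notin> cball u \<rho>\<close> by blast
    qed
    show "le c z" if "z \<in> thick u \<rho>" "le z u" for z
      using le_linear[OF le(1) that(2)] only[OF that(1)] le_refl[OF le(2)] by blast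
  qed
qed

end

text \<open>\<open>U\<close> and \<open>V\<close> stand for disjoint thick neighbourhoods. The arc
  \<open>A u n\<close> of \<open>X\<close>, the arc \<open>G\<close> outside \<open>X\<close>, and
  two segments inside \<open>U\<close> and \<open>V\<close> form a Jordan curve with sides
  \<open>I\<close> and \<open>J\<close>. The arguments treat the closed side \<open>- J\<close>;
  \<open>swap\<close> transfers them to the other one.\<close>

locale dendroid_frame = planar_dendroid X p f for X :: "(real ^ 2) set" and p f +
  fixes U V :: "(real ^ 2) set" and u n a a' :: "real ^ 2" and G I J
  assumes U: "compact U" "connected U" "p \<notin> U" and U_up: "\<And>x y. x \<in> U \<Longrightarrow> le x y \<Longrightarrow> y \<in> U"
    and V: "compact V" "connected V" "p \<notin> V" and V_up: "\<And>x y. x \<in> V \<Longrightarrow> le x y \<Longrightarrow> y \<in> V"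
    and UV: "U \<inter> V = {}"
    and un: "u \<in> X" "n \<in> X" "A u n \<inter> U = {u}" "A u n \<inter> V = {n}"
    and G: "arc_from_to G a a'" "G \<inter> X = {}" "G \<inter> U = {a}" "G \<inter> V = {a'}"
    and segs: "closed_segment u a \<subseteq> U" "closed_segment n a' \<subseteq> V"
    and IJ: "open I" "connected I" "I \<noteq> {}" "open J" "connected J" "J \<noteq> {}" "I \<inter> J = {}"
      "I \<union> J = - (A u n \<union> closed_segment u a \<union> G \<union> closed_segment n a')"
      "frontier I = A u n \<union> closed_segment u a \<union> G \<union> closed_segment n a'"
      "frontier J = A u n \<union> closed_segment u a \<union> G \<union> closed_segment n a'"
begin

abbreviation C where "C \<equiv> A u n \<union> closed_segment u a \<union> G \<union> closed_segment n a'"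

lemma swap: "dendroid_frame X p f U V u n a a' G J I"
proof -
  have JI: "J \<inter> I = {}" "J \<union> I = - (A u n \<union> closed_segment u a \<union> G \<union> closed_segment n a')"
    using IJ(7,8) by auto
  show ?thesis by unfold_locales (fact U V UV un G segs IJ U_up V_up JI)+
qed

lemma frame_points: "u \<in> U" "n \<in> V" "a \<in> U" "a' \<in> V" "u \<notin> V" "n \<notin> U" "u \<noteq> n" "a \<notin> X" "a' \<notin> X" "a \<in> G" "a' \<in> G"
proof -
  have "x \<in> S \<and> x \<in> Y" if "S \<inter> Y = {x}" for S Y and x :: "real ^ 2" using that by blast
  note ps = this[OF un(3)] this[OF un(4)] this[OF G(3)] this[OF G(4)]
  show "u \<in> U" "n \<in> V" "a \<in> U" "a' \<in> V" "a \<in> G" "a' \<in> G" using ps by simp_all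
  then show "u \<notin> V" "n \<notin> U" "u \<noteq> n" "a \<notin> X" "a' \<notin> X" using UV G(2) by (metis disjoint_iff)+
qed

lemma compact_C: "compact C" and closed_C: "closed C"
proof -
  show "compact C" using A_compact[OF un(1,2)] arc_from_to_compact[OF G(1)] by (intro compact_Un) auto
  then show "closed C" by (rule compact_imp_closed)
qed

lemma S: "arc_from_to (A u n) u n" "A u n \<subseteq> X" "u \<in> A u n" "n \<in> A u n"
  using the_arc_arc[OF dend un(1,2) frame_points(7)] A_ends[OF un(1,2)] by auto

lemma side_eq: "- J = I \<union> C" "closed (- J)" "I \<inter> C = {}" "J \<inter> C = {}" "C \<subseteq> - J"
  using IJ by auto

lemma C_U: "U \<inter> C = closed_segment u a" and C_V: "V \<inter> C = closed_segment n a'"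
proof -
  have "U \<inter> closed_segment n a' = {}" using segs UV by blast
  moreover have "U \<inter> C = (A u n \<inter> U) \<union> (closed_segment u a \<inter> U) \<union> (G \<inter> U) \<union> (U \<inter> closed_segment n a')" by auto
  moreover have "closed_segment u a \<inter> U = closed_segment u a" using segs by blast
  ultimately show "U \<inter> C = closed_segment u a" using un(3) G(3) by auto
  have "V \<inter> closed_segment u a = {}" using segs UV by blast
  moreover have "V \<inter> C = (A u n \<inter> V) \<union> (closed_segment n a' \<inter> V) \<union> (G \<inter> V) \<union> (V \<inter> closed_segment u a)" by auto
  moreover have "closed_segment n a' \<inter> V = closed_segment n a'" using segs by blast
  ultimately show "V \<inter> C = closed_segment n a'" using un(4) G(4) by auto
qed

lemma C_X: "x \<in> C \<Longrightarrow> x \<in> X \<Longrightarrow> x \<notin> U \<Longrightarrow> x \<notin> V \<Longrightarrow> x \<in> A u n"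
  using segs G(2) by blast

text \<open>\<open>U\<close> and \<open>V\<close> are added whole: as continua that contain the two
  segments of the curve, they are the opposite ends in \<open>partition_of_crossing\<close>.\<close>

definition E' where "E' = E \<union> U \<union> V"

lemma E'_C: "E' \<inter> C \<subseteq> closed_segment u a \<union> closed_segment n a'"
proof
  fix x assume x: "x \<in> E' \<inter> C"
  show "x \<in> closed_segment u a \<union> closed_segment n a'"
  proof (cases "x \<in> U \<or> x \<in> V")
    case True
    then show ?thesis using x C_U C_V by blast
  next
    case False
    then have "x \<in> E" using x unfolding E'_def by blast
    then have "x \<in> A u n" using C_X False x E_subset by blast
    then have "x = u \<or> x = n" using E_A[OF un(1,2)] \<open>x \<in> E\<close> by blast
    then show ?thesis by auto
  qed
qed

text \<open>The part of \<open>X\<close> available to a crossing continuum; by \<open>T_down\<close>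
  the arc from any of its points to the root stays in it.\<close>

definition T where "T = X - E'"

lemma T_down:
  assumes "x \<in> T" "le z x"
  shows "z \<in> T"
proof -
  have "z \<notin> U" "z \<notin> V" using U_up V_up assms unfolding T_def E'_def by blast+
  moreover have "z \<notin> E" using E_maximal[OF _ assms(2)] assms(1) unfolding T_def E'_def by blast
  ultimately show ?thesis using leD[OF assms(2)] unfolding T_def E'_def by blast
qed

lemma A_p_T: "x \<in> T \<Longrightarrow> A p x \<subseteq> T"
  using T_down unfolding le_def T_def by blast

lemma first_in_side:
  assumes "x \<in> X" "x \<notin> J" "y \<in> X" "A x y \<inter> C \<noteq> {}"
  obtains c where "c \<in> C" "c \<in> A x y" "A x c \<subseteq> - J" "A x c \<inter> C = {c}"
proof (cases "x \<in> C")
  case True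
  then show thesis using that[of x] assms A_ends[of x y] by auto
next
  case False
  then have xI: "x \<in> I" using assms(2) side_eq by blast
  have "x \<noteq> y" using assms(4) False by auto
  then have arc: "arc_from_to (A x y) x y" "A x y \<subseteq> X" using the_arc_arc[OF dend] assms by blast+
  obtain c B where c: "c \<in> C" "c \<in> A x y" "arc_from_to B x c" "B \<subseteq> A x y" "B \<inter> C = {c}"
    using arc_first_hit[OF arc(1) closed_C assms(4) False] by metis
  have B: "A x c = B" using A_eqI[OF c(3)] c(4) arc(2) by blast
  have "B - {c} \<subseteq> I \<union> J" using c(5) IJ(8) by blast
  then have "B - {c} \<subseteq> I \<or> B - {c} \<subseteq> J"
    using connected_in_one_side[OF connected_arc_minus_end[OF c(3)] _ IJ(1,4,7)] by blast
  moreover have "x \<in> B - {c}" using arc_from_to_ends[OF c(3)] by blast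
  ultimately have "B - {c} \<subseteq> I" using xI IJ(7) by blast
  then have "B \<subseteq> - J" using side_eq c(1) IJ(7) by blast
  then show thesis using that[OF c(1,2)] c(5) B by blast
qed

text \<open>Otherwise \<open>u\<close> would lie on the arc from \<open>p\<close> to
  \<open>n\<close>, and \<open>n\<close> would belong to the upward closed set
  \<open>U\<close>.\<close>

lemma p_not_only_u: "A p u \<inter> A u n \<noteq> {u}"
proof
  assume "A p u \<inter> A u n = {u}"
  then have "A p n = A p u \<union> A u n" by (rule A_concat[OF p un(2,1)])
  then have "le u n" unfolding le_def using un(2) S by blast
  then show False using U_up frame_points by blast
qed

text \<open>From \<open>x\<close> one goes down to the root and stops at the first point of
  \<open>C\<close>, which has to be on \<open>A u n\<close>. If \<open>C\<close> is not met, the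
  root lies in \<open>I\<close> and the route continues up along \<open>A p u\<close>; it remains to
  see that it meets \<open>C\<close> before it enters \<open>U\<close>.\<close>

lemma descend:
  assumes "x \<in> T" "x \<notin> J"
  obtains s where "s \<in> A u n" "cjoin (T - J) x s"
proof -
  have xX: "x \<in> X" using assms unfolding T_def by blast
  have sub: "A p x \<subseteq> T" by (rule A_p_T[OF assms(1)])
  have TC: "c \<in> A u n" if "c \<in> T" "c \<in> C" for c
    using C_X that unfolding T_def E'_def by blast
  have join: "cjoin (T - J) y z" if "y \<in> X" "z \<in> X" "A y z \<subseteq> T" "A y z \<subseteq> - J" for y z
    using that A_ends[of y z] A_compact A_connected by (intro cjoinI[of "A y z"]) auto
  show thesis
  proof (cases "A p x \<inter> C = {}")
    case False
    then have ne: "A x p \<inter> C \<noteq> {}" using A_commute[OF xX p] by simp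
    obtain c where c: "c \<in> C" "c \<in> A x p" "A x c \<subseteq> - J"
      using first_in_side[OF xX assms(2) p ne] by metis
    have "c \<in> T" using c(2) sub A_commute[OF xX p] by blast
    moreover have "A x c \<subseteq> T" using A_sub1[OF xX p c(2)] sub A_commute[OF xX p] by blast
    moreover have "c \<in> X" using A_in[OF xX p c(2)] .
    ultimately show thesis using that[of c] TC c join[of x c] xX by blast
  next
    case True
    then have "A p x \<subseteq> I \<union> J" using IJ(8) by blast
    then have "A p x \<subseteq> I \<or> A p x \<subseteq> J" using connected_in_one_side[OF A_connected[OF p xX] _ IJ(1,4,7)] by blast
    then have AI: "A p x \<subseteq> I" using assms(2) A_ends[OF p xX] by blast
    then have pI: "p \<in> I" using A_ends[OF p xX] by blast
    then have pJ: "p \<notin> J" using IJ(7) by blast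
    have j1: "cjoin (T - J) x p"
      by (rule cjoin_sym, rule join[OF p xX sub]) (use AI IJ(7) in blast)
    have "A p u \<inter> C \<noteq> {}" using A_ends[OF p un(1)] S by blast
    then obtain c where c: "c \<in> C" "c \<in> A p u" "A p c \<subseteq> - J" "A p c \<inter> C = {c}"
      using first_in_side[OF p pJ un(1)] by metis
    have lecu: "le c u" "c \<in> X" using c(2) un(1) A_in[OF p un(1)] unfolding le_def by auto
    have "c \<noteq> u"
    proof
      assume "c = u"
      then have "A p u \<inter> A u n = {u}" using c(4) S(3) A_ends[OF p un(1)] by blast
      then show False using p_not_only_u by blast
    qed
    have "c \<notin> V" using V_up[OF _ lecu(1)] frame_points by blast
    have cU: "c \<notin> U"
    proof
      assume "c \<in> U"
      \<comment> \<open>\<open>w\<close> is a point other than \<open>u\<close> common to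
        \<open>A p u\<close> and \<open>A u n\<close>, hence outside \<open>U\<close>. It precedes
        every point of \<open>U\<close> on \<open>A p u\<close>, so a first hit in \<open>U\<close>
        would come too late.\<close>
      obtain w where w: "w \<in> A p u" "w \<in> A u n" "w \<noteq> u" using p_not_only_u A_ends[OF p un(1)] S(3) by blast
      have wX: "w \<in> X" "le w u" using A_in[OF p un(1) w(1)] w(1) un(1) unfolding le_def by auto
      have "w \<notin> U" using w un(3) by blast
      then have "\<not> le c w" using U_up \<open>c \<in> U\<close> by blast
      then have "le w c" using le_linear[OF wX(2) lecu(1)] by blast
      then have "w \<in> A p c" unfolding le_def by blast
      then have "w = c" using c(4) w(2) by blast
      then show False using \<open>w \<notin> U\<close> \<open>c \<in> U\<close> by blast
    qed
    have "c \<notin> E" using E_maximal[OF _ lecu(1)] \<open>c \<noteq> u\<close> by blast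
    then have "c \<in> T" using cU \<open>c \<notin> V\<close> lecu(2) unfolding T_def E'_def by blast
    then have "A p c \<subseteq> T" by (rule A_p_T)
    then have "cjoin (T - J) p c" by (rule join[OF p lecu(2) _ c(3)])
    then show thesis using that[of c] TC[OF \<open>c \<in> T\<close> c(1)] cjoin_trans[OF j1] by blast
  qed
qed

text \<open>An excursion into \<open>J\<close> would leave and return through \<open>A u n\<close>,
  the only part of \<open>C\<close> that points of \<open>X\<close> off \<open>U \<union> V\<close>
  can meet; by convexity it would lie on \<open>A u n\<close>, not in \<open>J\<close>.\<close>

lemma A_in_side:
  assumes "x \<in> X" "y \<in> X" "x \<notin> J" "y \<notin> J" "A x y \<inter> (U \<union> V) = {}"
  shows "A x y \<inter> J = {}"
proof (rule ccontr)
  assume "A x y \<inter> J \<noteq> {}"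
  then obtain z where z: "z \<in> A x y" "z \<in> J" by blast
  have zX: "z \<in> X" using A_in[OF assms(1,2) z(1)] .
  have meet: "\<exists>s. s \<in> A v w \<and> s \<in> C" if "v \<in> X" "w \<in> X" "v \<in> J" "w \<notin> J" for v w
  proof (rule ccontr)
    assume "\<not> ?thesis"
    then have "A v w \<subseteq> I \<union> J" using IJ(8) by blast
    then have "A v w \<subseteq> I \<or> A v w \<subseteq> J"
      using connected_in_one_side[OF A_connected[OF that(1,2)] _ IJ(1,4,7)] by blast
    then show False using A_ends[OF that(1,2)] that(3,4) IJ(7) by blast
  qed
  obtain s where s: "s \<in> A x z" "s \<in> C" using meet[OF zX assms(1) z(2) assms(3)] A_commute[OF zX assms(1)] by blast
  obtain t where t: "t \<in> A z y" "t \<in> C" using meet[OF zX assms(2) z(2) assms(4)] by blast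
  have "s \<in> A x y" "t \<in> A x y" using s t A_sub1[OF assms(1,2) z(1)] A_sub2[OF assms(1,2) z(1)] by blast+
  then have st: "s \<in> A u n" "t \<in> A u n"
    using C_X s(2) t(2) assms(5) A_in[OF assms(1,2)] by blast+
  have "z \<in> A s t" by (rule A_between[OF assms(1,2) z(1) s(1) t(1)])
  then have "z \<in> A u n" using A_convex[OF un(1,2) st] by blast
  then show False using z(2) side_eq(4) by blast
qed

end

section \<open>A continuum without endpoints across one side of the frame\<close>

lemma connected_Un_at: "connected S \<Longrightarrow> connected T \<Longrightarrow> x \<in> S \<Longrightarrow> x \<in> T \<Longrightarrow> connected (S \<union> T)"
  by (rule connected_Un) auto

context dendroid_frame
begin

text \<open>The barrier required by \<open>partition_of_crossing\<close>: it leads from the arc of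
  \<open>X\<close> to \<open>G\<close> and avoids the endpoints as well as \<open>U\<close> and
  \<open>V\<close>.\<close>

definition reach where
  "reach \<longleftrightarrow> (\<exists>H. compact H \<and> connected H \<and> H \<subseteq> - J \<and> H \<inter> E' = {} \<and> H \<inter> A u n \<noteq> {} \<and> H \<inter> G \<noteq> {})"

lemma reachI:
  assumes "compact H" "connected H" "H \<inter> J = {}" "H \<inter> E' = {}" "s \<in> H" "s \<in> A u n" "g \<in> H" "g \<in> G"
  shows reach
  unfolding reach_def using assms by (intro exI[of _ H]) blast

lemma frame_arcs: "arc_from_to (closed_segment u a) u a" "arc_from_to (closed_segment n a') n a'"
  "closed_segment u a \<inter> G = {a}" "G \<inter> closed_segment n a' = {a'}" "A u n \<inter> closed_segment u a = {u}"
  "A u n \<inter> closed_segment n a' = {n}" "A u n \<inter> G = {}" "closed_segment u a \<inter> closed_segment n a' = {}"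
proof -
  have "u \<noteq> a" "n \<noteq> a'" using frame_points un(1,2) by blast+
  then show "arc_from_to (closed_segment u a) u a" "arc_from_to (closed_segment n a') n a'"
    by (simp_all add: arc_from_to_segment)
  have sub: "S \<inter> Y = {x}" if "S \<inter> Z = {x}" "Y \<subseteq> Z" "x \<in> Y" for S Y Z and x :: "real ^ 2"
    using that by blast
  show "A u n \<inter> closed_segment u a = {u}" by (rule sub[OF un(3) segs(1)]) simp
  show "A u n \<inter> closed_segment n a' = {n}" by (rule sub[OF un(4) segs(2)]) simp
  show "G \<inter> closed_segment n a' = {a'}" by (rule sub[OF G(4) segs(2)]) simp
  have "G \<inter> closed_segment u a = {a}" by (rule sub[OF G(3) segs(1)]) simp
  then show "closed_segment u a \<inter> G = {a}" by (simp only: Int_commute)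
  show "A u n \<inter> G = {}" using G(2) S(2) by blast
  show "closed_segment u a \<inter> closed_segment n a' = {}" using segs UV by blast
qed

text \<open>The frontier of a small neighbourhood \<open>Q\<close> of \<open>U \<union> B\<close>
  lies between \<open>u\<close> and \<open>n\<close>, which are joined in \<open>- J\<close> by
  \<open>A u n\<close> and by the rest of the curve; by unicoherence a continuum in the frontier
  meets both. The parameter \<open>B\<close> serves to keep a second crossing away from a point
  found by the first.\<close>

lemma cross_frontier:
  assumes "compact B" "B \<inter> V = {}"
  obtains K where "compact K" "connected K" "K \<subseteq> - J" "K \<inter> (U \<union> V \<union> B) = {}" "K \<inter> A u n \<noteq> {}" "K \<inter> G \<noteq> {}"
proof -
  define W where "W = U \<union> B"
  have W: "compact W" "closed W" "W \<noteq> {}" "V \<inter> W = {}"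
    unfolding W_def using U(1) assms frame_points UV by (auto simp: compact_imp_closed)
  obtain d where d: "d > 0" "\<And>x y. x \<in> V \<Longrightarrow> y \<in> W \<Longrightarrow> d \<le> dist x y"
    using separate_compact_closed[OF V(1) W(2,4)] by metis
  have att: "\<exists>w\<in>W. infdist z W = dist z w" for z using infdist_attains_inf[OF W(2,3), of z] by blast
  define Q where "Q = {z. infdist z W < d / 2}"
  have Q: "open Q" unfolding Q_def by (intro open_Collect_less continuous_intros)
  have clQ: "closure Q \<subseteq> {z. infdist z W \<le> d / 2}" unfolding Q_def
    by (rule closure_minimal) (auto intro!: closed_Collect_le continuous_intros)
  obtain R where R: "W \<subseteq> cball 0 R" using compact_imp_bounded[OF W(1)] by (auto simp: bounded_iff subset_iff)
  have "Q \<subseteq> cball 0 (R + d)"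
  proof
    fix z assume "z \<in> Q"
    then obtain w where "w \<in> W" "dist z w < d / 2" using att[of z] unfolding Q_def by force
    then have "norm w \<le> R" "dist z w < d / 2" using R by auto
    then show "z \<in> cball 0 (R + d)" using norm_triangle_ineq2[of z w] d(1) unfolding dist_norm by simp
  qed
  then have bQ: "bounded Q" using bounded_cball bounded_subset by blast
  have uQ: "u \<in> Q" unfolding Q_def W_def using frame_points d(1) by simp
  have far: "v \<notin> closure Q" if "v \<in> V" for v
    using att[of v] d that clQ by force
  have nQ: "n \<notin> closure Q" using far frame_points by blast
  define Y where "Y = closed_segment u a \<union> G \<union> closed_segment n a'"
  have Y: "connected Y" "closed Y" "Y \<subseteq> - J" "u \<in> Y" "n \<in> Y"
  proof -
    show "connected Y" unfolding Y_def
      using frame_arcs(3,4) arc_from_to_connected[OF G(1)] frame_points by (intro connected_Un) auto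
    show "closed Y" unfolding Y_def using arc_from_to_closed[OF G(1)] by (intro closed_Un) auto
    show "Y \<subseteq> - J" unfolding Y_def using side_eq(5) by blast
  qed (auto simp: Y_def)
  have SJ: "A u n \<subseteq> - J" using side_eq(5) by blast
  have "connected (- (- J))" using IJ(5) by simp
  then obtain K where K: "compact K" "connected K" "K \<subseteq> frontier Q \<inter> - J" "K \<inter> A u n \<noteq> {}" "K \<inter> Y \<noteq> {}"
    using frontier_component_meets_both[OF side_eq(2) _ bQ uQ nQ Q A_connected[OF un(1,2)] A_closed[OF un(1,2)] SJ S(3,4) Y]
    by metis
  have "W \<subseteq> Q" unfolding Q_def using d(1) by auto
  then have "frontier Q \<inter> W = {}" unfolding frontier_def interior_open[OF Q] by blast
  moreover have "frontier Q \<inter> V = {}" using far unfolding frontier_def by blast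
  ultimately have KU: "K \<inter> (U \<union> V \<union> B) = {}" using K(3) unfolding W_def by blast
  then have "K \<inter> G \<noteq> {}" using K(5) segs unfolding Y_def by blast
  then show thesis using that[OF K(1,2) _ KU K(4)] K(3) by blast
qed

text \<open>A continuum crossing the region from \<open>G\<close> to the arc is followed up to a small distance
  of \<open>X\<close>; unless its nearest point of \<open>X\<close> is an endpoint, it extends down the dendroid.\<close>

lemma accessible_endpoint:
  assumes "\<not> reach" "compact B" "B \<inter> V = {}"
  obtains Z k x where "compact Z" "connected Z" "Z \<inter> J = {}" "Z \<inter> X = {}" "Z \<inter> (U \<union> V) = {}" "k \<in> Z" "Z \<inter> G \<noteq> {}"
    "closed_segment k x \<inter> X = {x}" "closed_segment k x \<inter> J = {}" "closed_segment k x \<inter> (U \<union> V) = {}" "x \<in> E" "x \<notin> B"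
proof -
  obtain K where K: "compact K" "connected K" "K \<subseteq> - J" "K \<inter> (U \<union> V \<union> B) = {}" "K \<inter> A u n \<noteq> {}" "K \<inter> G \<noteq> {}"
    using cross_frontier[OF assms(2,3)] by metis
  obtain d1 where d1: "d1 > 0" "\<And>x y. x \<in> G \<Longrightarrow> y \<in> X \<Longrightarrow> d1 \<le> dist x y"
    using separate_compact_closed[OF arc_from_to_compact[OF G(1)] closed_X G(2)] by metis
  have "closed (U \<union> V \<union> B)" using U(1) V(1) assms(2) compact_imp_closed by blast
  then obtain d2 where d2: "d2 > 0" "\<And>x y. x \<in> K \<Longrightarrow> y \<in> U \<union> V \<union> B \<Longrightarrow> d2 \<le> dist x y"
    using separate_compact_closed[OF K(1) _ K(4)] by metis
  \<comment> \<open>Smaller than the distance from \<open>G\<close> to \<open>X\<close>, so that the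
    crossing starts farther than \<open>d\<close> from \<open>X\<close>, and smaller than the
    distance from \<open>K\<close> to \<open>U \<union> V \<union> B\<close>, so that the final
    segment of length \<open>d\<close> avoids these sets.\<close>
  define d where "d = min d1 d2 / 2"
  have d: "d > 0" "d < d1" "d < d2" unfolding d_def using d1 d2 by auto
  have Xne: "X \<noteq> {}" using p by blast
  define F where "F = K \<inter> {z. d \<le> infdist z X}"
  define Y where "Y = {z. infdist z X \<le> d}"
  have clY: "closed Y" "closed {z. d \<le> infdist z X}" unfolding Y_def by (auto intro!: closed_Collect_le continuous_intros)
  have F: "compact F" unfolding F_def using K(1) clY by (intro compact_Int_closed)
  have GF: "G \<inter> Y = {}"
  proof -
    have "d < infdist g X" if "g \<in> G" for g
    proof -
      obtain x where "x \<in> X" "infdist g X = dist g x" using infdist_attains_inf[OF closed_X Xne] by metis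
      then show ?thesis using d1(2)[OF that, of x] d(2) by simp
    qed
    then show ?thesis unfolding Y_def by force
  qed
  \<comment> \<open>\<open>K\<close> is connected and passes from \<open>G\<close>, which is far
    from \<open>X\<close>, to a point of \<open>A u n\<close>. A splitting of its far part
    \<open>F\<close> with \<open>G\<close> on one side and \<open>Y\<close> on the other would
    therefore split \<open>K\<close>.\<close>
  have split: False if H: "closed H1" "closed H2" "H1 \<union> H2 = F" "H1 \<inter> H2 = {}" "H1 \<inter> Y = {}" "H2 \<inter> G = {}" for H1 H2
  proof -
    have "K \<subseteq> F \<union> Y" unfolding F_def Y_def by auto
    then have K1: "K \<subseteq> H1 \<union> (H2 \<union> Y)" using H(3) by blast
    have "H1 \<inter> (H2 \<union> Y) \<inter> K = {}" using H(4,5) by blast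
    then have "H1 \<inter> K = {} \<or> (H2 \<union> Y) \<inter> K = {}"
      using connected_closedD[OF K(2) _ K1 H(1) closed_Un[OF H(2) clY(1)]] by blast
    moreover have "H1 \<inter> K \<noteq> {}" using K(6) GF K1 H(6) by blast
    moreover have "(H2 \<union> Y) \<inter> K \<noteq> {}"
    proof -
      obtain s where "s \<in> K" "s \<in> A u n" using K(5) by blast
      moreover have "s \<in> X" using \<open>s \<in> A u n\<close> S(2) by blast
      then have "s \<in> Y" unfolding Y_def using d(1) by simp
      ultimately show ?thesis by blast
    qed
    ultimately show False by blast
  qed
  obtain Z where Z: "compact Z" "connected Z" "Z \<subseteq> F" "Z \<inter> Y \<noteq> {}" "Z \<inter> G \<noteq> {}"
    by (rule component_meets_both[OF F clY(1) arc_from_to_closed[OF G(1)] split])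
  have ZJ: "Z \<inter> J = {}" using Z(3) K(3) unfolding F_def by blast
  have ZX: "Z \<inter> X = {}" using Z(3) d(1) unfolding F_def by force
  have ZU: "Z \<inter> (U \<union> V) = {}" using Z(3) K(4) unfolding F_def by blast
  obtain k where k: "k \<in> Z" "k \<in> Y" using Z(4) by blast
  then have kd: "infdist k X = d" "k \<in> K" using Z(3) unfolding F_def Y_def by auto
  obtain x where x: "x \<in> X" "dist k x = d" "closed_segment k x \<inter> X = {x}"
    using nearest_point[OF closed_X Xne, of k] kd(1) by metis
  have dist: "dist k z \<le> d" "dist z x \<le> d" if "z \<in> closed_segment k x" for z
    using dist_in_closed_segment[OF that] x(2) by (simp_all add: dist_commute)
  have segU: "z \<notin> U \<union> V \<union> B" if "z \<in> closed_segment k x" for z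
    using d2(2)[OF kd(2), of z] dist(1)[OF that] d(3) by force
  have segG: "z \<notin> G" if "z \<in> closed_segment k x" for z
    using d1(2)[of z x] x(1) dist(2)[OF that] d(2) by force
  have segC: "z = x" if "z \<in> closed_segment k x" "z \<in> C" for z
  proof -
    have "z \<in> A u n" using that segU[OF that(1)] segG[OF that(1)] segs by blast
    then show "z = x" using that(1) x(3) S(2) by blast
  qed
  \<comment> \<open>The segment starts outside \<open>J\<close> and meets \<open>C\<close> at most
    in its end \<open>x\<close>, so it has no way into \<open>J\<close>.\<close>
  have segJ: "closed_segment k x \<inter> J = {}"
  proof (rule ccontr)
    assume "closed_segment k x \<inter> J \<noteq> {}"
    then obtain z where z: "z \<in> closed_segment k x" "z \<in> J" by blast
    have "closed_segment k z \<inter> C = {}"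
    proof (rule ccontr)
      assume "closed_segment k z \<inter> C \<noteq> {}"
      then obtain y where y: "y \<in> closed_segment k z" "y \<in> C" by blast
      have "y \<in> closed_segment k x" using y(1) z(1) by (meson ends_in_segment(1) subset_closed_segment subsetD)
      then have "y = x" using segC y(2) by blast
      then show False using closed_segment_minus_end(2)[OF z(1)] y z(2) side_eq(4) by blast
    qed
    then have "closed_segment k z \<subseteq> I \<union> J" using IJ(8) by blast
    then have "closed_segment k z \<subseteq> I \<or> closed_segment k z \<subseteq> J"
      using connected_in_one_side[OF _ _ IJ(1,4,7)] connected_segment(1) by blast
    moreover have "z \<in> closed_segment k z" "k \<in> closed_segment k z" by auto
    ultimately show False using z(2) IJ(7) k(1) ZJ by blast
  qed
  \<comment> \<open>Otherwise \<open>x\<close> lies in \<open>T\<close>, and \<open>descend\<close>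
    prolongs the crossing from \<open>x\<close> to \<open>A u n\<close>, which would establish
    \<open>reach\<close>.\<close>
  have xE: "x \<in> E"
  proof (rule ccontr)
    assume nE: "x \<notin> E"
    have xs: "x \<in> closed_segment k x" by simp
    have xT: "x \<in> T" unfolding T_def E'_def using x(1) nE segU[OF xs] by blast
    have xJ: "x \<notin> J" using segJ xs by blast
    obtain s where s: "s \<in> A u n" "cjoin (T - J) x s" using descend[OF xT xJ] by metis
    obtain L where L: "compact L" "connected L" "L \<subseteq> T - J" "x \<in> L" "s \<in> L" using cjoinE[OF s(2)] by metis
    define M where "M = Z \<union> closed_segment k x \<union> L"
    have "connected (Z \<union> closed_segment k x)" using Z(2) k(1) by (intro connected_Un) auto
    then have "connected M" unfolding M_def by (rule connected_Un_at[OF _ L(2) _ L(4)]) auto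
    moreover have "compact M" unfolding M_def using Z(1) L(1) by (intro compact_Un) auto
    moreover have "M \<inter> J = {}" unfolding M_def using ZJ segJ L(3) by blast
    moreover have "M \<inter> E' = {}"
    proof -
      have "closed_segment k x \<inter> E = {}" by (rule Int_singleton_subset(2)[OF x(3) E_subset nE])
      moreover have "closed_segment k x \<inter> (U \<union> V) = {}" using segU by blast
      moreover have "Z \<inter> E = {}" using ZX E_subset by blast
      moreover have "L \<inter> E' = {}" using L(3) unfolding T_def by blast
      ultimately show ?thesis using ZU unfolding M_def E'_def by blast
    qed
    moreover obtain g where "g \<in> Z" "g \<in> G" using Z(5) by blast
    moreover have "s \<in> M" using L(5) unfolding M_def by blast
    ultimately have reach using reachI[of M s g] s(1) unfolding M_def by blast
    then show False using assms(1) by blast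
  qed
  have sU: "closed_segment k x \<inter> (U \<union> V) = {}" "x \<notin> B" using segU by auto
  show thesis by (rule that[OF Z(1,2) ZJ ZX ZU k(1) Z(5) x(3) segJ sU(1) xE sU(2)])
qed

text \<open>If no crossing avoids the endpoints, there are crossings to two different accessible
  endpoints \<open>x1\<close> and \<open>x2\<close>. With a piece of \<open>G\<close> and the arc
  \<open>A x1 x2\<close> they form a set \<open>C'\<close> off the connected set
  \<open>J \<union> U \<union> V\<close>. Outside the complementary component that contains the
  latter, \<open>crossing_continuum\<close> finds a continuum that reaches \<open>X\<close> without
  endpoints, and \<open>descend\<close> completes the crossing.\<close>

lemma reach: reach
proof (rule ccontr)
  assume no: "\<not> reach"
  obtain Z1 k1 x1 where 1: "compact Z1" "connected Z1" "Z1 \<inter> J = {}" "Z1 \<inter> X = {}" "Z1 \<inter> (U \<union> V) = {}" "k1 \<in> Z1" "Z1 \<inter> G \<noteq> {}"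
    "closed_segment k1 x1 \<inter> X = {x1}" "closed_segment k1 x1 \<inter> J = {}" "closed_segment k1 x1 \<inter> (U \<union> V) = {}" "x1 \<in> E"
    using accessible_endpoint[OF no compact_empty Int_empty_left] by metis
  have xs: "x \<in> closed_segment k x" for k x :: "real ^ 2" by simp
  have x1: "x1 \<notin> U \<union> V" using 1(10) xs by blast
  \<comment> \<open>With \<open>{x1}\<close> in the role of \<open>B\<close>, the second endpoint
    differs from the first.\<close>
  have "compact {x1}" "{x1} \<inter> V = {}" using x1 by auto
  then obtain Z2 k2 x2 where 2: "compact Z2" "connected Z2" "Z2 \<inter> J = {}" "Z2 \<inter> X = {}" "Z2 \<inter> (U \<union> V) = {}" "k2 \<in> Z2" "Z2 \<inter> G \<noteq> {}"
    "closed_segment k2 x2 \<inter> X = {x2}" "closed_segment k2 x2 \<inter> J = {}" "closed_segment k2 x2 \<inter> (U \<union> V) = {}" "x2 \<in> E" "x2 \<notin> {x1}"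
    using accessible_endpoint[OF no] by metis
  have x2: "x2 \<notin> U \<union> V" "x1 \<noteq> x2" using 2(10,12) xs by blast+
  obtain g1 g2 where g: "g1 \<in> Z1" "g1 \<in> G" "g2 \<in> Z2" "g2 \<in> G" using 1(7) 2(7) by blast
  have "g1 \<in> G - {a, a'}" "g2 \<in> G - {a, a'}" using g 1(5) 2(5) frame_points(3,4) by blast+
  then obtain Q where Q: "compact Q" "connected Q" "Q \<subseteq> G - {a, a'}" "g1 \<in> Q" "g2 \<in> Q"
    using arc_interior_subcontinuum[OF G(1)] by metis
  have QU: "Q \<inter> (U \<union> V) = {}"
  proof -
    have "G \<inter> (U \<union> V) = {a, a'}" unfolding Int_Un_distrib G(3,4) by auto
    then show ?thesis using Q(3) by blast
  qed
  have QJ: "Q \<inter> J = {}" using Q(3) side_eq(5) by blast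
  have QX: "Q \<inter> X = {}" using Q(3) G(2) by blast
  define Z where "Z = Z1 \<union> Q \<union> Z2"
  have "connected (Z1 \<union> Q)" using 1(2) Q(2) g(1) Q(4) by (intro connected_Un) auto
  then have Zc: "connected Z" unfolding Z_def by (rule connected_Un_at[OF _ 2(2) _ g(3)]) (use Q(5) in simp)
  have Z: "compact Z" "Z \<inter> J = {}" "Z \<inter> X = {}" "Z \<inter> (U \<union> V) = {}" "k1 \<in> Z" "k2 \<in> Z"
  proof -
    show "compact Z" unfolding Z_def using 1(1) Q(1) 2(1) by (intro compact_Un)
    show "Z \<inter> J = {}" unfolding Z_def using 1(3) QJ 2(3) by blast
    show "Z \<inter> X = {}" unfolding Z_def using 1(4) QX 2(4) by blast
    show "Z \<inter> (U \<union> V) = {}" unfolding Z_def using 1(5) QU 2(5) by blast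
    show "k1 \<in> Z" "k2 \<in> Z" unfolding Z_def using 1(6) 2(6) by auto
  qed
  have xX: "x1 \<in> X" "x2 \<in> X" using 1(11) 2(11) E_subset by auto
  have AU: "A x1 x2 \<inter> (U \<union> V) = {}"
  proof (rule ccontr)
    assume "A x1 x2 \<inter> (U \<union> V) \<noteq> {}"
    then obtain z where z: "z \<in> A x1 x2" "z \<in> U \<union> V" by blast
    have "le z x1 \<or> le z x2" using A_down[OF xX z(1)] .
    then show False using z(2) U_up V_up x1 x2(1) by blast
  qed
  have "x1 \<notin> J" "x2 \<notin> J" using 1(9) 2(9) xs by blast+
  then have AJ: "A x1 x2 \<inter> J = {}" using A_in_side[OF xX _ _ AU] by blast
  define C' where "C' = Z \<union> closed_segment k1 x1 \<union> closed_segment k2 x2 \<union> A x1 x2"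
  define M where "M = J \<union> U \<union> V"
  have MC: "M \<subseteq> - C'" 
  proof -
    have *: "M \<inter> B = {}" if "B \<inter> J = {}" "B \<inter> (U \<union> V) = {}" for B unfolding M_def using that by blast
    have "M \<inter> C' = {}" unfolding C'_def Int_Un_distrib using *[OF Z(2,4)] *[OF 1(9,10)] *[OF 2(9,10)] *[OF AJ AU] by simp
    then show ?thesis by blast
  qed
  have Mc: "connected M"
  proof -
    \<comment> \<open>\<open>J\<close> is linked to \<open>U\<close> and \<open>V\<close> through
      its frontier points \<open>u\<close> and \<open>n\<close>.\<close>
    have "C \<subseteq> closure J" using IJ(10) unfolding frontier_def by blast
    then have sub: "J \<union> {u, n} \<subseteq> closure J" using S(3,4) closure_subset by blast
    have "connected (J \<union> {u, n})" by (rule connected_intermediate_closure[OF IJ(5) _ sub]) blast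
    then have "connected ((J \<union> {u, n}) \<union> U)" by (rule connected_Un_at[OF _ U(2) _ frame_points(1)]) simp
    then have "connected (((J \<union> {u, n}) \<union> U) \<union> V)" by (rule connected_Un_at[OF _ V(2) _ frame_points(2)]) simp
    moreover have "((J \<union> {u, n}) \<union> U) \<union> V = M" unfolding M_def using frame_points by auto
    ultimately show ?thesis by simp
  qed
  have "M \<noteq> {}" unfolding M_def using frame_points by blast
  then obtain W where W: "W \<in> components (- C')" "M \<subseteq> W"
    using exists_component_superset[OF MC _ Mc] MC by blast
  obtain K where K: "compact K" "connected K" "K \<inter> W = {}" "K \<inter> E = {}" "K \<inter> X \<noteq> {}" "K \<inter> Z \<noteq> {}"
    using crossing_continuum[OF C'_def Z(1) Zc Z(3,5,6) 1(11) 2(11) x2(2) 1(8) 2(8) W(1)] by metis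
  have KJ: "K \<inter> J = {}" "K \<inter> (U \<union> V) = {}" using K(3) W(2) unfolding M_def by auto
  obtain y where y: "y \<in> K" "y \<in> X" using K(5) by blast
  have yT: "y \<in> T" unfolding T_def E'_def using y K(4) KJ by blast
  have "y \<notin> J" using y KJ by blast
  then obtain s where s: "s \<in> A u n" "cjoin (T - J) y s" using descend[OF yT] by metis
  obtain L where L: "compact L" "connected L" "L \<subseteq> T - J" "y \<in> L" "s \<in> L" using cjoinE[OF s(2)] by metis
  define H where "H = Z \<union> K \<union> L"
  have "connected (Z \<union> K)" using Zc K(2,6) by (intro connected_Un) auto
  then have "connected H" unfolding H_def by (rule connected_Un_at[OF _ L(2) _ L(4)]) (use y(1) in simp)
  moreover have "compact H" unfolding H_def using Z(1) K(1) L(1) by (intro compact_Un)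
  moreover have "H \<inter> J = {}" unfolding H_def using Z(2) KJ(1) L(3) by blast
  moreover have "H \<inter> E' = {}"
  proof -
    have "Z \<inter> E' = {}" using Z(3,4) E_subset unfolding E'_def by blast
    moreover have "K \<inter> E' = {}" using K(4) KJ(2) unfolding E'_def by blast
    moreover have "L \<inter> E' = {}" using L(3) unfolding T_def by blast
    ultimately show ?thesis unfolding H_def by blast
  qed
  moreover have "s \<in> H" "g1 \<in> H" using L(5) g(1) unfolding H_def Z_def by auto
  ultimately have reach using reachI[of H s g1] s(1) g(2) by blast
  then show False using no by blast
qed

lemma one_side_partition:
  obtains P where "P \<subseteq> E' - J" "closedin (top_of_set E') P" "closedin (top_of_set E') (E' - J - P)"
    "U - J \<subseteq> P" "(V - J) \<inter> P = {}"
proof -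
  obtain H where H: "compact H" "connected H" "H \<subseteq> - J" "H \<inter> E' = {}" "H \<inter> A u n \<noteq> {}" "H \<inter> G \<noteq> {}"
    using reach unfolding reach_def by metis
  have sub: "U \<subseteq> E'" "V \<subseteq> E'" unfolding E'_def by auto
  show thesis
    by (rule partition_of_crossing[OF S(1) frame_arcs(1) G(1) frame_arcs(2) frame_arcs(5,6,3,4,7,8)
      IJ(1,2,3,4,5,7,8,9,10) U(1,2) V(1,2) sub C_U C_V E'_C H that])
qed

text \<open>The partitions of the two closed sides are glued. Common points of \<open>E'\<close> and
  the curve lie in \<open>U\<close> or in \<open>V\<close>, where both partitions make the same
  choice.\<close>

lemma frame_partition:
  obtains P where "P \<subseteq> E" "closedin (top_of_set E) P" "closedin (top_of_set E) (E - P)" "E \<inter> U \<subseteq> P" "E \<inter> V \<inter> P = {}"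
proof -
  interpret F2: dendroid_frame X p f U V u n a a' G J I by (rule swap)
  obtain P where P: "P \<subseteq> E' - J" "closedin (top_of_set E') P" "closedin (top_of_set E') (E' - J - P)"
    "U - J \<subseteq> P" "(V - J) \<inter> P = {}" using one_side_partition by metis
  obtain Q where Q: "Q \<subseteq> E' - I" "closedin (top_of_set E') Q" "closedin (top_of_set E') (E' - I - Q)"
    "U - I \<subseteq> Q" "(V - I) \<inter> Q = {}" using F2.one_side_partition by metis
  have PU: "U \<subseteq> P \<union> Q" using P(4) Q(4) IJ(7) by blast
  have PV: "V \<inter> (P \<union> Q) = {}" using P(1,5) Q(1,5) by blast
  have comp: "E' - (P \<union> Q) = (E' - J - P) \<union> (E' - I - Q)" (is "?L = ?R")
  proof
    show "?L \<subseteq> ?R" using IJ(7) by blast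
    show "?R \<subseteq> ?L"
    proof
      fix x assume x: "x \<in> ?R"
      show "x \<in> ?L"
      proof (cases "x \<in> C")
        case True
        then have "x \<in> closed_segment u a \<union> closed_segment n a'" using x E'_C by blast
        then have "x \<in> U \<or> x \<in> V" using segs by blast
        moreover have "x \<notin> J" "x \<notin> I" using True side_eq by blast+
        ultimately show ?thesis using x P(4,5) Q(4,5) by blast
      next
        case False
        then have "x \<in> I \<or> x \<in> J" using IJ(8) by blast
        then show ?thesis using x P(1) Q(1) IJ(7) by blast
      qed
    qed
  qed
  have cl: "closedin (top_of_set E') (P \<union> Q)" "closedin (top_of_set E') (E' - (P \<union> Q))"
    unfolding comp using P(2,3) Q(2,3) closedin_Un by blast+
  have EE: "E \<subseteq> E'" unfolding E'_def by blast
  have restr: "closedin (top_of_set E) (E \<inter> Y)" if "closedin (top_of_set E') Y" for Y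
    using that EE closedin_subset_trans unfolding closedin_closed by blast
  show thesis
  proof (rule that[of "E \<inter> (P \<union> Q)"])
    show "closedin (top_of_set E) (E \<inter> (P \<union> Q))" using restr[OF cl(1)] .
    have "E - E \<inter> (P \<union> Q) = E \<inter> (E' - (P \<union> Q))" using EE by blast
    then show "closedin (top_of_set E) (E - E \<inter> (P \<union> Q))" using restr[OF cl(2)] by simp
  qed (use PU PV in blast)+
qed

end

subsection \<open>At most two endpoints above a point are limits from outside\<close>

context planar_dendroid
begin

lemma point_near:
  assumes "x \<in> X" "\<rho> > 0"
  obtains b where "b \<in> cball x \<rho>" "b \<notin> X"
  using near_Compl[OF assms] by (metis dist_commute less_imp_le mem_cball)

text \<open>An arc outside \<open>X\<close> is trimmed twice: at its first point in
  \<open>V\<close>, then, run backwards, at its first point in \<open>U\<close>.\<close>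

lemma bridge:
  assumes "closed U" "closed V" "U \<inter> V = {}" "x \<in> U" "x \<notin> X" "y \<in> V" "y \<notin> X"
  obtains G a a' where "arc_from_to G a a'" "G \<inter> X = {}" "G \<inter> U = {a}" "G \<inter> V = {a'}"
proof -
  have "x \<noteq> y" using assms by blast
  then obtain B where B: "arc_from_to B x y" "B \<inter> X = {}" using path_in_Compl[OF assms(5,7)] by metis
  have "B \<inter> V \<noteq> {}" "x \<notin> V" using arc_from_to_ends[OF B(1)] assms by blast+
  then obtain a' B1 where 1: "a' \<in> V" "arc_from_to B1 x a'" "B1 \<subseteq> B" "B1 \<inter> V = {a'}"
    using arc_first_hit[OF B(1) assms(2)] by metis
  have "B1 \<inter> U \<noteq> {}" "a' \<notin> U" using arc_from_to_ends[OF 1(2)] assms(3,4) 1(1) by blast+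
  then obtain a G where 2: "arc_from_to G a' a" "G \<subseteq> B1" "G \<inter> U = {a}"
    using arc_first_hit[OF arc_from_to_sym[OF 1(2)] assms(1)] by metis
  have "a' \<in> G" using arc_from_to_ends[OF 2(1)] by blast
  then have "G \<inter> V = {a'}" using 1(1,4) 2(2) by blast
  moreover have "G \<inter> X = {}" using 2(2) 1(3) B(2) by blast
  ultimately show thesis using that[OF arc_from_to_sym[OF 2(1)]] 2(3) by blast
qed

text \<open>\<open>u\<close> and \<open>n\<close> are the first points of the thick sets on the arcs
  from the root. A point of \<open>A u n\<close> lies below \<open>u\<close> or \<open>n\<close>; if
  it is in a thick set, it lies below the first point of that set and so equals it.\<close>

lemma frame_exists:
  assumes "y \<in> X" "y' \<in> X" "\<rho> > 0" "\<sigma> > 0" "thick y \<rho> \<inter> thick y' \<sigma> = {}" "p \<notin> thick y \<rho>" "p \<notin> thick y' \<sigma>"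
  obtains u n a a' G I J where "dendroid_frame X p f (thick y \<rho>) (thick y' \<sigma>) u n a a' G I J"
    "le u y" "\<And>z. z \<in> thick y \<rho> \<Longrightarrow> le z y \<Longrightarrow> le u z"
    "le n y'" "\<And>z. z \<in> thick y' \<sigma> \<Longrightarrow> le z y' \<Longrightarrow> le n z"
proof -
  let ?U = "thick y \<rho>" and ?V = "thick y' \<sigma>"
  have U: "compact ?U" "connected ?U" "closed ?U" and V: "compact ?V" "connected ?V" "closed ?V"
    using compact_thick connected_thick assms(3,4) compact_imp_closed by blast+
  obtain u where u: "u \<in> X" "u \<in> cball y \<rho>" "le u y" "\<And>z. z \<in> ?U \<Longrightarrow> le z y \<Longrightarrow> le u z"
    using first_point[OF assms(1,3,6)] by metis
  obtain n where n: "n \<in> X" "n \<in> cball y' \<sigma>" "le n y'" "\<And>z. z \<in> ?V \<Longrightarrow> le z y' \<Longrightarrow> le n z"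
    using first_point[OF assms(2,4,7)] by metis
  have un: "u \<in> ?U" "n \<in> ?V" using u n cball_subset_thick by blast+
  have un': "u \<notin> ?V" "n \<notin> ?U" using un assms(5) by blast+
  have SU: "A u n \<inter> ?U = {u}"
  proof -
    have "z = u" if "z \<in> A u n" "z \<in> ?U" for z
    proof -
      have "\<not> le z n" using thick_up[OF that(2)] un' by blast
      then have zu: "le z u" using A_down[OF u(1) n(1) that(1)] by blast
      then have "le u z" using u(4)[OF that(2)] le_trans[OF zu u(3)] by blast
      then show ?thesis using le_antisym zu by blast
    qed
    moreover have "u \<in> A u n" using A_ends[OF u(1) n(1)] by blast
    ultimately show ?thesis using un(1) by blast
  qed
  have SV: "A u n \<inter> ?V = {n}"
  proof -
    have "z = n" if "z \<in> A u n" "z \<in> ?V" for z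
    proof -
      have "\<not> le z u" using thick_up[OF that(2)] un' by blast
      then have zu: "le z n" using A_down[OF u(1) n(1) that(1)] by blast
      then have "le n z" using n(4)[OF that(2)] le_trans[OF zu n(3)] by blast
      then show ?thesis using le_antisym zu by blast
    qed
    moreover have "n \<in> A u n" using A_ends[OF u(1) n(1)] by blast
    ultimately show ?thesis using un(2) by blast
  qed
  obtain b where b: "b \<in> cball y \<rho>" "b \<notin> X" using point_near[OF assms(1,3)] by metis
  obtain b' where b': "b' \<in> cball y' \<sigma>" "b' \<notin> X" using point_near[OF assms(2,4)] by metis
  have bU: "b \<in> ?U" "b' \<in> ?V" using b b' cball_subset_thick by blast+
  obtain G a a' where G: "arc_from_to G a a'" "G \<inter> X = {}" "G \<inter> ?U = {a}" "G \<inter> ?V = {a'}"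
    using bridge[OF U(3) V(3) assms(5) bU(1) b(2) bU(2) b'(2)] by metis
  have aG: "a \<in> G" "a' \<in> G" using arc_from_to_ends[OF G(1)] by auto
  have aX: "a \<notin> X" "a' \<notin> X" using aG G(2) by auto
  have aU: "a \<in> ?U" "a' \<in> ?V" using G(3,4) by blast+
  have ab: "a \<in> cball y \<rho>" "a' \<in> cball y' \<sigma>" using thick_minus_X aU aX by blast+
  have seg: "closed_segment u a \<subseteq> ?U" "closed_segment n a' \<subseteq> ?V"
    using closed_segment_subset[OF u(2) ab(1) convex_cball] closed_segment_subset[OF n(2) ab(2) convex_cball] cball_subset_thick by blast+
  define R where "R = (closed_segment u a \<union> G) \<union> closed_segment a' n"
  have ne: "u \<noteq> a" "a' \<noteq> n" "u \<noteq> n" using u(1) n(1) aX un un' by auto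
  have sub: "S \<inter> Y = {x}" if "S \<inter> Z = {x}" "Y \<subseteq> Z" "x \<in> Y" for S Y Z and x :: "real ^ 2"
    using that by blast
  have "closed_segment u a \<inter> G = {a}" using sub[OF G(3) seg(1)] by (simp add: Int_commute)
  then have a1: "arc_from_to (closed_segment u a \<union> G) u a'"
    using arc_from_to_join[OF arc_from_to_segment[OF ne(1)] G(1)] by blast
  have "G \<inter> closed_segment a' n = {a'}" using sub[OF G(4) seg(2)] by (simp add: closed_segment_commute)
  moreover have "closed_segment u a \<inter> closed_segment a' n = {}"
    using seg assms(5) unfolding closed_segment_commute[of a' n] by blast
  ultimately have "(closed_segment u a \<union> G) \<inter> closed_segment a' n = {a'}" unfolding Int_Un_distrib2 by simp
  then have R: "arc_from_to R u n" unfolding R_def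
    using arc_from_to_join[OF a1 arc_from_to_segment[OF ne(2)]] by blast
  have S: "arc_from_to (A u n) u n" "A u n \<subseteq> X" using the_arc_arc[OF dend u(1) n(1) ne(3)] by auto
  have "A u n \<inter> R = {u, n}"
  proof -
    have "A u n \<inter> closed_segment u a = {u}" by (rule sub[OF SU seg(1)]) simp
    moreover have "A u n \<inter> closed_segment a' n = {n}" by (rule sub[OF SV]) (use seg(2) in \<open>auto simp: closed_segment_commute\<close>)
    moreover have "A u n \<inter> G = {}" using G(2) S(2) by blast
    ultimately show ?thesis unfolding R_def Int_Un_distrib by (simp add: insert_commute)
  qed
  then obtain I J where IJ: "open I" "connected I" "I \<noteq> {}" "open J" "connected J" "J \<noteq> {}"
    "I \<inter> J = {}" "I \<union> J = - (A u n \<union> R)" "frontier I = A u n \<union> R" "frontier J = A u n \<union> R"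
    using Jordan_arcs[OF S(1) R] by metis
  have C: "A u n \<union> R = A u n \<union> closed_segment u a \<union> G \<union> closed_segment n a'"
    unfolding R_def closed_segment_commute[of a' n] by blast
  have "dendroid_frame X p f ?U ?V u n a a' G I J"
    by unfold_locales (fact U V assms u n SU SV G seg IJ[unfolded C] thick_up)+
  then show thesis using that u(3,4) n(3,4) by blast
qed

lemma separation:
  assumes "u \<in> X" "n \<in> X" "\<not> le u n" "\<not> le n u"
  obtains \<rho> P where "\<rho> > 0" "P \<subseteq> E" "closedin (top_of_set E) P" "closedin (top_of_set E) (E - P)"
    "E \<inter> thick u \<rho> \<subseteq> P" "E \<inter> thick n \<rho> \<inter> P = {}"
proof -
  obtain \<rho> where r: "\<rho> > 0" "thick u \<rho> \<inter> thick n \<rho> = {}" "p \<notin> thick u \<rho>" "p \<notin> thick n \<rho>"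
    using disjoint_thick[OF assms] by metis
  obtain us ns a a' G I J where "dendroid_frame X p f (thick u \<rho>) (thick n \<rho>) us ns a a' G I J"
    using frame_exists[OF assms(1,2) r(1) r(1) r(2,3,4)] by metis
  then interpret F: dendroid_frame X p f "thick u \<rho>" "thick n \<rho>" us ns a a' G I J .
  show thesis using F.frame_partition that[OF r(1)] by metis
qed

text \<open>By \<open>le_lower_limit\<close>, a point below a limit of points is a limit of points
  below them, and the complement of an upward closed set is closed under going down.\<close>

lemma upward_closure:
  assumes "y \<in> closure (X - up {m})" "le x y"
  shows "x \<in> closure (X - up {m})"
proof -
  obtain b where b: "\<And>n. b n \<in> X - up {m}" "b \<longlonglongrightarrow> y" using assms(1) unfolding closure_sequential by blast
  have bX: "b n \<in> X" for n using b(1) by blast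
  obtain a where a: "\<And>n. le (a n) (b n)" "a \<longlonglongrightarrow> x" using le_lower_limit[OF bX b(2) assms(2)] by metis
  have "a n \<in> X - up {m}" for n
    using leD[OF a(1)[of n]] b(1)[of n] le_trans[OF _ a(1)[of n]] unfolding up_def by blast
  then show ?thesis unfolding closure_sequential using a(2) by blast
qed

end

text \<open>The third leg together with an arc outside \<open>X\<close> is a crosscut of the frame, and
  the connected set \<open>F\<close> would have to approach all three legs.\<close>

lemma (in dendroid_frame) no_third_leg:
  assumes W: "compact W" "\<And>x y. x \<in> W \<Longrightarrow> le x y \<Longrightarrow> y \<in> W" "W \<inter> U = {}" "W \<inter> V = {}" "W \<inter> G = {}"
    and w: "w \<in> X" "w \<in> W" "b0 \<in> W" "b0 \<notin> X" "\<And>b. b \<in> W \<Longrightarrow> b \<notin> X \<Longrightarrow> closed_segment w b \<subseteq> W"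
      "\<And>z. z \<in> W \<Longrightarrow> le z w \<Longrightarrow> z = w"
    and m: "le m u" "le m n" "le m w"
    and F: "connected F" "F \<subseteq> X - up {m}" "F \<inter> (U \<union> V \<union> W) = {}" "u \<in> closure F" "n \<in> closure F" "w \<in> closure F"
  shows False
proof -
  have mX: "m \<in> X" using m leD by blast
  have noW: "u \<notin> W" "n \<notin> W" "w \<notin> U" "w \<notin> V" using W w frame_points by blast+
  have arcm: "A x y \<subseteq> up {m}" if "le m x" "le m y" for x y
  proof -
    have "x \<in> X" "y \<in> X" using that leD by blast+
    then have "A x y \<subseteq> A m x \<union> A m y" using A_triangle[OF _ _ mX] A_commute mX by metis
    then show ?thesis using A_subset_up that by blast
  qed
  have clW: "closed W" using W(1) by (rule compact_imp_closed)
  have "A w u \<inter> A u n \<noteq> {}" using A_ends[OF w(1) un(1)] S(3) by blast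
  moreover have wS: "w \<notin> A u n" using A_down[OF un(1,2)] W(2) w(2) noW by blast
  moreover have "w \<noteq> u" using noW w by blast
  moreover note arc_first_hit[OF the_arc_arc(1)[OF dend w(1) un(1)] A_closed[OF un(1,2)]]
  \<comment> \<open>\<open>d\<close> is the branch point of the three legs: the first point of
    \<open>A u n\<close> on the way from \<open>w\<close> to \<open>u\<close>.\<close>
  ultimately obtain d L where d: "d \<in> A u n" "d \<in> A w u" "arc_from_to L w d" "L \<subseteq> A w u" "L \<inter> A u n = {d}" by metis
  have dX: "d \<in> X" using d(1) S(2) by blast
  have L: "L = A w d" "L \<subseteq> X" using A_eqI[OF d(3)] d(4) A_subset[OF w(1) un(1)] by auto
  have dn: "d \<noteq> n"
  proof
    assume "d = n"
    then have "le n w \<or> le n u" using A_down[OF w(1) un(1)] d(2) by blast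
    then show False using V_up frame_points noW by blast
  qed
  have du: "d \<noteq> u"
  proof
    assume eq: "d = u"
    have "A w u \<inter> A u n = {u}" using d(5) L eq by simp
    then have "A w n = A w u \<union> A u n" by (rule A_concat[OF w(1) un(2,1)])
    then have "u \<in> A w n" using S(3) by blast
    then have "le u w \<or> le u n" using A_down[OF w(1) un(2)] by blast
    then show False using U_up frame_points noW by blast
  qed
  have dUV: "d \<notin> U" "d \<notin> V" using d(1) un(3,4) du dn by blast+
  have below: "le z w \<or> le z d" if "z \<in> L" for z using A_down[OF w(1) dX] that L(1) by blast
  have dW: "d \<notin> W"
  proof
    assume "d \<in> W"
    moreover have "le d u \<or> le d n" using A_down[OF un(1,2) d(1)] .
    ultimately show False using W(2) noW by blast
  qed
  have LU: "L \<inter> (U \<union> V) = {}" using below U_up V_up dUV noW by blast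
  have LW: "L \<inter> W = {w}" using below W(2) dW w(6) w(2) arc_from_to_ends[OF d(3)] by blast
  have SW: "A u n \<inter> W = {}" using A_down[OF un(1,2)] W(2) noW by blast
  have CW: "C \<inter> W = {}" using SW segs W(3,4,5) by blast
  have LC: "L \<inter> C = {d}"
  proof -
    have "L \<inter> (closed_segment u a \<union> G \<union> closed_segment n a') = {}" using LU segs L(2) G(2) by blast
    moreover have "L \<inter> C = (L \<inter> A u n) \<union> (L \<inter> (closed_segment u a \<union> G \<union> closed_segment n a'))" by blast
    ultimately show ?thesis using d(5) by simp
  qed
  have "C \<inter> W = {}" "W \<inter> C = {}" "a \<in> C" using CW by auto
  \<comment> \<open>An arc outside \<open>X\<close> from \<open>W\<close> to the curve completes the
    third leg to a crosscut \<open>cc\<close> from \<open>d\<close> to \<open>q\<close>; being off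
    \<open>X\<close>, the point \<open>q\<close> lies on the part of the curve opposite to
    \<open>A u n\<close>.\<close>
  then obtain B b q where B: "arc_from_to B b q" "B \<inter> X = {}" "B \<inter> W = {b}" "B \<inter> C = {q}"
    using bridge[OF clW closed_C _ w(3,4) _ frame_points(8)] by metis
  have bq: "b \<in> B" "q \<in> B" using arc_from_to_ends[OF B(1)] by auto
  have bX: "b \<notin> X" "q \<notin> X" "b \<in> W" "q \<in> C" using bq B by blast+
  have seg: "closed_segment w b \<subseteq> W" using w(5) bX by blast
  have wb: "w \<noteq> b" using w(1) bX by blast
  have "closed_segment w b \<inter> B = {b}" using seg B(3) by auto
  then have c1: "arc_from_to (closed_segment w b \<union> B) w q" using arc_from_to_join[OF arc_from_to_segment[OF wb] B(1)] by blast
  define cc where "cc = L \<union> (closed_segment w b \<union> B)"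
  have "L \<inter> closed_segment w b = {w}" using seg LW by auto
  moreover have "L \<inter> B = {}" using L(2) B(2) by blast
  ultimately have "L \<inter> (closed_segment w b \<union> B) = {w}" by blast
  then have cc: "arc_from_to cc d q" unfolding cc_def using arc_from_to_join[OF arc_from_to_sym[OF d(3)] c1] by blast
  have ccC: "cc \<inter> C = {d, q}"
  proof -
    have "closed_segment w b \<inter> C = {}" using seg CW by blast
    then show ?thesis unfolding cc_def Int_Un_distrib2 LC B(4) by auto
  qed
  have wd: "w \<noteq> d" "w \<noteq> q" using d(1) wS w(1) bX by auto
  have wcc: "w \<in> cc - {d, q}" using wd unfolding cc_def by auto
  have "connected (cc - {d, q})"
  proof -
    have con: "connected ((L - {d}) \<union> ((closed_segment w b \<union> B) - {q}))"
      using connected_Un_at[OF connected_arc_minus_end[OF d(3)] connected_arc_minus_end[OF c1], of w] wd arc_from_to_ends[OF d(3)]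
        arc_from_to_ends[OF c1] by blast
    have "q \<notin> L" using L(2) bX by blast
    moreover have "d \<notin> closed_segment w b \<union> B" using seg dW dX B(2) by blast
    ultimately have "(L - {d}) \<union> ((closed_segment w b \<union> B) - {q}) = cc - {d, q}" unfolding cc_def by auto
    with con show ?thesis by simp
  qed
  moreover have "cc - {d, q} \<subseteq> I \<union> J" using ccC IJ(8) by blast
  ultimately have side: "cc - {d, q} \<subseteq> I \<or> cc - {d, q} \<subseteq> J" using connected_in_one_side[OF _ _ IJ(1,4,7)] by blast
  have qS: "q \<notin> A u n" using bX S(2) by blast
  define R where "R = closed_segment u a \<union> G \<union> closed_segment n a'"
  have Rarc: "arc_from_to R u n"
  proof -
    have "closed_segment u a \<inter> G = {a}" by (rule frame_arcs(3))
    then have 1: "arc_from_to (closed_segment u a \<union> G) u a'" using arc_from_to_join[OF frame_arcs(1) G(1)] by blast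
    have "(closed_segment u a \<union> G) \<inter> closed_segment n a' = {a'}"
      using frame_arcs(4,8) by (simp add: Int_Un_distrib2)
    then show ?thesis unfolding R_def using arc_from_to_join[OF 1 arc_from_to_sym[OF frame_arcs(2)]] by blast
  qed
  have SR: "A u n \<inter> R = {u, n}" unfolding R_def Int_Un_distrib using frame_arcs(5,6,7) by (simp add: insert_commute)
  have CR: "C = A u n \<union> R" unfolding R_def by blast
  have "q \<in> R" "q \<noteq> u" "q \<noteq> n" using bX qS CR S by blast+
  then obtain R1 R2 where R: "arc_from_to R1 u q" "arc_from_to R2 q n" "R = R1 \<union> R2" "R1 \<inter> R2 = {q}"
    using arc_from_to_split[OF Rarc] by metis
  obtain S1 S2 where S12: "arc_from_to S1 u d" "arc_from_to S2 d n" "A u n = S1 \<union> S2" "S1 \<inter> S2 = {d}"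
    using arc_from_to_split[OF S(1) d(1) du dn] by metis
  note e = arc_from_to_ends[OF R(1)] arc_from_to_ends[OF R(2)] arc_from_to_ends[OF S12(1)] arc_from_to_ends[OF S12(2)]
  have nR1: "n \<notin> R1" "u \<notin> R2" "n \<notin> S1" "u \<notin> S2" using e R(4) S12(4) by (metis IntI singletonD)+
  have cross: "S1 \<inter> R1 = {u}" "S1 \<inter> R2 = {}" "S2 \<inter> R1 = {}" "S2 \<inter> R2 = {n}"
  proof -
    have "x = u \<or> x = n" if "x \<in> S1 \<union> S2" "x \<in> R1 \<union> R2" for x using that SR R(3) S12(3) by blast
    then show "S1 \<inter> R1 = {u}" "S1 \<inter> R2 = {}" "S2 \<inter> R1 = {}" "S2 \<inter> R2 = {n}" using nR1 e by blast+
  qed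
  have C1: "arc_from_to (S1 \<union> R1) d q" using arc_from_to_join[OF arc_from_to_sym[OF S12(1)] R(1) cross(1)] .
  have C2: "arc_from_to (S2 \<union> R2) d q" using arc_from_to_join[OF S12(2) arc_from_to_sym[OF R(2)] cross(4)] .
  have C12: "(S1 \<union> R1) \<inter> (S2 \<union> R2) = {d, q}"
    unfolding Int_Un_distrib Int_Un_distrib2 S12(4) R(4) cross Int_commute[of R1 S2] by auto
  have CC: "(S1 \<union> R1) \<union> (S2 \<union> R2) = C" using R(3) S12(3) CR by blast
  have ccC': "cc \<inter> ((S1 \<union> R1) \<union> (S2 \<union> R2)) = {d, q}" unfolding CC by (rule ccC)
  have uC: "u \<in> (S1 \<union> R1) - {d, q}" "n \<in> (S2 \<union> R2) - {d, q}" using e du dn by blast+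
  have FC: "F \<inter> C = {}" using C_X F(2,3) arcm[OF m(1,2)] by blast
  have Fcc: "F \<inter> cc = {}"
  proof -
    have "le m d" using arcm[OF m(1,2)] d(1) unfolding up_def by blast
    then have "L \<subseteq> up {m}" using arcm[OF m(3)] L(1) by blast
    then show ?thesis unfolding cc_def using F(2,3) seg B(2) by blast
  qed
  \<comment> \<open>\<open>F\<close> avoids the theta curve, so it lies in one of the three
    complementary regions. The closure of each region misses one of \<open>w\<close>,
    \<open>n\<close>, \<open>u\<close>, while all three are limits of \<open>F\<close>.\<close>
  have main: False if IJ': "open I'" "open J'" "J' \<noteq> {}" "connected J'" "I' \<inter> J' = {}" "I' \<union> J' = - C" "frontier J' = C"
    and sub: "cc - {d, q} \<subseteq> I'" for I' J'
  proof -
    obtain R1' R2' where R': "open R1'" "open R2'" "R1' \<inter> R2' = {}" "R1' \<union> R2' = I' - cc"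
      "closure R1' \<inter> ((S2 \<union> R2) - {d, q}) = {}" "closure R2' \<inter> ((S1 \<union> R1) - {d, q}) = {}"
      using theta_sides[OF C1 C2 cc C12 ccC' IJ'(1,2,3,4,5) IJ'(6)[folded CC] IJ'(7)[folded CC] sub] by metis
    have sub3: "F \<subseteq> J' \<union> (R1' \<union> R2')" unfolding R'(4) using FC Fcc IJ'(6) by blast
    have dis: "J' \<inter> (R1' \<union> R2') = {}" unfolding R'(4) using IJ'(5) by blast
    have "F \<subseteq> J' \<or> F \<subseteq> R1' \<union> R2'"
      by (rule connected_in_one_side[OF F(1) sub3 IJ'(2) open_Un[OF R'(1,2)] dis])
    then consider "F \<subseteq> J'" | "F \<subseteq> R1'" | "F \<subseteq> R2'"
      using connected_in_one_side[OF F(1) _ R'(1,2,3)] by blast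
    then show False
    proof cases
      case 1
      then have "w \<in> closure J'" using F(6) closure_mono by blast
      moreover have "I' \<inter> closure J' = {}" by (rule closure_disjoint_open[OF IJ'(1,5)])
      ultimately show False using wcc sub by blast
    next
      case 2
      then have "n \<in> closure R1'" using F(5) closure_mono by blast
      then show False using R'(5) uC(2) by blast
    next
      case 3
      then have "u \<in> closure R2'" using F(4) closure_mono by blast
      then show False using R'(6) uC(1) by blast
    qed
  qed
  have JI: "J \<inter> I = {}" "J \<union> I = - C" using IJ(7,8) by auto
  show False using side
  proof
    assume "cc - {d, q} \<subseteq> I"
    then show False by (rule main[OF IJ(1,4,6,5,7,8,10)])
  next
    assume "cc - {d, q} \<subseteq> J"
    then show False by (rule main[OF IJ(4,1,3,2) JI IJ(9)])
  qed
qed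

context planar_dendroid
begin

text \<open>The three endpoints get disjoint thick neighbourhoods. What remains of \<open>X\<close>
  outside these and outside \<open>up {m}\<close> is connected through the root, yet accumulates at
  the first points \<open>u\<close>, \<open>n\<close>, \<open>w\<close> of all three neighbourhoods,
  which \<open>no_third_leg\<close> excludes.\<close>

lemma no_tripod:
  assumes m: "m \<noteq> p" and y: "y1 \<in> E" "y2 \<in> E" "y3 \<in> E" "y1 \<noteq> y2" "y1 \<noteq> y3" "y2 \<noteq> y3"
    and le: "le m y1" "le m y2" "le m y3"
    and cl: "y1 \<in> closure (X - up {m})" "y2 \<in> closure (X - up {m})" "y3 \<in> closure (X - up {m})"
  shows False
proof -
  have yX: "y1 \<in> X" "y2 \<in> X" "y3 \<in> X" using y E_subset by auto
  have inc: "\<not> le y z" if "y \<in> E" "y \<noteq> z" for y z using E_maximal that by blast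
  have ym: "y1 \<noteq> m" "y2 \<noteq> m" "y3 \<noteq> m" using inc[OF y(1,4)] inc[OF y(2) y(4)[symmetric]] inc[OF y(3) y(5)[symmetric]] le by auto
  obtain r12 where r12: "r12 > 0" "thick y1 r12 \<inter> thick y2 r12 = {}" "p \<notin> thick y1 r12" "p \<notin> thick y2 r12"
    using disjoint_thick[OF yX(1,2)] inc y by metis
  obtain r13 where r13: "r13 > 0" "thick y1 r13 \<inter> thick y3 r13 = {}"
    using disjoint_thick[OF yX(1,3)] inc y by metis
  obtain r23 where r23: "r23 > 0" "thick y2 r23 \<inter> thick y3 r23 = {}" "p \<notin> thick y3 r23"
    using disjoint_thick[OF yX(2,3)] inc y by metis
  have "{m} \<inter> up {y} = {}" if "y \<in> E" "y \<noteq> m" for y using inc[OF that] unfolding up_def by simp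
  then obtain s1 s2 s3 where s: "s1 > 0" "m \<notin> thick y1 s1" "s2 > 0" "m \<notin> thick y2 s2" "s3 > 0" "m \<notin> thick y3 s3"
    using thick_avoids[of "{m}" y1] thick_avoids[of "{m}" y2] thick_avoids[of "{m}" y3] y ym yX
    by (metis Int_insert_left_if1 compact_insert compact_empty insert_not_empty)
  \<comment> \<open>Small enough for the three thick sets to be pairwise disjoint and to contain
    neither \<open>p\<close> nor \<open>m\<close>.\<close>
  define \<rho> where "\<rho> = min r12 (min r13 (min r23 (min s1 (min s2 s3))))"
  have \<rho>: "\<rho> > 0" "\<rho> \<le> r12" "\<rho> \<le> r13" "\<rho> \<le> r23" "\<rho> \<le> s1" "\<rho> \<le> s2" "\<rho> \<le> s3"
    unfolding \<rho>_def using r12(1) r13(1) r23(1) s(1,3,5) by linarith+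
  define U V where "U = thick y1 \<rho>" and "V = thick y2 \<rho>"
  have dis: "thick y1 \<rho> \<inter> thick y2 \<rho> = {}" "p \<notin> thick y1 \<rho>" "p \<notin> thick y2 \<rho>"
    using r12 thick_mono[OF \<rho>(2)] by blast+
  obtain u n a a' G I J where fr: "dendroid_frame X p f (thick y1 \<rho>) (thick y2 \<rho>) u n a a' G I J"
    and u: "le u y1" "\<And>z. z \<in> thick y1 \<rho> \<Longrightarrow> le z y1 \<Longrightarrow> le u z"
    and n: "le n y2" "\<And>z. z \<in> thick y2 \<rho> \<Longrightarrow> le z y2 \<Longrightarrow> le n z"
    using frame_exists[OF yX(1,2) \<rho>(1) \<rho>(1) dis] by metis
  interpret F: dendroid_frame X p f "thick y1 \<rho>" "thick y2 \<rho>" u n a a' G I J by (rule fr)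
  have "y3 \<notin> G" using yX(3) F.G(2) by blast
  then have "y3 \<in> - G" "open (- G)" using arc_from_to_closed[OF F.G(1)] by auto
  then obtain g where g: "g > 0" "cball y3 g \<subseteq> - G" using open_contains_cball by blast
  \<comment> \<open>The third neighbourhood also has to avoid \<open>G\<close>, which is available
    only after the frame for the first two has been chosen.\<close>
  define \<sigma> where "\<sigma> = min \<rho> g"
  have \<sigma>: "\<sigma> > 0" "\<sigma> \<le> \<rho>" "\<sigma> \<le> g" unfolding \<sigma>_def using \<rho>(1) g(1) by auto
  define W where "W = thick y3 \<sigma>"
  have W3: "W \<subseteq> thick y3 \<rho>" unfolding W_def by (rule thick_mono[OF \<sigma>(2)])
  have WU: "W \<inter> thick y1 \<rho> = {}" using W3 r13(2) thick_mono[OF \<rho>(3)] by blast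
  have WV: "W \<inter> thick y2 \<rho> = {}" using W3 r23(2) thick_mono[OF \<rho>(4)] by blast
  have Wp: "p \<notin> thick y3 \<sigma>" using W3 r23(3) thick_mono[OF \<rho>(4)] unfolding W_def by blast
  have WG: "W \<inter> G = {}"
  proof -
    have "cball y3 \<sigma> \<subseteq> cball y3 g" using \<sigma>(3) by (rule subset_cball)
    then show ?thesis unfolding W_def thick_def using g(2) up_subset F.G(2) by blast
  qed
  obtain w where w: "w \<in> X" "w \<in> cball y3 \<sigma>" "le w y3" "\<And>z. z \<in> thick y3 \<sigma> \<Longrightarrow> le z y3 \<Longrightarrow> le w z"
    using first_point[OF yX(3) \<sigma>(1) Wp] by metis
  have wW: "w \<in> W" unfolding W_def using w(2) cball_subset_thick by blast
  obtain b0 where b0: "b0 \<in> cball y3 \<sigma>" "b0 \<notin> X" using point_near[OF yX(3) \<sigma>(1)] by metis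
  have b0W: "b0 \<in> W" unfolding W_def using b0 cball_subset_thick by blast
  have W: "compact W" "\<And>x y. x \<in> W \<Longrightarrow> le x y \<Longrightarrow> y \<in> W" unfolding W_def by (auto simp: compact_thick thick_up)
  have wseg: "closed_segment w b \<subseteq> W" if "b \<in> W" "b \<notin> X" for b
  proof -
    have "b \<in> cball y3 \<sigma>" using that thick_minus_X unfolding W_def by blast
    then have "closed_segment w b \<subseteq> cball y3 \<sigma>" by (rule closed_segment_subset[OF w(2) _ convex_cball])
    then show ?thesis unfolding W_def using cball_subset_thick by blast
  qed
  have w_only: "z = w" if "z \<in> W" "le z w" for z
    using w(4)[of z] le_trans[OF that(2) w(3)] that le_antisym unfolding W_def by blast
  have mT: "m \<notin> thick y1 \<rho>" "m \<notin> thick y2 \<rho>" "m \<notin> W"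
    using s thick_mono[OF \<rho>(5)] thick_mono[OF \<rho>(6)] thick_mono[OF \<rho>(7)] W3 by blast+
  have mle: "le m u" "le m n" "le m w"
  proof -
    have "le m v" if "le v y" "le m y" "v \<in> H" "m \<notin> H" "\<And>x z. x \<in> H \<Longrightarrow> le x z \<Longrightarrow> z \<in> H" for v y H
      using le_linear[OF that(1,2)] that(3,4,5) by blast
    then show "le m u" "le m n" "le m w"
      using u(1) n(1) w(3) le mT F.frame_points(1,2) wW F.U_up F.V_up W(2) by metis+
  qed
  define TH where "TH = thick y1 \<rho> \<union> thick y2 \<rho> \<union> W"
  have TH: "closed TH" unfolding TH_def using W(1) compact_thick compact_imp_closed by blast
  have TH_up: "z \<in> TH" if "x \<in> TH" "le x z" for x z
    using that F.U_up F.V_up W(2) unfolding TH_def by blast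
  define F where "F = X - (up {m} \<union> TH)"
  have pF: "p \<in> F"
  proof -
    have "p \<notin> up {m}" using m p_le leD[OF le(1)] le_antisym unfolding up_def by blast
    then show ?thesis unfolding F_def TH_def using p dis(2,3) Wp unfolding W_def by blast
  qed
  have "connected F"
  proof -
    have sub: "A p x \<subseteq> F" if "x \<in> F" for x
    proof
      fix z assume z: "z \<in> A p x"
      have xX: "x \<in> X" using that unfolding F_def by blast
      have zx: "le z x" using z xX unfolding le_def by blast
      have "z \<notin> up {m}" using that up_closed[OF _ zx] unfolding F_def by blast
      moreover have "z \<notin> TH" using that TH_up[OF _ zx] unfolding F_def by blast
      ultimately show "z \<in> F" unfolding F_def using A_in[OF p xX z] by blast
    qed
    have FX: "x \<in> X" if "x \<in> F" for x using that unfolding F_def by blast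
    have "F = \<Union> (A p ` F)" using sub A_ends[OF p] FX by blast
    moreover have "connected (\<Union> (A p ` F))"
      by (rule connected_Union) (use A_connected[OF p] A_ends[OF p] FX in blast)+
    ultimately show ?thesis by simp
  qed
  \<comment> \<open>Just below \<open>v\<close> on \<open>A m v\<close> there are points outside
    \<open>TH\<close>. Being below \<open>y\<close> they are limits of points outside
    \<open>up {m}\<close>, and since \<open>TH\<close> is closed such points can be found in
    \<open>F\<close>.\<close>
  have approach: "v \<in> closure F"
    if v: "le v y" "le m v" "v \<noteq> m" "y \<in> closure (X - up {m})" "\<And>z. z \<in> TH \<Longrightarrow> le z v \<Longrightarrow> z = v" for v y
  proof -
    have mv: "m \<in> X" "v \<in> X" using leD[OF v(2)] by auto
    have "v islimpt A m v"
      by (rule connected_imp_perfect[OF A_connected[OF mv]]) (use A_ends[OF mv] v(3) in auto)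
    have "\<exists>z\<in>F. dist z v < e" if "e > 0" for e
    proof -
      obtain x where x: "x \<in> A m v" "x \<noteq> v" "dist x v < e"
        using \<open>v islimpt A m v\<close> \<open>e > 0\<close> unfolding islimpt_approachable by blast
      have xv: "le x v" using A_le_iff[OF v(2)] x(1) by blast
      then have "x \<in> - TH" using v(5) x(2) by blast
      then have "x \<in> ball v e \<inter> - TH" using x(3) by (simp add: dist_commute)
      moreover have "open (ball v e \<inter> - TH)" using TH by blast
      moreover have "x \<in> closure (X - up {m})" using upward_closure[OF v(4) le_trans[OF xv v(1)]] .
      ultimately have "(ball v e \<inter> - TH) \<inter> (X - up {m}) \<noteq> {}" by (metis IntI empty_iff open_Int_closure_eq_empty)
      then show ?thesis unfolding F_def by (auto simp: dist_commute)
    qed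
    then show ?thesis unfolding closure_approachable by blast
  qed
  have only: "z = v" if "z \<in> TH" "le z v" "le v y" "v \<in> K" "K \<in> {thick y1 \<rho>, thick y2 \<rho>, W}" "\<And>z. z \<in> K \<Longrightarrow> le z y \<Longrightarrow> le v z" for z v y K
  proof -
    have "z \<in> K"
    proof (rule ccontr)
      assume "z \<notin> K"
      have "\<exists>K'\<in>{thick y1 \<rho>, thick y2 \<rho>, W}. z \<in> K'" using that(1) unfolding TH_def by simp
      then obtain K' where K': "K' \<in> {thick y1 \<rho>, thick y2 \<rho>, W}" "z \<in> K'" by (rule bexE)
      have "K' \<noteq> K" using K'(2) \<open>z \<notin> K\<close> by blast
      have "v \<in> K'" using K' F.U_up[OF _ that(2)] F.V_up[OF _ that(2)] W(2)[OF _ that(2)] by auto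
      then show False using K'(1) \<open>K' \<noteq> K\<close> that(4,5) dis(1) WU WV by blast
    qed
    then have "le v z" using that(6) le_trans[OF that(2,3)] by blast
    then show ?thesis using le_antisym that(2) by blast
  qed
  have ucl: "u \<in> closure F" using approach[OF u(1) mle(1) _ cl(1)] only[OF _ _ u(1) F.frame_points(1) _ u(2)] F.frame_points(1) mT(1) by blast
  have ncl: "n \<in> closure F" using approach[OF n(1) mle(2) _ cl(2)] only[OF _ _ n(1) F.frame_points(2) _ n(2)] F.frame_points(2) mT(2) by blast
  have wcl: "w \<in> closure F" using approach[OF w(3) mle(3) _ cl(3)] only[OF _ _ w(3) wW _ w(4)[folded W_def]] wW mT(3) by blast
  have FX: "F \<subseteq> X - up {m}" "F \<inter> (thick y1 \<rho> \<union> thick y2 \<rho> \<union> W) = {}" unfolding F_def TH_def by auto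
  show False
    by (rule F.no_third_leg[OF W WU WV WG w(1) wW b0W b0(2) wseg w_only mle \<open>connected F\<close> FX ucl ncl wcl])
qed

lemma finite_tripod:
  assumes "m \<noteq> p"
  shows "finite {y \<in> E. le m y \<and> y \<in> closure (X - up {m})}" (is "finite ?Y")
proof (rule ccontr)
  assume "infinite ?Y"
  from infinite_arbitrarily_large[OF this, of 3] obtain B where B: "card B = 3" "B \<subseteq> ?Y" by (elim exE conjE)
  then obtain x y z where "B = {x, y, z}" "x \<noteq> y" "x \<noteq> z" "y \<noteq> z" by (auto simp: card_3_iff)
  then show False using no_tripod[OF assms, of x y z] B(2) by blast
qed

end

subsection \<open>Cantor schemes\<close>

lemma compact_UNIV_Cantor: "compact (UNIV :: (nat \<Rightarrow> bool) set)"
proof -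
  have "compact_space (euclidean :: bool topology)"
    unfolding compact_space_def by (simp add: finite_imp_compact)
  then have "compact_space (product_topology (\<lambda>i::nat. euclidean :: bool topology) UNIV)"
    unfolding compact_space_product_topology by blast
  then show ?thesis unfolding euclidean_product_topology compact_space_def by simp
qed

text \<open>Discard all open sets that meet \<open>Y\<close> in a countable set. By Lindelof this
  removes only countably many points of \<open>Y\<close>, and all others are condensation
  points.\<close>

lemma two_condensation_points:
  fixes Y :: "'a::second_countable_topology set"
  assumes "uncountable Y"
  obtains y z where "y \<in> Y" "z \<in> Y" "y \<noteq> z" "\<And>U. open U \<Longrightarrow> y \<in> U \<Longrightarrow> uncountable (U \<inter> Y)"
    "\<And>U. open U \<Longrightarrow> z \<in> U \<Longrightarrow> uncountable (U \<inter> Y)"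
proof -
  define \<F> where "\<F> = {U. open U \<and> countable (U \<inter> Y)}"
  obtain \<F>' where F: "\<F>' \<subseteq> \<F>" "countable \<F>'" "\<Union>\<F>' = \<Union>\<F>"
    using Lindelof_openin[of \<F> UNIV] unfolding \<F>_def by (auto simp: subtopology_UNIV)
  have "countable (\<Union>U\<in>\<F>'. U \<inter> Y)" using F unfolding \<F>_def by (intro countable_UN) auto
  moreover have "(\<Union>U\<in>\<F>'. U \<inter> Y) = \<Union>\<F> \<inter> Y" using F(3) by blast
  ultimately have "countable (\<Union>\<F> \<inter> Y)" by simp
  moreover have "Y = (\<Union>\<F> \<inter> Y) \<union> (Y - \<Union>\<F>)" by blast
  ultimately have "uncountable (Y - \<Union>\<F>)" using assms countable_Un by metis
  then have "infinite (Y - \<Union>\<F>)" using countable_finite by blast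
  then obtain y where y: "y \<in> Y - \<Union>\<F>" by (metis all_not_in_conv finite.emptyI)
  have "infinite (Y - \<Union>\<F> - {y})" using \<open>infinite (Y - \<Union>\<F>)\<close> by simp
  then obtain z where z: "z \<in> Y - \<Union>\<F> - {y}" by (metis all_not_in_conv finite.emptyI)
  have cond: "uncountable (U \<inter> Y)" if "open U" "w \<in> U" "w \<notin> \<Union>\<F>" for U w
    using that unfolding \<F>_def by blast
  show thesis
  proof (rule that[of y z])
    show "y \<in> Y" "z \<in> Y" "y \<noteq> z" using y z by auto
    show "uncountable (U \<inter> Y)" if "open U" "y \<in> U" for U using cond[OF that] y by blast
    show "uncountable (U \<inter> Y)" if "open U" "z \<in> U" for U using cond[OF that] z by blast
  qed
qed

lemma shrink_uncountable_image:
  fixes h :: "'a::euclidean_space \<Rightarrow> 'b"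
  assumes "compact B" "uncountable (h ` B)" "e > 0"
  obtains B' where "compact B'" "B' \<subseteq> B" "uncountable (h ` B')" "\<And>x y. x \<in> B' \<Longrightarrow> y \<in> B' \<Longrightarrow> dist x y < e"
proof -
  have "e / 3 > 0" using assms(3) by simp
  then obtain k where k: "finite k" "B \<subseteq> (\<Union>x\<in>k. ball x (e / 3))"
    using assms(1) unfolding compact_eq_totally_bounded by blast
  have "B \<subseteq> (\<Union>x\<in>k. B \<inter> cball x (e / 3))" 
  proof
    fix y assume "y \<in> B"
    then obtain x where "x \<in> k" "y \<in> ball x (e / 3)" using k(2) by blast
    then show "y \<in> (\<Union>x\<in>k. B \<inter> cball x (e / 3))" using \<open>y \<in> B\<close> by (intro UN_I[of x]) auto
  qed
  then have "h ` B \<subseteq> (\<Union>x\<in>k. h ` (B \<inter> cball x (e / 3)))" by blast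
  then have "\<not> (\<forall>x\<in>k. countable (h ` (B \<inter> cball x (e / 3))))"
    using assms(2) countable_UN[OF countable_finite[OF k(1)]] countable_subset by metis
  then obtain x where x: "uncountable (h ` (B \<inter> cball x (e / 3)))" by blast
  show thesis
  proof (rule that[OF _ _ x])
    fix y z assume "y \<in> B \<inter> cball x (e / 3)" "z \<in> B \<inter> cball x (e / 3)"
    then have "dist x y \<le> e / 3" "dist x z \<le> e / 3" by auto
    then show "dist y z < e" using dist_triangle3[of y z x] assms(3) by linarith
  qed (use assms(1) in \<open>auto simp: compact_Int\<close>)
qed

text \<open>Two condensation points of the image have disjoint closed balls. Each ball contains
  uncountably many values, and uncountably many of them are already taken on a piece of
  \<open>B\<close> of small diameter.\<close>

lemma split_uncountable_image:
  fixes h :: "'a::euclidean_space \<Rightarrow> 'b::euclidean_space"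
  assumes "compact B" "continuous_on B h" "uncountable (h ` B)" "e > 0"
  shows "\<exists>B0 B1. compact B0 \<and> compact B1 \<and> B0 \<subseteq> B \<and> B1 \<subseteq> B \<and> uncountable (h ` B0) \<and> uncountable (h ` B1) \<and>
    h ` B0 \<inter> h ` B1 = {} \<and> (\<forall>x\<in>B0. \<forall>y\<in>B0. dist x y < e) \<and> (\<forall>x\<in>B1. \<forall>y\<in>B1. dist x y < e)"
proof -
  obtain y z where yz: "y \<noteq> z" "\<And>U. open U \<Longrightarrow> y \<in> U \<Longrightarrow> uncountable (U \<inter> h ` B)"
    "\<And>U. open U \<Longrightarrow> z \<in> U \<Longrightarrow> uncountable (U \<inter> h ` B)"
    using two_condensation_points[OF assms(3)] by metis
  define d where "d = dist y z / 3"
  have d: "d > 0" "cball y d \<inter> cball z d = {}"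
  proof -
    show "d > 0" unfolding d_def using yz(1) by simp
    show "cball y d \<inter> cball z d = {}"
    proof (rule ccontr)
      assume "cball y d \<inter> cball z d \<noteq> {}"
      then obtain x where "dist y x \<le> d" "dist z x \<le> d" by auto
      then have "dist y z \<le> 2 * d" using dist_triangle2[of y z x] by linarith
      then show False using \<open>d > 0\<close> unfolding d_def by simp
    qed
  qed
  have piece: "\<exists>B'. compact B' \<and> B' \<subseteq> B \<and> h ` B' \<subseteq> cball w d \<and> uncountable (h ` B') \<and> (\<forall>x\<in>B'. \<forall>y\<in>B'. dist x y < e)"
    if "\<And>U. open U \<Longrightarrow> w \<in> U \<Longrightarrow> uncountable (U \<inter> h ` B)" for w
  proof -
    have unc: "uncountable (ball w d \<inter> h ` B)" using that d(1) by simp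
    define B1 where "B1 = B \<inter> h -` cball w d"
    have "closed B1" unfolding B1_def using continuous_closed_preimage[OF assms(2)] assms(1) compact_imp_closed by blast
    moreover have "B1 = B \<inter> B1" unfolding B1_def by blast
    ultimately have "compact B1" using compact_Int_closed[OF assms(1)] by metis
    moreover have "ball w d \<inter> h ` B \<subseteq> h ` B1" unfolding B1_def using ball_subset_cball by blast
    then have "uncountable (h ` B1)" using unc countable_subset by blast
    ultimately obtain B' where "compact B'" "B' \<subseteq> B1" "uncountable (h ` B')" "\<And>x y. x \<in> B' \<Longrightarrow> y \<in> B' \<Longrightarrow> dist x y < e"
      using shrink_uncountable_image[of B1 h e] assms(4) by metis
    then show ?thesis unfolding B1_def by (intro exI[of _ B']) auto
  qed
  obtain B0 where 0: "compact B0" "B0 \<subseteq> B" "h ` B0 \<subseteq> cball y d" "uncountable (h ` B0)" "\<forall>x\<in>B0. \<forall>y\<in>B0. dist x y < e"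
    using piece[of y, OF yz(2)] by metis
  obtain B1 where 1: "compact B1" "B1 \<subseteq> B" "h ` B1 \<subseteq> cball z d" "uncountable (h ` B1)" "\<forall>x\<in>B1. \<forall>y\<in>B1. dist x y < e"
    using piece[of z, OF yz(3)] by metis
  have "h ` B0 \<inter> h ` B1 = {}" using 0(3) 1(3) d(2) by blast
  then show ?thesis using 0 1 by (intro exI[of _ B0] exI[of _ B1]) simp
qed

text \<open>The halves are separated by their images under \<open>h\<close>, which makes
  \<open>h \<circ> g\<close> and not merely \<open>g\<close> injective; the shrinking diameters make
  \<open>g\<close> continuous.\<close>

lemma Cantor_scheme:
  fixes h :: "'a::euclidean_space \<Rightarrow> 'b::euclidean_space"
  assumes K: "compact K" "continuous_on K h" "uncountable (h ` K)"
  obtains g :: "(nat \<Rightarrow> bool) \<Rightarrow> 'a" where "continuous_on UNIV g" "range g \<subseteq> K" "inj (h \<circ> g)"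
proof -
  define good where "good B n B0 B1 \<longleftrightarrow> compact B0 \<and> compact B1 \<and> B0 \<subseteq> B \<and> B1 \<subseteq> B \<and> uncountable (h ` B0) \<and> uncountable (h ` B1) \<and>
    h ` B0 \<inter> h ` B1 = {} \<and> (\<forall>x\<in>B0. \<forall>y\<in>B0. dist x y < inverse (real (Suc n))) \<and> (\<forall>x\<in>B1. \<forall>y\<in>B1. dist x y < inverse (real (Suc n)))"
    for B B0 B1 and n :: nat
  have "\<exists>B0 B1. good B n B0 B1" if "compact B" "B \<subseteq> K" "uncountable (h ` B)" for B n
    unfolding good_def using split_uncountable_image[OF that(1) continuous_on_subset[OF K(2) that(2)] that(3)] by simp
  then obtain s0 s1 where s: "\<And>B n. compact B \<Longrightarrow> B \<subseteq> K \<Longrightarrow> uncountable (h ` B) \<Longrightarrow> good B n (s0 B n) (s1 B n)"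
    by metis
  define D where "D = rec_list K (\<lambda>b l B. if b then s1 B (length l) else s0 B (length l))"
  have D_Nil: "D [] = K" and D_Cons: "\<And>b l. D (b # l) = (if b then s1 (D l) (length l) else s0 (D l) (length l))"
    unfolding D_def by auto
  have D: "compact (D l) \<and> D l \<subseteq> K \<and> uncountable (h ` D l)" for l
  proof (induction l)
    case Nil
    then show ?case using K D_Nil by simp
  next
    case (Cons b l)
    then have "good (D l) (length l) (s0 (D l) (length l)) (s1 (D l) (length l))" using s by blast
    then show ?case using Cons unfolding D_Cons good_def by auto
  qed
  have good: "good (D l) (length l) (D (False # l)) (D (True # l))" for l
    using s[of "D l" "length l"] D[of l] unfolding D_Cons by simp
  have dis: "h ` D (b # l) \<inter> h ` D (b' # l) = {}" if "b \<noteq> b'" for b b' l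
    using good[of l] that unfolding good_def by (cases b; cases b') auto
  have diam: "dist x y < inverse (real (Suc (length l)))" if "x \<in> D (b # l)" "y \<in> D (b # l)" for x y b l
    using good[of l] that unfolding good_def by (cases b) auto
  have sub: "D (b # l) \<subseteq> D l" for b l using good[of l] unfolding good_def by (cases b) auto
  \<comment> \<open>The first \<open>n\<close> bits in reverse order: in the words that index
    \<open>D\<close> the latest bit stands at the head.\<close>
  define pre where "pre \<sigma> n = rec_nat [] (\<lambda>i l. \<sigma> i # l) n" for \<sigma> :: "nat \<Rightarrow> bool" and n
  have pre: "pre \<sigma> 0 = []" "pre \<sigma> (Suc n) = \<sigma> n # pre \<sigma> n" for \<sigma> n unfolding pre_def by auto
  have len: "length (pre \<sigma> n) = n" for \<sigma> n by (induction n) (auto simp: pre)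
  have pre_eq: "pre \<sigma> n = pre \<tau> n" if "\<And>i. i < n \<Longrightarrow> \<sigma> i = \<tau> i" for \<sigma> \<tau> n
    using that by (induction n) (auto simp: pre)
  have "\<exists>x. \<forall>n. x \<in> D (pre \<sigma> n)" for \<sigma>
  proof -
    have "D (pre \<sigma> n) \<subseteq> D (pre \<sigma> m)" if "m \<le> n" for m n
      using that by (induction rule: dec_induct) (use sub in \<open>auto simp: pre\<close>)
    moreover have "D (pre \<sigma> n) \<noteq> {}" for n using D[of "pre \<sigma> n"] by auto
    ultimately have "\<Inter> (range (\<lambda>n. D (pre \<sigma> n))) \<noteq> {}" using D by (intro compact_nest) auto
    then show ?thesis by blast
  qed
  then obtain g where g: "\<And>\<sigma> n. g \<sigma> \<in> D (pre \<sigma> n)" by metis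
  show thesis
  proof (rule that[of g])
    show "range g \<subseteq> K" using g[of _ 0] unfolding pre D_Nil by blast
    show "inj (h \<circ> g)"
    proof (rule injI, rule ccontr)
      fix \<sigma> \<tau> assume eq: "(h \<circ> g) \<sigma> = (h \<circ> g) \<tau>" and "\<sigma> \<noteq> \<tau>"
      define n where "n = (LEAST n. \<sigma> n \<noteq> \<tau> n)"
      have n: "\<sigma> n \<noteq> \<tau> n" 
      proof -
        have "\<exists>n. \<sigma> n \<noteq> \<tau> n" using \<open>\<sigma> \<noteq> \<tau>\<close> by (simp add: fun_eq_iff)
        then show ?thesis unfolding n_def by (rule LeastI_ex)
      qed
      have "pre \<sigma> n = pre \<tau> n" by (rule pre_eq) (use not_less_Least n_def in blast)
      then have "g \<sigma> \<in> D (\<sigma> n # pre \<sigma> n)" "g \<tau> \<in> D (\<tau> n # pre \<sigma> n)"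
        using g[of \<sigma> "Suc n"] g[of \<tau> "Suc n"] unfolding pre by auto
      then show False using dis[OF n, of "pre \<sigma> n"] eq by auto
    qed
    show "continuous_on UNIV g"
      unfolding continuous_on_def
    proof
      fix \<sigma> :: "nat \<Rightarrow> bool"
      show "g \<midarrow>\<sigma>\<rightarrow> g \<sigma>"
      proof (rule tendstoI)
        fix e :: real assume "e > 0"
        then obtain n where n: "inverse (real (Suc n)) < e" using reals_Archimedean by blast
        define W :: "(nat \<Rightarrow> bool) set" where "W = (\<Inter>i\<in>{..n}. (\<lambda>\<tau>. \<tau> i) -` {\<sigma> i})"
        have "open W" unfolding W_def
          by (intro open_INT ballI open_vimage) (auto simp: open_discrete)
        moreover have "\<sigma> \<in> W" unfolding W_def by simp
        moreover have "dist (g \<tau>) (g \<sigma>) < e" if "\<tau> \<in> W" for \<tau>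
        proof -
          have "\<tau> i = \<sigma> i" if "i < Suc n" for i using \<open>\<tau> \<in> W\<close> that unfolding W_def by auto
          then have "pre \<tau> (Suc n) = pre \<sigma> (Suc n)" by (rule pre_eq)
          then have "g \<tau> \<in> D (\<sigma> n # pre \<sigma> n)" "g \<sigma> \<in> D (\<sigma> n # pre \<sigma> n)"
            using g[of \<tau> "Suc n"] g[of \<sigma> "Suc n"] unfolding pre by auto
          then have "dist (g \<tau>) (g \<sigma>) < inverse (real (Suc (length (pre \<sigma> n))))" by (rule diam)
          then show ?thesis using n unfolding len by simp
        qed
        ultimately show "\<forall>\<^sub>F \<tau> in at \<sigma>. dist (g \<tau>) (g \<sigma>) < e"
          unfolding eventually_at_topological by blast
      qed
    qed
  qed
qed

text \<open>The scheme is applied to the identity on the unit interval; a continuous injection of a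
  compact space is a homeomorphism onto its image.\<close>

lemma Cantor_set_of_reals:
  obtains \<psi> :: "(nat \<Rightarrow> bool) \<Rightarrow> real" and \<phi> where "homeomorphism UNIV (range \<psi>) \<psi> \<phi>"
proof -
  have "uncountable ((\<lambda>x. x) ` {0..1::real})" using uncountable_closed_interval[of 0 "1::real"] by simp
  then obtain g :: "(nat \<Rightarrow> bool) \<Rightarrow> real" where g: "continuous_on UNIV g" "inj ((\<lambda>x. x) \<circ> g)"
    using Cantor_scheme[of "{0..1::real}" "\<lambda>x. x"] compact_Icc continuous_on_id by metis
  have "inj g" using g(2) by (simp add: comp_def)
  then show thesis using homeomorphism_compact[OF compact_UNIV_Cantor g(1) refl] that by blast
qed

section \<open>A Cantor set of arcs between two levels\<close>

context height_dendroid
begin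

lemma arc_of_r:
  assumes "x \<in> X" "f p \<le> s" "s \<le> f x"
  shows "A (r s x) x = (\<lambda>v. r v x) ` {s..f x}"
proof
  note rs = r[OF assms]
  show "A (r s x) x \<subseteq> (\<lambda>v. r v x) ` {s..f x}"
  proof
    fix z assume "z \<in> A (r s x) x"
    then have z: "le (r s x) z" "le z x" using A_le_iff[OF rs(1)] by auto
    then have "r (f z) x = z" "s \<le> f z" "f z \<le> f x" using r_eqI[OF z(2)] mono_f[OF z(1)] mono_f[OF z(2)] rs(2) by auto
    then show "z \<in> (\<lambda>v. r v x) ` {s..f x}" by force
  qed
  show "(\<lambda>v. r v x) ` {s..f x} \<subseteq> A (r s x) x"
  proof
    fix z assume "z \<in> (\<lambda>v. r v x) ` {s..f x}"
    then obtain v where v: "z = r v x" "s \<le> v" "v \<le> f x" by auto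
    have "f p \<le> v" using v assms by simp
    note rv = r[OF assms(1) this v(3)]
    have "le (r s x) (r v x)" using le_of_height[OF rs(1) rv(1)] rs(2) rv(2) v(2) by simp
    then show "z \<in> A (r s x) x" using A_le_iff[OF rs(1)] rv(1) v(1) by simp
  qed
qed

text \<open>All arcs between the levels \<open>s\<close> and \<open>t\<close> are parametrized by
  height over the same interval, so uniform continuity of \<open>r v x\<close> on a compact product
  bounds their distance.\<close>

lemma arcs_close:
  assumes "f p \<le> s" "s \<le> t" "e > 0"
  obtains d where "d > 0" "\<And>x y. x \<in> X \<Longrightarrow> y \<in> X \<Longrightarrow> f x = t \<Longrightarrow> f y = t \<Longrightarrow> dist x y < d \<Longrightarrow>
    hausdorff_dist (A (r s x) x) (A (r s y) y) \<le> e"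
proof -
  define K where "K = {x \<in> X. f x = t}"
  have "K = {x \<in> X. t \<le> f x} \<inter> {x \<in> X. f x \<in> {..t}}" unfolding K_def by auto
  moreover have "closed {x \<in> X. f x \<in> {..t}}"
    using continuous_closed_preimage[OF cont_f closed_X closed_atMost] by (simp add: vimage_def Int_def)
  ultimately have K: "compact K" using compact_Int_closed[OF compact_ge] by metis
  have KX: "x \<in> X" "f x = t" if "x \<in> K" for x using that unfolding K_def by auto
  have "continuous_on ({s..t} \<times> K) (\<lambda>(v, x). r v x)"
    unfolding continuous_on_sequentially
  proof (intro allI ballI impI, elim conjE)
    fix u :: "nat \<Rightarrow> real \<times> 'a" and a assume a: "a \<in> {s..t} \<times> K" and u: "\<forall>n. u n \<in> {s..t} \<times> K" "u \<longlonglongrightarrow> a"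
    have "(\<lambda>n. r (fst (u n)) (snd (u n))) \<longlonglongrightarrow> r (fst a) (snd a)"
    proof (rule r_cont)
      show "snd (u n) \<in> X" for n using u(1) KX by (metis mem_Times_iff)
      show "snd a \<in> X" using a KX by (metis mem_Times_iff)
      show "(\<lambda>n. snd (u n)) \<longlonglongrightarrow> snd a" "(\<lambda>n. fst (u n)) \<longlonglongrightarrow> fst a" using u(2) by (auto intro: tendsto_intros)
      have "fst (u n) \<in> {s..t}" "f (snd (u n)) = t" for n using u(1) KX by (metis mem_Times_iff)+
      then show "f p \<le> fst (u n)" "fst (u n) \<le> f (snd (u n))" for n using assms(1) by (auto intro: order_trans)
    qed
    then show "((\<lambda>(v, x). r v x) \<circ> u) \<longlonglongrightarrow> (case a of (v, x) \<Rightarrow> r v x)"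
      by (simp add: case_prod_beta comp_def)
  qed
  moreover have "compact ({s..t} \<times> K)" using K by (intro compact_Times) auto
  ultimately have "uniformly_continuous_on ({s..t} \<times> K) (\<lambda>(v, x). r v x)" by (rule compact_uniformly_continuous)
  then obtain d where d: "d > 0" "\<And>a b. a \<in> {s..t} \<times> K \<Longrightarrow> b \<in> {s..t} \<times> K \<Longrightarrow> dist b a < d \<Longrightarrow>
      dist (case b of (v, x) \<Rightarrow> r v x) (case a of (v, x) \<Rightarrow> r v x) < e"
    using assms(3) unfolding uniformly_continuous_on_def by metis
  have close: "dist (r v x) (r v y) < e" if "x \<in> K" "y \<in> K" "v \<in> {s..t}" "dist x y < d" for v x y
    using d(2)[of "(v, y)" "(v, x)"] that by (simp add: dist_Pair_Pair)
  have arc: "A (r s x) x = (\<lambda>v. r v x) ` {s..t}" if "x \<in> K" for x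
    using arc_of_r[of x s] KX[OF that] assms(1,2) by simp
  show thesis
  proof (rule that[OF d(1)])
    fix x y assume xy: "x \<in> X" "y \<in> X" "f x = t" "f y = t" "dist x y < d"
    then have K: "x \<in> K" "y \<in> K" unfolding K_def by auto
    have "{s..t} \<noteq> {}" using assms(2) by simp
    show "hausdorff_dist (A (r s x) x) (A (r s y) y) \<le> e"
      unfolding arc[OF K(1)] arc[OF K(2)]
    proof (rule hausdorff_dist_le)
      fix a assume "a \<in> (\<lambda>v. r v x) ` {s..t}"
      then obtain v where v: "v \<in> {s..t}" "a = r v x" by blast
      have "infdist a ((\<lambda>v. r v y) ` {s..t}) \<le> dist a (r v y)" by (rule infdist_le) (use v in blast)
      then show "infdist a ((\<lambda>v. r v y) ` {s..t}) \<le> e" using close[OF K v(1) xy(5)] v(2) by simp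
    next
      fix a assume "a \<in> (\<lambda>v. r v y) ` {s..t}"
      then obtain v where v: "v \<in> {s..t}" "a = r v y" by blast
      have "infdist a ((\<lambda>v. r v x) ` {s..t}) \<le> dist a (r v x)" by (rule infdist_le) (use v in blast)
      then show "infdist a ((\<lambda>v. r v x) ` {s..t}) \<le> e" using close[OF K v(1) xy(5)] v(2) by (simp add: dist_commute)
    qed (use \<open>{s..t} \<noteq> {}\<close> in simp_all)
  qed
qed

text \<open>The scheme is applied to \<open>r s\<close> on the level \<open>f = t\<close>. A common
  point of two arcs would have the lower ends of both as its predecessor at height \<open>s\<close>,
  so the injectivity of \<open>r s \<circ> g\<close> makes the arcs disjoint.\<close>

lemma Cantor_set_of_arcs_exists:
  assumes st: "f p \<le> s" "s < t" and unc: "uncountable (N s t)"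
  shows "\<exists>\<A>. cantor_set_of_arcs \<A> \<and> \<Union>\<A> \<subseteq> X"
proof -
  define K where "K = {x \<in> X. f x = t}"
  have "K = {x \<in> X. t \<le> f x} \<inter> {x \<in> X. f x \<in> {..t}}" unfolding K_def by auto
  moreover have "closed {x \<in> X. f x \<in> {..t}}"
    using continuous_closed_preimage[OF cont_f closed_X closed_atMost] by (simp add: vimage_def Int_def)
  ultimately have K: "compact K" using compact_Int_closed[OF compact_ge] by metis
  have "continuous_on K (r s)" by (rule continuous_on_subset[OF r_continuous_on[OF st(1)]]) (use st(2) in \<open>auto simp: K_def\<close>)
  \<comment> \<open>A point above height \<open>t\<close> may first be projected to height
    \<open>t\<close>; its predecessor at height \<open>s\<close> stays the same.\<close>
  moreover have "N s t \<subseteq> r s ` K"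
  proof
    fix z assume "z \<in> N s t"
    then obtain x where x: "x \<in> X" "t \<le> f x" "z = r s x" unfolding N_def by blast
    have pt: "f p \<le> t" using st by simp
    have "r t x \<in> K" unfolding K_def using r_in[OF x(1) pt x(2)] r(2)[OF x(1) pt x(2)] by simp
    moreover have "r s (r t x) = z"
      using r_mono[OF r(1)[OF x(1) pt x(2)] st(1)] r(2)[OF x(1) pt x(2)] st(2) x(3) by simp
    ultimately show "z \<in> r s ` K" by blast
  qed
  then have "uncountable (r s ` K)" using unc countable_subset by blast
  ultimately obtain g :: "(nat \<Rightarrow> bool) \<Rightarrow> 'a" where g: "continuous_on UNIV g" "range g \<subseteq> K" "inj (r s \<circ> g)"
    using Cantor_scheme[OF K] by metis
  obtain \<psi> :: "(nat \<Rightarrow> bool) \<Rightarrow> real" and \<phi> where hom: "homeomorphism UNIV (range \<psi>) \<psi> \<phi>"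
    using Cantor_set_of_reals by metis
  define C where "C = range \<psi>"
  define k where "k c = g (\<phi> c)" for c
  have kc: "continuous_on C k" unfolding k_def
    by (rule continuous_on_compose2[OF g(1), of C \<phi>]) (use hom in \<open>auto simp: C_def homeomorphism_def\<close>)
  have kK: "k c \<in> X" "f (k c) = t" for c using g(2) unfolding K_def k_def by auto
  have k_inj: "c = d" if "c \<in> C" "d \<in> C" "r s (k c) = r s (k d)" for c d
  proof -
    have "\<phi> c = \<phi> d" using g(3) that(3) unfolding k_def inj_def by simp
    then show ?thesis using that(1,2) hom unfolding C_def homeomorphism_def by metis
  qed
  define B where "B c = A (r s (k c)) (k c)" for c
  have rk: "le (r s (k c)) (k c)" "f (r s (k c)) = s" for c using r[OF kK(1) st(1)] kK(2) st(2) by auto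
  have "cantor_set C" unfolding cantor_set_def C_def
    using hom homeomorphic_sym homeomorphic_def by blast
  moreover have "is_arc (B c)" for c
  proof -
    have "r s (k c) \<noteq> k c" using rk(2)[of c] kK(2)[of c] st(2) by auto
    then show ?thesis unfolding is_arc_def B_def using the_arc_arc(1)[OF dend, of "r s (k c)" "k c"] leD[OF rk(1)] by blast
  qed
  moreover have "disjoint_family_on B C"
  proof (unfold disjoint_family_on_def, intro ballI impI, rule ccontr)
    fix c d assume cd: "c \<in> C" "d \<in> C" "c \<noteq> d" "B c \<inter> B d \<noteq> {}"
    then obtain z where z: "z \<in> B c" "z \<in> B d" by blast
    have *: "r s z = r s (k c)" if "z \<in> B c" for c
    proof -
      have "le (r s (k c)) z" using that A_le_iff[OF rk(1)] unfolding B_def by blast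
      then show ?thesis using r_eqI rk(2) by blast
    qed
    show False using *[OF z(1)] *[OF z(2)] k_inj cd by metis
  qed
  moreover have "((\<lambda>d. hausdorff_dist (B d) (B c)) \<longlongrightarrow> 0) (at c within C)" if c: "c \<in> C" for c
  proof (rule tendstoI)
    fix e :: real assume "e > 0"
    then have "e / 2 > 0" by simp
    then obtain \<delta> where \<delta>: "\<delta> > 0" "\<And>x y. x \<in> X \<Longrightarrow> y \<in> X \<Longrightarrow> f x = t \<Longrightarrow> f y = t \<Longrightarrow> dist x y < \<delta> \<Longrightarrow>
        hausdorff_dist (A (r s x) x) (A (r s y) y) \<le> e / 2"
      using arcs_close[OF st(1) less_imp_le[OF st(2)]] by metis
    have "(k \<longlongrightarrow> k c) (at c within C)" using kc c unfolding continuous_on_def by blast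
    then have "\<forall>\<^sub>F d in at c within C. dist (k d) (k c) < \<delta>" using \<delta>(1) by (rule tendstoD)
    then show "\<forall>\<^sub>F d in at c within C. dist (hausdorff_dist (B d) (B c)) 0 < e"
    proof (rule eventually_mono)
      fix d assume "dist (k d) (k c) < \<delta>"
      then have "hausdorff_dist (B d) (B c) \<le> e / 2" unfolding B_def using \<delta>(2) kK by blast
      moreover have "0 \<le> hausdorff_dist (B d) (B c)"
        unfolding B_def using leD[OF rk(1)] A_compact A_ends by (intro hausdorff_dist_nonneg) blast+
      ultimately show "dist (hausdorff_dist (B d) (B c)) 0 < e" using \<open>e > 0\<close> by (simp add: dist_real_def)
    qed
  qed
  ultimately have "cantor_set_of_arcs (B ` C)" unfolding cantor_set_of_arcs_def by blast
  moreover have "\<Union> (B ` C) \<subseteq> X" unfolding B_def using A_subset leD[OF rk(1)] by blast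
  ultimately show ?thesis by blast
qed

end

subsection \<open>Zero-dimensionality of the endpoint set\<close>

definition clopen_in :: "'a::topological_space set \<Rightarrow> 'a set \<Rightarrow> bool" where
  "clopen_in E P \<longleftrightarrow> openin (top_of_set E) P \<and> closedin (top_of_set E) P"

lemma clopen_in_subset: "clopen_in E P \<Longrightarrow> P \<subseteq> E"
  unfolding clopen_in_def using openin_imp_subset by blast

lemma clopen_in_self: "clopen_in E E"
  unfolding clopen_in_def by simp

lemma clopen_in_Int: "clopen_in E P \<Longrightarrow> clopen_in E Q \<Longrightarrow> clopen_in E (P \<inter> Q)"
  unfolding clopen_in_def by auto

lemma clopen_in_Diff: "clopen_in E P \<Longrightarrow> clopen_in E Q \<Longrightarrow> clopen_in E (P - Q)"
  unfolding clopen_in_def by (auto intro: openin_diff closedin_diff)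

lemma clopen_in_UN: "finite I \<Longrightarrow> (\<And>i. i \<in> I \<Longrightarrow> clopen_in E (P i)) \<Longrightarrow> clopen_in E (\<Union>i\<in>I. P i)"
  by (induction I rule: finite_induct) (auto simp: clopen_in_def intro: openin_Un closedin_Un)

lemma clopen_in_INT: "finite I \<Longrightarrow> (\<And>i. i \<in> I \<Longrightarrow> clopen_in E (P i)) \<Longrightarrow> clopen_in E (E \<inter> (\<Inter>i\<in>I. P i))"
proof (induction I rule: finite_induct)
  case empty
  then show ?case using clopen_in_self by simp
next
  case (insert i I)
  then have "clopen_in E (E \<inter> (\<Inter>i\<in>I. P i))" "clopen_in E (P i)" by blast+
  then have "clopen_in E ((E \<inter> (\<Inter>i\<in>I. P i)) \<inter> P i)" by (rule clopen_in_Int)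
  moreover have "(E \<inter> (\<Inter>i\<in>I. P i)) \<inter> P i = E \<inter> (\<Inter>i\<in>insert i I. P i)" by auto
  ultimately show ?case by simp
qed

definition zero_dim :: "'a::topological_space set \<Rightarrow> bool" where
  "zero_dim E \<longleftrightarrow> (\<forall>x\<in>E. \<forall>V. open V \<and> x \<in> V \<longrightarrow> (\<exists>P. clopen_in E P \<and> x \<in> P \<and> P \<subseteq> V))"

text \<open>Clopen sets have empty frontier, and the empty space has dimension at most
  \<open>-1\<close>.\<close>

lemma dimension_le_zero:
  assumes "zero_dim E"
  shows "dimension_le (top_of_set E) 0"
proof (rule dimension_le.intros)
  fix V a assume V: "openin (top_of_set E) V" "a \<in> V"
  obtain T where T: "open T" "V = E \<inter> T" using V(1) unfolding openin_open by blast
  obtain P where P: "clopen_in E P" "a \<in> P" "P \<subseteq> T"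
    using assms V(2) T unfolding zero_dim_def by blast
  have "P \<subseteq> E" by (rule clopen_in_subset[OF P(1)])
  moreover have "(top_of_set E) frontier_of P = {}"
    using P(1) \<open>P \<subseteq> E\<close> by (simp add: frontier_of_eq_empty clopen_in_def)
  moreover have "dimension_le (subtopology (top_of_set E) {}) (0 - 1)"
    by (rule dimension_le.intros) auto
  ultimately show "\<exists>W. a \<in> W \<and> W \<subseteq> V \<and> openin (top_of_set E) W \<and>
      dimension_le (subtopology (top_of_set E) ((top_of_set E) frontier_of W)) (0 - 1)"
    using P T(2) unfolding clopen_in_def by (intro exI[of _ P]) auto
qed simp

text \<open>Clopen sets of \<open>E\<close> at positive distance from \<open>p\<close> stay clopen.
  At \<open>p\<close> itself, \<open>E\<close> is partitioned into clopen pieces that get smaller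
  towards \<open>p\<close>; the pieces not contained in \<open>V\<close> keep a positive distance
  from \<open>p\<close>, and removing them leaves a clopen neighbourhood.\<close>

lemma zero_dim_insert:
  fixes E :: "'a::euclidean_space set"
  assumes E: "zero_dim E" and "p \<notin> E"
  shows "zero_dim (insert p E)"
  unfolding zero_dim_def
proof (intro ballI allI impI, elim conjE)
  fix x V assume x: "x \<in> insert p E" and V: "open V" "x \<in> V"
  have oE: "openin (top_of_set (insert p E)) E"
    unfolding openin_open by (rule exI[of _ "- {p}"]) (use assms(2) in auto)
  have up: "openin (top_of_set (insert p E)) Q" if "openin (top_of_set E) Q" for Q
    using openin_trans[OF that oE] .
  have clopen: "clopen_in (insert p E) Q"
    if Q: "openin (top_of_set E) Q" "openin (top_of_set E) (E - Q)" "d > 0" "\<And>z. z \<in> Q \<Longrightarrow> d \<le> dist p z" for Q and d :: real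
  proof -
    have QE: "Q \<subseteq> E" using Q(1) openin_imp_subset by blast
    have "insert p E - Q = (E - Q) \<union> (insert p E \<inter> ball p d)"
      using Q(3,4) assms(2) QE by force
    moreover have "openin (top_of_set (insert p E)) (insert p E \<inter> ball p d)" by (simp add: openin_open_Int)
    ultimately have "openin (top_of_set (insert p E)) (insert p E - Q)" using up[OF Q(2)] openin_Un by metis
    then show ?thesis unfolding clopen_in_def closedin_def using up[OF Q(1)] QE by auto
  qed
  have small: "\<exists>P. clopen_in E P \<and> y \<in> P \<and> P \<subseteq> V" if "y \<in> E" "open V" "y \<in> V" for y V
    using E that unfolding zero_dim_def by blast
  show "\<exists>P. clopen_in (insert p E) P \<and> x \<in> P \<and> P \<subseteq> V"
  proof (cases "x = p")
    case False
    then have xE: "x \<in> E" using x by blast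
    have d: "dist p x / 2 > 0" using False by simp
    have "open (V \<inter> ball x (dist p x / 2))" "x \<in> V \<inter> ball x (dist p x / 2)" using V d by auto
    then obtain P where P: "clopen_in E P" "x \<in> P" "P \<subseteq> V \<inter> ball x (dist p x / 2)"
      using small[OF xE] by metis
    have "dist p x / 2 \<le> dist p z" if "z \<in> P" for z
    proof -
      have "dist x z < dist p x / 2" using P(3) that by auto
      then show ?thesis using dist_triangle[of p x z] by (simp add: dist_commute)
    qed
    then have "clopen_in (insert p E) P"
      using clopen[OF _ _ d] P(1) unfolding clopen_in_def closedin_def by auto
    then show ?thesis using P by blast
  next
    case True
    show ?thesis
    proof (cases "E = {}")
      case True
      then show ?thesis using \<open>x = p\<close> V clopen_in_self[of "{p}"] by auto
    next
      case False
      \<comment> \<open>With the factor 1/3, distances from \<open>p\<close> vary within a piece by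
        a factor less than 2; hence the bound \<open>d / 2\<close> below.\<close>
      have "\<exists>P. clopen_in E P \<and> y \<in> P \<and> P \<subseteq> ball y (dist p y / 3)" if "y \<in> E" for y
        using small[OF that, of "ball y (dist p y / 3)"] that assms(2) by auto
      then obtain Q where Q: "\<And>y. y \<in> E \<Longrightarrow> clopen_in E (Q y)" "\<And>y. y \<in> E \<Longrightarrow> y \<in> Q y"
        "\<And>y. y \<in> E \<Longrightarrow> Q y \<subseteq> ball y (dist p y / 3)" by metis
      obtain \<F> where F: "\<F> \<subseteq> Q ` E" "countable \<F>" "\<Union>\<F> = \<Union> (Q ` E)"
        using Lindelof_openin[of "Q ` E" E] Q(1) unfolding clopen_in_def by blast
      obtain D where D: "D \<subseteq> E" "countable D" "\<F> = Q ` D" using F(1,2) by (meson countable_subset_image)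
      have QE: "\<Union> (Q ` E) = E" using Q clopen_in_subset by blast
      then have "D \<noteq> {}" using D(3) F(3) False by auto
      define q where "q = from_nat_into D"
      have q: "range q = D" unfolding q_def by (rule range_from_nat_into[OF \<open>D \<noteq> {}\<close> D(2)])
      have qE: "q n \<in> E" for n using q D(1) by blast
      have cover: "(\<Union>n. Q (q n)) = E" using q D(3) F(3) QE by (metis image_image)
      define R where "R n = Q (q n) - (\<Union>i<n. Q (q i))" for n
      have R: "clopen_in E (R n)" for n
        unfolding R_def by (intro clopen_in_Diff clopen_in_UN Q(1) qE) simp
      have Rcover: "\<exists>n. y \<in> R n" if "y \<in> E" for y
      proof -
        have ex: "\<exists>n. y \<in> Q (q n)" using cover that by blast
        define n where "n = (LEAST n. y \<in> Q (q n))"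
        have "y \<in> Q (q n)" unfolding n_def using ex by (rule LeastI_ex)
        moreover have "y \<notin> Q (q i)" if "i < n" for i using that not_less_Least unfolding n_def by blast
        ultimately have "y \<in> R n" unfolding R_def by blast
        then show ?thesis by blast
      qed
      have Rdis: "m = n" if "y \<in> R m" "y \<in> R n" for y m n
        using that unfolding R_def by (metis DiffD1 DiffD2 UN_I lessThan_iff linorder_neqE_nat)
      define B where "B = {n. \<not> R n \<subseteq> V}"
      define Q' where "Q' = (\<Union>n\<in>B. R n)"
      have "openin (top_of_set E) Q'" unfolding Q'_def using R unfolding clopen_in_def by blast
      moreover have EQ: "E - Q' = (\<Union>n\<in>-B. R n)"
      proof
        show "E - Q' \<subseteq> (\<Union>n\<in>-B. R n)" using Rcover unfolding Q'_def by blast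
        show "(\<Union>n\<in>-B. R n) \<subseteq> E - Q'"
        proof
          fix y assume "y \<in> (\<Union>n\<in>-B. R n)"
          then obtain n where n: "n \<notin> B" "y \<in> R n" by blast
          have "y \<notin> Q'" unfolding Q'_def using n Rdis by blast
          then show "y \<in> E - Q'" using n(2) clopen_in_subset[OF R] by blast
        qed
      qed
      moreover have "openin (top_of_set E) (\<Union>n\<in>-B. R n)" using R unfolding clopen_in_def by blast
      moreover obtain d where d: "d > 0" "ball p d \<subseteq> V" using V True open_contains_ball by blast
      moreover have "d / 2 \<le> dist p z" if z: "z \<in> Q'" for z
      proof -
        obtain n where n: "n \<in> B" "z \<in> R n" using z unfolding Q'_def by blast
        obtain w where w: "w \<in> R n" "w \<notin> V" using n(1) unfolding B_def by blast
        have "dist (q n) z < dist p (q n) / 3" "dist (q n) w < dist p (q n) / 3"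
          using n(2) w(1) Q(3)[OF qE, of n] unfolding R_def by auto
        moreover have "d \<le> dist p w" using w(2) d(2) by force
        moreover have "dist p w \<le> dist p (q n) + dist (q n) w" "dist p (q n) \<le> dist p z + dist (q n) z"
          by (metis dist_triangle, metis dist_triangle dist_commute)
        ultimately show ?thesis by linarith
      qed
      ultimately have "clopen_in (insert p E) Q'" using clopen[of Q' "d / 2"] by simp
      then have "clopen_in (insert p E) (insert p E - Q')" by (rule clopen_in_Diff[OF clopen_in_self])
      moreover have "p \<notin> Q'" using \<open>openin (top_of_set E) Q'\<close> openin_imp_subset assms(2) by blast
      moreover have "insert p E - Q' \<subseteq> V"
      proof -
        have "E - Q' \<subseteq> V" unfolding EQ B_def by blast
        then show ?thesis using V(2) True by blast
      qed
      ultimately show ?thesis using True by blast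
    qed
  qed
qed

section \<open>Clopen neighbourhoods of endpoints\<close>

context planar_dendroid
begin

lemma N_props:
  assumes "f p \<le> s" "s \<le> t" "m \<in> N s t"
  shows "m \<in> X" "f m = s"
  using assms r_in r(2) unfolding N_def by auto

text \<open>An endpoint is maximal, so the sets above its predecessors \<open>r s y\<close> shrink
  to \<open>y\<close> as \<open>s\<close> approaches \<open>f y\<close>, and some thickened one fits
  into \<open>V\<close>. Points of \<open>X\<close> near \<open>y\<close> rise above height
  \<open>t\<close> and have predecessors near \<open>c\<close>, so they belong to
  \<open>up M\<close>.\<close>

lemma small_up:
  assumes y: "y \<in> E" and V: "open V" "y \<in> V"
  obtains M s t where "f p < s" "s < t" "compact M" "M \<subseteq> N s t" "up M \<subseteq> V" "y \<notin> closure (X - up M)"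
proof -
  have yX: "y \<in> X" using y E_subset by blast
  have "p \<noteq> y" using y p_notin_E by blast
  then have py: "f p < f y" using strict_f[OF p_le[OF yX]] by blast
  have "\<exists>s. f p < s \<and> s < f y \<and> (X - V) \<inter> up {r s y} = {}"
  proof (rule ccontr)
    assume no: "\<not> ?thesis"
    \<comment> \<open>Heights strictly between \<open>f p\<close> and \<open>f y\<close> that tend
      to \<open>f y\<close>; the double successor keeps the factor below 1.\<close>
    define s where "s n = f y - (f y - f p) * inverse (real (Suc (Suc n)))" for n
    have s: "f p < s n" "s n < f y" for n
    proof -
      have "inverse (real (Suc (Suc n))) < 1" "inverse (real (Suc (Suc n))) > 0" by (auto simp: inverse_less_1_iff)
      then have "(f y - f p) * inverse (real (Suc (Suc n))) < (f y - f p) * 1" "0 < (f y - f p) * inverse (real (Suc (Suc n)))"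
        using py by (intro mult_strict_left_mono mult_pos_pos; simp)+
      then show "f p < s n" "s n < f y" unfolding s_def by simp_all
    qed
    have "s \<longlonglongrightarrow> f y - (f y - f p) * 0"
      unfolding s_def by (intro tendsto_intros LIMSEQ_inverse_real_of_nat[THEN LIMSEQ_Suc])
    then have "(\<lambda>n. r (s n) y) \<longlonglongrightarrow> r (f y) y"
      using s yX by (intro r_cont) (auto simp: less_imp_le)
    then have rs: "(\<lambda>n. r (s n) y) \<longlonglongrightarrow> y" using r_self[OF yX] by simp
    have "\<exists>z. z \<in> X - V \<and> le (r (s n) y) z" for n
      using no s[of n] unfolding up_def by blast
    then obtain z where z: "\<And>n. z n \<in> X - V" "\<And>n. le (r (s n) y) (z n)" by metis
    have "compact (X - V)" using compact_X V(1) by (rule compact_diff)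
    then obtain l q where q: "l \<in> X - V" "strict_mono q" "(z \<circ> q) \<longlonglongrightarrow> l"
      using z(1) unfolding compact_def by metis
    have "((\<lambda>n. r (s n) y) \<circ> q) \<longlonglongrightarrow> y" by (rule LIMSEQ_subseq_LIMSEQ[OF rs q(2)])
    then have "le y l" using le_closed[of "(\<lambda>n. r (s n) y) \<circ> q" "z \<circ> q"] z(2) q(3) by simp
    then have "l = y" using E_maximal[OF y] by blast
    then show False using q(1) V(2) by blast
  qed
  then obtain s where s: "f p < s" "s < f y" "(X - V) \<inter> up {r s y} = {}" by blast
  define c where "c = r s y"
  have cX: "c \<in> X" unfolding c_def using r_in[OF yX] s by simp
  have "compact (X - V)" using compact_X V(1) by (rule compact_diff)
  then obtain \<rho> where \<rho>: "\<rho> > 0" "(X - V) \<inter> thick c \<rho> = {}" using thick_avoids[OF _ _ cX] s(3) unfolding c_def by metis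
  define t where "t = (s + f y) / 2"
  have t: "s < t" "t < f y" unfolding t_def using s by auto
  define M where "M = N s t \<inter> cball c \<rho>"
  have "compact M" unfolding M_def using compact_N[of s t] s t by (intro compact_Int_closed) auto
  moreover have "M \<subseteq> X" unfolding M_def using N_props(1)[of s t] s t by auto
  then have "up M \<subseteq> thick c \<rho>" unfolding up_def thick_def M_def by blast
  then have "up M \<subseteq> V" using \<rho>(2) up_subset by blast
  moreover have "y \<notin> closure (X - up M)"
  proof
    assume "y \<in> closure (X - up M)"
    then obtain b where b: "\<And>n. b n \<in> X - up M" "b \<longlonglongrightarrow> y" unfolding closure_sequential by blast
    have "(\<lambda>n. f (b n)) \<longlonglongrightarrow> f y" using f_lim[of b y] b yX by blast
    then have "\<forall>\<^sub>F n in sequentially. t < f (b n)" using t(2) by (rule order_tendstoD)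
    then obtain n0 where n0: "\<And>n. n \<ge> n0 \<Longrightarrow> t < f (b n)" unfolding eventually_sequentially by blast
    define b' where "b' n = b (n + n0)" for n
    have b': "\<And>n. b' n \<in> X - up M" "b' \<longlonglongrightarrow> y" "\<And>n. t < f (b' n)"
      unfolding b'_def using b(1) LIMSEQ_ignore_initial_segment[OF b(2)] n0 by auto
    have "s \<le> f (b' n)" for n using b'(3)[of n] t(1) by simp
    then have "(\<lambda>n. r s (b' n)) \<longlonglongrightarrow> r s y"
      using b'(1,2) yX s(1) by (intro r_cont) auto
    then have "\<forall>\<^sub>F n in sequentially. dist (r s (b' n)) c < \<rho>" using \<rho>(1) unfolding c_def by (rule tendstoD)
    then obtain n where n: "dist (r s (b' n)) c < \<rho>" unfolding eventually_sequentially by blast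
    have bn: "b' n \<in> X" "s \<le> f (b' n)" "t \<le> f (b' n)" using b'(1,3)[of n] t by auto
    have "r s (b' n) \<in> M" unfolding M_def N_def using bn n by (auto simp: dist_commute)
    moreover have "le (r s (b' n)) (b' n)" using r(1)[OF bn(1) _ bn(2)] s(1) by simp
    ultimately show False using b'(1)[of n] unfolding up_def by blast
  qed
  moreover have "M \<subseteq> N s t" unfolding M_def by blast
  ultimately show thesis using that s(1) t(1) by blast
qed

text \<open>\<open>a\<close> is maximal and above no point of \<open>M\<close>, hence incomparable
  with each of them. \<open>separation\<close> gives a clopen set around \<open>a\<close> that
  misses everything above a disc at \<open>m\<close>, and finitely many such discs cover
  \<open>M\<close>.\<close>

lemma separation_from_up:
  assumes M: "compact M" "M \<subseteq> X" and a: "a \<in> E" "a \<notin> up M"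
  obtains Q where "clopen_in E Q" "a \<in> Q" "Q \<inter> up M = {}"
proof -
  have aX: "a \<in> X" using a E_subset by blast
  have "\<exists>\<rho> P. \<rho> > 0 \<and> clopen_in E P \<and> a \<in> P \<and> P \<inter> thick m \<rho> = {}" if "m \<in> M" for m
  proof -
    have mX: "m \<in> X" using that M by blast
    have n1: "\<not> le m a" using that a(2) unfolding up_def by blast
    have n2: "\<not> le a m"
    proof
      assume "le a m"
      then have "m = a" using E_maximal[OF a(1)] by blast
      then show False using n1 le_refl[OF aX] by simp
    qed
    obtain \<rho> P where P: "\<rho> > 0" "P \<subseteq> E" "closedin (top_of_set E) P" "closedin (top_of_set E) (E - P)"
      "E \<inter> thick a \<rho> \<subseteq> P" "E \<inter> thick m \<rho> \<inter> P = {}"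
      using separation[OF aX mX n2 n1] by metis
    have "clopen_in E P" unfolding clopen_in_def openin_closedin_eq using P(2,3,4) by simp
    moreover have "a \<in> cball a \<rho>" using P(1) by simp
    then have "a \<in> P" using P(5) a(1) cball_subset_thick by blast
    moreover have "P \<inter> thick m \<rho> = {}" using P(2,6) by blast
    ultimately show ?thesis using P(1) by blast
  qed
  then obtain \<rho> P where P: "\<And>m. m \<in> M \<Longrightarrow> \<rho> m > 0" "\<And>m. m \<in> M \<Longrightarrow> clopen_in E (P m)" "\<And>m. m \<in> M \<Longrightarrow> a \<in> P m"
    "\<And>m. m \<in> M \<Longrightarrow> P m \<inter> thick m (\<rho> m) = {}" by metis
  have "M \<subseteq> (\<Union>m\<in>M. ball m (\<rho> m))" using P(1) by force
  then obtain F where F: "F \<subseteq> M" "finite F" "M \<subseteq> (\<Union>m\<in>F. ball m (\<rho> m))"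
    using compactE_image[OF M(1), of M "\<lambda>m. ball m (\<rho> m)"] by (metis open_ball)
  define Q where "Q = E \<inter> (\<Inter>m\<in>F. P m)"
  show thesis
  proof (rule that[of Q])
    show "clopen_in E Q" unfolding Q_def using clopen_in_INT[OF F(2)] P(2) F(1) by blast
    show "a \<in> Q" unfolding Q_def using a(1) P(3) F(1) by blast
    show "Q \<inter> up M = {}"
    proof (rule ccontr)
      assume "Q \<inter> up M \<noteq> {}"
      then obtain z k where z: "z \<in> Q" "k \<in> M" "le k z" unfolding up_def by blast
      then obtain m where m: "m \<in> F" "k \<in> ball m (\<rho> m)" using F(3) by blast
      have "k \<in> X \<inter> cball m (\<rho> m)" using m(2) z(2) M(2) by auto
      then have "z \<in> thick m (\<rho> m)" unfolding thick_def up_def using z(3) by blast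
      then show False using P(4) m(1) F(1) z(1) unfolding Q_def by blast
    qed
  qed
qed

text \<open>Removing from \<open>E\<close> clopen neighbourhoods \<open>K i\<close> of the points \<open>a i\<close> of \<open>B\<close> leaves an open set
  because the \<open>i\<close>-th of them misses the first \<open>i\<close> sets of a cover of \<open>E - B\<close>.\<close>

lemma clopen_avoiding_countable:
  assumes B: "countable B" "B \<subseteq> E" "closedin (top_of_set E) B" and e: "e \<in> E" "e \<notin> B"
  obtains P where "clopen_in E P" "e \<in> P" "P \<inter> B = {}"
proof (cases "B = {}")
  case True
  then show thesis using that[OF clopen_in_self] e by blast
next
  case False
  define a where "a = from_nat_into B"
  have a: "range a = B" unfolding a_def by (rule range_from_nat_into[OF False B(1)])
  obtain T where T: "closed T" "B = E \<inter> T" using B(3) unfolding closedin_closed by blast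
  have "\<exists>M. compact M \<and> M \<subseteq> X \<and> up M \<inter> B = {} \<and> y \<notin> closure (X - up M)" if y: "y \<in> E - B" for y
  proof -
    have "y \<in> - T" "y \<in> E" "open (- T)" using y T by auto
    then obtain M s t where "f p < s" "s < t" "compact M" "M \<subseteq> N s t" "up M \<subseteq> - T" "y \<notin> closure (X - up M)"
      using small_up[of y "- T"] by metis
    moreover have "M \<subseteq> X" using N_props(1)[of s t] calculation by auto
    ultimately show ?thesis using T(2) by blast
  qed
  then obtain M where M: "\<And>y. y \<in> E - B \<Longrightarrow> compact (M y)" "\<And>y. y \<in> E - B \<Longrightarrow> M y \<subseteq> X"
    "\<And>y. y \<in> E - B \<Longrightarrow> up (M y) \<inter> B = {}" "\<And>y. y \<in> E - B \<Longrightarrow> y \<notin> closure (X - up (M y))" by metis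
  define G where "G y = - closure (X - up (M y))" for y
  have Gup: "G y \<inter> E \<subseteq> up (M y)" for y
    unfolding G_def using E_subset closure_subset[of "X - up (M y)"] by blast
  obtain \<F> where F: "\<F> \<subseteq> G ` (E - B)" "countable \<F>" "\<Union>\<F> = \<Union> (G ` (E - B))"
    using Lindelof_openin[of "G ` (E - B)" UNIV] unfolding G_def by (auto simp: subtopology_UNIV)
  obtain D where D: "D \<subseteq> E - B" "countable D" "\<F> = G ` D" using F(1,2) by (meson countable_subset_image)
  have cover: "\<exists>d\<in>D. y \<in> G d" if "y \<in> E - B" for y
  proof -
    have "y \<in> G y" unfolding G_def using M(4)[OF that] by simp
    then have "y \<in> \<Union>\<F>" unfolding F(3) using that by blast
    then show ?thesis using D(3) by blast
  qed
  \<comment> \<open>The point \<open>e\<close> comes first in the enumeration, so every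
    \<open>K i\<close> misses \<open>up (M e)\<close> and \<open>e\<close> is never removed.\<close>
  define y where "y n = (case n of 0 \<Rightarrow> e | Suc n \<Rightarrow> from_nat_into (insert e D) n)" for n
  have "range (from_nat_into (insert e D)) = insert e D" by (rule range_from_nat_into) (use D(2) in auto)
  then have y_surj: "\<exists>n. y n = d" if "d \<in> D" for d
    unfolding y_def using that by (metis insertI2 nat.simps(5) rangeE)
  have y0: "y 0 = e" unfolding y_def by simp
  have yE: "y n \<in> E - B" for n
  proof -
    have "from_nat_into (insert e D) k \<in> insert e D" for k by (rule from_nat_into) simp
    moreover have "insert e D \<subseteq> E - B" using D(1) e by auto
    ultimately have "from_nat_into (insert e D) k \<in> E - B" for k by blast
    then show ?thesis unfolding y_def using e by (cases n) auto
  qed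
  have "\<exists>Q. clopen_in E Q \<and> a i \<in> Q \<and> Q \<inter> up (M (y j)) = {}" for i j
  proof -
    have "a i \<in> B" using a by blast
    then have "a i \<in> E" "a i \<notin> up (M (y j))" using B(2) M(3)[OF yE] by blast+
    then show ?thesis using separation_from_up[OF M(1,2)[OF yE]] by metis
  qed
  then obtain Q where Q: "\<And>i j. clopen_in E (Q i j)" "\<And>i j. a i \<in> Q i j" "\<And>i j. Q i j \<inter> up (M (y j)) = {}" by metis
  define K where "K i = E \<inter> (\<Inter>j\<in>{..i}. Q i j)" for i
  have K: "clopen_in E (K i)" "a i \<in> K i" for i
    unfolding K_def using clopen_in_INT[of "{..i}"] Q(1,2) a B(2) by auto
  have Kup: "K i \<inter> up (M (y j)) = {}" if "j \<le> i" for i j unfolding K_def using Q(3)[of i j] that by blast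
  define P where "P = E - (\<Union>i. K i)"
  have eP: "e \<in> P"
  proof -
    have "e \<in> up (M e)" using Gup[of e] M(4)[of e] e unfolding G_def by blast
    then have "e \<notin> K i" for i using Kup[of 0 i] y0 by auto
    then show ?thesis unfolding P_def using e by blast
  qed
  have PB: "P \<inter> B = {}" unfolding P_def using K(2) a by blast
  have oK: "openin (top_of_set E) (\<Union>i. K i)" using K(1) unfolding clopen_in_def by blast
  \<comment> \<open>On the neighbourhood \<open>E \<inter> G (y j)\<close> of \<open>z\<close> only
    the sets \<open>K i\<close> with \<open>i < j\<close> are felt, and their finite union is
    clopen.\<close>
  have "openin (top_of_set E) P"
  proof (subst openin_subopen, intro ballI)
    fix z assume z: "z \<in> P"
    then have zE: "z \<in> E - B" using PB unfolding P_def by blast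
    obtain j where j: "z \<in> G (y j)" using cover[OF zE] y_surj by metis
    define H where "H = (E \<inter> G (y j)) - (\<Union>i<j. K i)"
    have "openin (top_of_set E) (E \<inter> G (y j))" unfolding G_def by (simp add: openin_open_Int open_Compl)
    moreover have "clopen_in E (\<Union>i<j. K i)" using K(1) by (intro clopen_in_UN) auto
    ultimately have "openin (top_of_set E) H" unfolding H_def clopen_in_def by (blast intro: openin_diff)
    moreover have "z \<in> H" unfolding H_def using z j zE unfolding P_def by blast
    moreover have "H \<subseteq> P"
    proof
      fix w assume w: "w \<in> H"
      have "w \<notin> K i" for i
      proof (cases "i < j")
        case True
        then show ?thesis using w unfolding H_def by blast
      next
        case False
        then show ?thesis using Kup[of j i] w Gup[of "y j"] unfolding H_def by auto
      qed
      then show "w \<in> P" using w unfolding H_def P_def by blast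
    qed
    ultimately show "\<exists>T. openin (top_of_set E) T \<and> z \<in> T \<and> T \<subseteq> P" by blast
  qed
  moreover have "closedin (top_of_set E) P" unfolding P_def using oK by (simp add: closedin_diff)
  ultimately show thesis using that[of P] eP PB unfolding clopen_in_def by blast
qed

text \<open>\<open>up M\<close> is closed, and within \<open>E\<close> it fails to be a
  neighbourhood only of the points of \<open>B\<close>. Each of the countably many \<open>m\<close>
  in \<open>M\<close> accounts for finitely many of these by \<open>finite_tripod\<close>; a clopen
  \<open>P\<close> around \<open>e\<close> that avoids \<open>B\<close> then meets
  \<open>up M\<close> in a clopen set.\<close>

lemma zero_dim_E:
  assumes cN: "\<And>s t. f p \<le> s \<Longrightarrow> s < t \<Longrightarrow> countable (N s t)"
  shows "zero_dim E"
  unfolding zero_dim_def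
proof (intro ballI allI impI, elim conjE)
  fix e V assume e: "e \<in> E" and V: "open V" "e \<in> V"
  obtain M s t where M: "f p < s" "s < t" "compact M" "M \<subseteq> N s t" "up M \<subseteq> V" "e \<notin> closure (X - up M)"
    using small_up[OF e V] by metis
  have "countable M" using cN[of s t] M(1,2,4) countable_subset by auto
  define B where "B = E \<inter> up M \<inter> closure (X - up M)"
  have "B \<subseteq> (\<Union>m\<in>M. {y \<in> E. le m y \<and> y \<in> closure (X - up {m})})"
  proof
    fix y assume y: "y \<in> B"
    then obtain m where m: "m \<in> M" "le m y" unfolding B_def up_def by blast
    have "X - up M \<subseteq> X - up {m}" using m(1) unfolding up_def by blast
    then have "y \<in> closure (X - up {m})" using y closure_mono unfolding B_def by blast
    then show "y \<in> (\<Union>m\<in>M. {y \<in> E. le m y \<and> y \<in> closure (X - up {m})})" using y m unfolding B_def by blast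
  qed
  moreover have "countable {y \<in> E. le m y \<and> y \<in> closure (X - up {m})}" if "m \<in> M" for m
  proof -
    have "f m = s" using N_props(2)[of s t m] M that by auto
    then have "m \<noteq> p" using M(1) by auto
    then show ?thesis by (rule countable_finite[OF finite_tripod])
  qed
  then have "countable (\<Union>m\<in>M. {y \<in> E. le m y \<and> y \<in> closure (X - up {m})})"
    by (rule countable_UN[OF \<open>countable M\<close>])
  ultimately have cB: "countable B" by (rule countable_subset)
  have clU: "closed (up M)" using compact_up[OF M(3)] by (rule compact_imp_closed)
  have "closedin (top_of_set E) B" unfolding B_def Int_assoc by (intro closedin_closed_Int closed_Int clU closed_closure)
  moreover have "e \<notin> B" "B \<subseteq> E" unfolding B_def using M(6) by auto
  ultimately obtain P where P: "clopen_in E P" "e \<in> P" "P \<inter> B = {}" using clopen_avoiding_countable[OF cB _ _ e] by metis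
  have PE: "P \<subseteq> E" by (rule clopen_in_subset[OF P(1)])
  have eU: "e \<in> up M" using M(6) closure_subset[of "X - up M"] e E_subset by blast
  have "closedin (top_of_set E) (P \<inter> up M)"
  proof -
    have "P \<inter> up M = P \<inter> (E \<inter> up M)" using PE by blast
    then show ?thesis using P(1) closedin_closed_Int[OF clU, of E] unfolding clopen_in_def by (metis closedin_Int)
  qed
  moreover have "openin (top_of_set E) (P \<inter> up M)"
  proof -
    have "P \<inter> up M = P \<inter> (E \<inter> - closure (X - up M))"
      using PE P(3) E_subset closure_subset[of "X - up M"] unfolding B_def by blast
    moreover have "openin (top_of_set E) (E \<inter> - closure (X - up M))" by (simp add: openin_open_Int open_Compl)
    ultimately show ?thesis using P(1) unfolding clopen_in_def by (metis openin_Int)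
  qed
  ultimately have "clopen_in E (P \<inter> up M)" unfolding clopen_in_def by simp
  then show "\<exists>P. clopen_in E P \<and> e \<in> P \<and> P \<subseteq> V" using P(2) eU M(5) by blast
qed

lemma dimension_endpoints:
  assumes cN: "\<And>s t. f p \<le> s \<Longrightarrow> s < t \<Longrightarrow> countable (N s t)"
  shows "dimension_le (top_of_set (endpoints X)) 0"
proof (rule dimension_le_zero)
  show "zero_dim (endpoints X)"
  proof (cases "p \<in> endpoints X")
    case True
    then have "endpoints X = insert p E" unfolding E_def by blast
    then show ?thesis using zero_dim_insert[OF zero_dim_E[OF cN] p_notin_E] by simp
  next
    case False
    then have "endpoints X = E" unfolding E_def by blast
    then show ?thesis using zero_dim_E[OF cN] by simp
  qed
qed

end

theorem corollary18:
  fixes X :: "(real ^ 2) set"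
  assumes "smooth_dendroid X"
    and "hereditarily_disconnected (endpoints X)"
    and "has_dimension (top_of_set (endpoints X)) 1"
  shows "\<exists>\<A>. cantor_set_of_arcs \<A> \<and> \<Union>\<A> \<subseteq> X"
proof -
  obtain p where p: "p \<in> X" and smooth: "\<And>s x. (\<And>n. s n \<in> X) \<Longrightarrow> x \<in> X \<Longrightarrow> s \<longlonglongrightarrow> x \<Longrightarrow>
      (\<lambda>n. hausdorff_dist (the_arc X (s n) p) (the_arc X x p)) \<longlonglongrightarrow> 0"
    using assms(1) unfolding smooth_dendroid_def by metis
  have d: "dendroid X" using assms(1) unfolding smooth_dendroid_def by blast
  interpret rooted_dendroid X p
    by unfold_locales (fact d, fact p, fact smooth)
  obtain f :: "real ^ 2 \<Rightarrow> real" where f: "continuous_on X f" "\<And>x y. le x y \<Longrightarrow> x \<noteq> y \<Longrightarrow> f x < f y"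
    using height_exists by metis
  interpret planar_dendroid X p f
    by unfold_locales (fact f assms)+
  have "\<not> dimension_le (top_of_set (endpoints X)) 0"
    using assms(3) unfolding has_dimension_def by simp
  \<comment> \<open>Contrapositive of the zero-dimensional case: if all these sets were countable,
    the endpoint set would have dimension at most 0.\<close>
  then obtain s t where "f p \<le> s" "s < t" "uncountable (N s t)" using dimension_endpoints by blast
  then show ?thesis by (rule Cantor_set_of_arcs_exists)
qed

end
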